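(* Let $1\leq q<\infty$. Property $q$-$(V)$ is not a three-space property; that is, there exist a Banach space $X$ and a closed subspace $X_0$ of $X$ such that both $X_0$ and $X/X_0$ have property $q$-$(V)$, but $X$ does not have property $q$-$(V)$.
   Context: Operators are bounded linear operators. For $1\le q<\infty$, a sequence $(x_n)_n$ in a Banach space $X$ is weakly $q$-summable if $\sum_{n}|\langle x^{*},x_n\rangle|^{q}<\infty$ for every $x^{*}\in X^{*}$; it is unconditionally $q$-summable if moreover $\sup\{(\sum_{n=m}^{\infty}|\langle x^{*},x_n\rangle|^{q})^{1/q}: x^{*}\in B_{X^{*}}\}\to 0$ as $m\to\infty$, where $B_{X^*}$ is the closed unit ball of $X^*$. An operator $T:X\to Y$ is unconditionally $q$-converging if it takes weakly $q$-summable sequences in $X$ to unconditionally $q$-summable sequences in $Y$. A Banach space $X$ has property $q$-$(V)$ (Pe{\l}czy\'nski's property $(V)$ of order $q$) if for every Banach space $Y$, every unconditionally $q$-converging operator $T:X\to Y$ is weakly compact. *)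

theory Defs
  imports "HOL-Analysis.Analysis" "HOL-Algebra.AbelCoset" "HOL-Algebra.Module"
begin

no_notation eq_closure_of (\<open>closure'_of\<index>\<close>)

text \<open>
  The statement quantifies existentially over Banach spaces and speaks about subspaces and
  quotients, so Banach spaces are carrier-based structures here: modules over the field of real
  numbers, extended by a norm.  The fields mult and one that the module record inherits from
  the ring record play no role.
\<close>

definition real_ring :: "real ring" where
  "real_ring =
     \<lparr>carrier = UNIV, monoid.mult = (\<lambda>a b. a * b), one = 1, zero = 0, add = (\<lambda>a b. a + b)\<rparr>"

record 'a nvs = "(real, 'a) module" +
  nrm :: "'a \<Rightarrow> real"

locale normed_space = module real_ring V for V :: "'a nvs" (structure) +
  assumes nrm_eq_0_iff: "x \<in> carrier V \<Longrightarrow> nrm V x = 0 \<longleftrightarrow> x = \<zero>"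
    and nrm_smult: "x \<in> carrier V \<Longrightarrow> nrm V (a \<odot> x) = \<bar>a\<bar> * nrm V x"
    and nrm_triangle: "x \<in> carrier V \<Longrightarrow> y \<in> carrier V \<Longrightarrow> nrm V (x \<oplus> y) \<le> nrm V x + nrm V y"

text \<open>The value 0 outside the carrier is needed because the locale \<^locale>\<open>Metric_space\<close> requires
  a distance to be symmetric and nonnegative on the whole type.\<close>

definition nrm_dist :: "'a nvs \<Rightarrow> 'a \<Rightarrow> 'a \<Rightarrow> real" where
  "nrm_dist V x y = (if x \<in> carrier V \<and> y \<in> carrier V then nrm V (x \<ominus>\<^bsub>V\<^esub> y) else 0)"

abbreviation nrm_topology :: "'a nvs \<Rightarrow> 'a topology" where
  "nrm_topology V \<equiv> Metric_space.mtopology (carrier V) (nrm_dist V)"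

definition banach_space :: "'a nvs \<Rightarrow> bool" where
  "banach_space V \<longleftrightarrow> normed_space V \<and> Metric_space.mcomplete (carrier V) (nrm_dist V)"

definition closed_subspace :: "'a nvs \<Rightarrow> 'a set \<Rightarrow> bool" where
  "closed_subspace V H \<longleftrightarrow>
     submodule H real_ring V \<and> closedin (nrm_topology V) H"

definition subspace_of :: "'a nvs \<Rightarrow> 'a set \<Rightarrow> 'a nvs" where
  "subspace_of V H = V\<lparr>carrier := H\<rparr>"

text \<open>The quotient space, with the cosets as points and the quotient norm.  The product of a
  scalar and a coset is formed as in \<open>rcoset_mult\<close> for quotient rings; the image of a coset under
  multiplication by 0 would not be a coset.\<close>

definition quotient_space :: "'a nvs \<Rightarrow> 'a set \<Rightarrow> 'a set nvs" where
  "quotient_space V H =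
     \<lparr>carrier = a_rcosets\<^bsub>V\<^esub> H, monoid.mult = (\<lambda>C D. H), one = H,
      zero = H, add = set_add V,
      smult = (\<lambda>a C. \<Union>x\<in>C. H +>\<^bsub>V\<^esub> (a \<odot>\<^bsub>V\<^esub> x)),
      nrm = (\<lambda>C. INF x\<in>C. nrm V x)\<rparr>"

text \<open>Functions on a space are relevant on its carrier only.\<close>

definition bounded_operator :: "'a nvs \<Rightarrow> 'b nvs \<Rightarrow> ('a \<Rightarrow> 'b) \<Rightarrow> bool" where
  "bounded_operator V W T \<longleftrightarrow>
     T \<in> carrier V \<rightarrow> carrier W \<and>
     (\<forall>x\<in>carrier V. \<forall>y\<in>carrier V. T (x \<oplus>\<^bsub>V\<^esub> y) = T x \<oplus>\<^bsub>W\<^esub> T y) \<and>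
     (\<forall>a. \<forall>x\<in>carrier V. T (a \<odot>\<^bsub>V\<^esub> x) = a \<odot>\<^bsub>W\<^esub> T x) \<and>
     (\<exists>K. \<forall>x\<in>carrier V. nrm W (T x) \<le> K * nrm V x)"

definition dual :: "'a nvs \<Rightarrow> ('a \<Rightarrow> real) set" where
  "dual V = {f.
     (\<forall>x\<in>carrier V. \<forall>y\<in>carrier V. f (x \<oplus>\<^bsub>V\<^esub> y) = f x + f y) \<and>
     (\<forall>a. \<forall>x\<in>carrier V. f (a \<odot>\<^bsub>V\<^esub> x) = a * f x) \<and>
     (\<exists>K. \<forall>x\<in>carrier V. \<bar>f x\<bar> \<le> K * nrm V x)}"

definition dual_ball :: "'a nvs \<Rightarrow> ('a \<Rightarrow> real) set" where
  "dual_ball V = {f \<in> dual V. \<forall>x\<in>carrier V. \<bar>f x\<bar> \<le> nrm V x}"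

definition weak_topology :: "'a nvs \<Rightarrow> 'a topology" where
  "weak_topology V =
     topology_generated_by {{x \<in> carrier V. f x \<in> U} | f U. f \<in> dual V \<and> open U}"

definition weakly_compact_operator :: "'a nvs \<Rightarrow> 'b nvs \<Rightarrow> ('a \<Rightarrow> 'b) \<Rightarrow> bool" where
  "weakly_compact_operator V W T \<longleftrightarrow>
     compactin (weak_topology W)
       (weak_topology W closure_of (T ` {x \<in> carrier V. nrm V x \<le> 1}))"

definition weakly_summable :: "real \<Rightarrow> 'a nvs \<Rightarrow> (nat \<Rightarrow> 'a) \<Rightarrow> bool" where
  "weakly_summable q V x \<longleftrightarrow>
     range x \<subseteq> carrier V \<and> (\<forall>f\<in>dual V. summable (\<lambda>n. \<bar>f (x n)\<bar> powr q))"

definition unconditionally_summable :: "real \<Rightarrow> 'a nvs \<Rightarrow> (nat \<Rightarrow> 'a) \<Rightarrow> bool" where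
  "unconditionally_summable q V x \<longleftrightarrow>
     weakly_summable q V x \<and>
     ((\<lambda>m. SUP f\<in>dual_ball V. ennreal ((\<Sum>n. \<bar>f (x (m + n))\<bar> powr q) powr (1 / q)))
        \<longlongrightarrow> 0) sequentially"

definition unconditionally_converging ::
    "real \<Rightarrow> 'a nvs \<Rightarrow> 'b nvs \<Rightarrow> ('a \<Rightarrow> 'b) \<Rightarrow> bool" where
  "unconditionally_converging q V W T \<longleftrightarrow>
     (\<forall>x. weakly_summable q V x \<longrightarrow> unconditionally_summable q W (\<lambda>n. T (x n)))"

text \<open>Pelczynski's property (V) of order q.  A definition in HOL cannot quantify over all types,
  so the codomains Y are the Banach spaces whose carriers are subsets of the type
  \<^typ>\<open>nat \<Rightarrow> 'a\<close>.  This is no restriction: the theorem \<open>property_V_every_codomain\<close> below shows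
  that the property implies the same for Banach spaces Y over arbitrary types.\<close>

definition property_V :: "real \<Rightarrow> 'a nvs \<Rightarrow> bool" where
  "property_V q X \<longleftrightarrow>
     banach_space X \<and>
     (\<forall>(Y :: (nat \<Rightarrow> 'a) nvs) T.
        banach_space Y \<and> bounded_operator X Y T \<and> unconditionally_converging q X Y T
          \<longrightarrow> weakly_compact_operator X Y T)"

text \<open>The rest of the theory validates the definitions: closed subspaces and quotients of Banach
  spaces are Banach spaces, and property (V) of order q covers codomains over all types.\<close>

lemma real_ring_simps [simp]:
  "carrier real_ring = UNIV" "a \<otimes>\<^bsub>real_ring\<^esub> b = a * b" "\<one>\<^bsub>real_ring\<^esub> = 1"
  "\<zero>\<^bsub>real_ring\<^esub> = 0" "a \<oplus>\<^bsub>real_ring\<^esub> b = a + b"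
  by (simp_all add: real_ring_def)

lemma cring_real_ring: "cring real_ring"
proof (rule cringI)
  show "abelian_group real_ring"
    by (rule abelian_groupI) (auto simp: algebra_simps intro: exI[of _ "- x" for x])
  show "comm_monoid real_ring"
    by (rule comm_monoidI) (auto simp: algebra_simps)
qed (simp add: algebra_simps)

lemma a_inv_real_ring [simp]: "\<ominus>\<^bsub>real_ring\<^esub> a = - a"
proof -
  interpret cring real_ring by (rule cring_real_ring)
  show ?thesis
    by (rule minus_equality) simp_all
qed

context normed_space
begin

lemma smult_add_left: "x \<in> carrier V \<Longrightarrow> (a + b) \<odot> x = a \<odot> x \<oplus> b \<odot> x"
  using smult_l_distr[of a b x] by simp

lemma smult_add_right:
  "x \<in> carrier V \<Longrightarrow> y \<in> carrier V \<Longrightarrow> a \<odot> (x \<oplus> y) = a \<odot> x \<oplus> a \<odot> y"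
  using smult_r_distr[of a x y] by simp

lemma smult_assoc: "x \<in> carrier V \<Longrightarrow> a \<odot> (b \<odot> x) = (a * b) \<odot> x"
  using smult_assoc1[of a b x] by simp

lemma smult_1 [simp]: "x \<in> carrier V \<Longrightarrow> 1 \<odot> x = x"
  using smult_one[of x] by simp

lemma smult_0 [simp]: "x \<in> carrier V \<Longrightarrow> 0 \<odot> x = \<zero>"
  using smult_l_null[of x] by simp

lemma smult_zero [simp]: "a \<odot> \<zero> = \<zero>"
  using smult_r_null[of a] by simp

lemma smult_neg: "x \<in> carrier V \<Longrightarrow> (- a) \<odot> x = \<ominus> (a \<odot> x)"
  using smult_l_minus[of a x] by simp

lemma a_inv_eq_smult: "x \<in> carrier V \<Longrightarrow> \<ominus> x = (-1) \<odot> x"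
  by (simp add: smult_neg)

lemma diff_eq_zero_iff:
  assumes "x \<in> carrier V" "y \<in> carrier V" shows "x \<ominus> y = \<zero> \<longleftrightarrow> x = y"
proof
  assume "x \<ominus> y = \<zero>"
  then have "(x \<oplus> \<ominus> y) \<oplus> y = y" using assms by (simp add: a_minus_def)
  then show "x = y" using assms by (simp add: M.a_assoc M.l_neg)
qed (use assms in \<open>simp add: a_minus_def M.r_neg\<close>)

lemma nrm_zero [simp]: "nrm V \<zero> = 0"
  by (simp add: nrm_eq_0_iff)

lemma nrm_a_inv [simp]: "x \<in> carrier V \<Longrightarrow> nrm V (\<ominus> x) = nrm V x"
  by (simp add: a_inv_eq_smult nrm_smult)

lemma nrm_nonneg [simp]: assumes "x \<in> carrier V" shows "0 \<le> nrm V x"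
proof -
  have "nrm V (x \<oplus> \<ominus> x) \<le> nrm V x + nrm V (\<ominus> x)"
    using assms by (intro nrm_triangle) auto
  then show ?thesis using assms by (simp add: M.r_neg)
qed

lemma nrm_diff_commute:
  assumes "x \<in> carrier V" "y \<in> carrier V" shows "nrm V (x \<ominus> y) = nrm V (y \<ominus> x)"
proof -
  have "\<ominus> (x \<ominus> y) = y \<ominus> x"
    using assms by (simp add: a_minus_def M.minus_add M.a_comm)
  then show ?thesis using assms by (metis nrm_a_inv M.minus_closed)
qed

lemma nrm_diff_triangle:
  assumes "x \<in> carrier V" "y \<in> carrier V" "z \<in> carrier V"
  shows "nrm V (x \<ominus> z) \<le> nrm V (x \<ominus> y) + nrm V (y \<ominus> z)"
proof -
  have "(x \<ominus> y) \<oplus> (y \<ominus> z) = x \<oplus> ((\<ominus> y \<oplus> y) \<oplus> \<ominus> z)"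
    unfolding a_minus_def using assms by (simp only: M.a_assoc M.a_inv_closed M.add.m_closed)
  also have "\<dots> = x \<ominus> z"
    using assms by (simp add: a_minus_def M.l_neg)
  finally have "(x \<ominus> y) \<oplus> (y \<ominus> z) = x \<ominus> z" .
  then show ?thesis using nrm_triangle[of "x \<ominus> y" "y \<ominus> z"] assms by simp
qed

lemma Metric_space_nrm_dist: "Metric_space (carrier V) (nrm_dist V)"
proof
  fix x y z
  show "0 \<le> nrm_dist V x y" "nrm_dist V x y = nrm_dist V y x"
    by (auto simp: nrm_dist_def nrm_diff_commute)
  assume "x \<in> carrier V" "y \<in> carrier V"
  then show "nrm_dist V x y = 0 \<longleftrightarrow> x = y"
    by (simp add: nrm_dist_def nrm_eq_0_iff diff_eq_zero_iff)
  assume "z \<in> carrier V"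
  with \<open>x \<in> carrier V\<close> \<open>y \<in> carrier V\<close> show "nrm_dist V x z \<le> nrm_dist V x y + nrm_dist V y z"
    by (simp add: nrm_dist_def nrm_diff_triangle)
qed

end

context normed_space
begin

lemma carrier_weak_topology [simp]: "topspace (weak_topology V) = carrier V"
proof -
  have "(\<lambda>x. 0) \<in> dual V" by (auto simp: dual_def intro: exI[of _ 0])
  then have "carrier V \<in> {{x \<in> carrier V. f x \<in> U} | f U. f \<in> dual V \<and> open U}"
    by (intro CollectI exI[of _ "\<lambda>x. 0"] exI[of _ UNIV]) auto
  then show ?thesis by (auto simp: weak_topology_def)
qed

text \<open>Graphs of linear functionals on subspaces that are bounded by \<open>C\<close>.\<close>

definition functional_graph :: "real \<Rightarrow> ('a \<times> real) set \<Rightarrow> bool" where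
  "functional_graph C G \<longleftrightarrow>
     G \<subseteq> carrier V \<times> UNIV \<and> (\<zero>, 0) \<in> G \<and>
     (\<forall>x r y s. (x, r) \<in> G \<longrightarrow> (y, s) \<in> G \<longrightarrow> (x \<oplus> y, r + s) \<in> G) \<and>
     (\<forall>a x r. (x, r) \<in> G \<longrightarrow> (a \<odot> x, a * r) \<in> G) \<and>
     (\<forall>x r. (x, r) \<in> G \<longrightarrow> r \<le> C * nrm V x)"

lemma functional_graphD:
  assumes "functional_graph C G"
  shows "(x, r) \<in> G \<Longrightarrow> x \<in> carrier V" "(\<zero>, 0) \<in> G"
    "(x, r) \<in> G \<Longrightarrow> (y, s) \<in> G \<Longrightarrow> (x \<oplus> y, r + s) \<in> G"
    "(x, r) \<in> G \<Longrightarrow> (a \<odot> x, a * r) \<in> G"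
    "(x, r) \<in> G \<Longrightarrow> r \<le> C * nrm V x"
  using assms unfolding functional_graph_def by blast+

lemma functional_graph_unique:
  assumes G: "functional_graph C G" and "(x, r) \<in> G" "(x, s) \<in> G"
  shows "r = s"
proof -
  have "r' \<le> s'" if "(x, r') \<in> G" "(x, s') \<in> G" for r' s'
  proof -
    have x: "x \<in> carrier V" using that functional_graphD(1)[OF G] by blast
    have "(x \<oplus> (-1) \<odot> x, r' + (-1) * s') \<in> G"
      using that by (intro functional_graphD(3,4)[OF G])
    moreover have "x \<oplus> (-1) \<odot> x = \<zero>" using x by (simp add: smult_neg M.r_neg)
    ultimately show ?thesis using functional_graphD(5)[OF G, of \<zero> "r' - s'"] by simp
  qed
  then show ?thesis using assms by (meson order_antisym)
qed

lemma functional_graph_extend: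
  assumes G: "functional_graph C G" and C: "0 \<le> C" and x0: "x0 \<in> carrier V"
  shows "\<exists>G'. functional_graph C G' \<and> G \<subseteq> G' \<and> (\<exists>a. (x0, a) \<in> G')"
proof -
  note GD = functional_graphD[OF G]
  define L where "L = {r - C * nrm V (x \<ominus> x0) | x r. (x, r) \<in> G}"
  have le: "r - C * nrm V (x \<ominus> x0) \<le> C * nrm V (y \<oplus> x0) - s"
    if "(x, r) \<in> G" "(y, s) \<in> G" for x r y s
  proof -
    have mem: "x \<in> carrier V" "y \<in> carrier V" using that GD(1) by blast+
    have "(x \<ominus> x0) \<oplus> (y \<oplus> x0) = (x \<ominus> x0) \<oplus> (x0 \<oplus> y)"
      using mem x0 by (simp add: M.a_comm)
    also have "\<dots> = x \<oplus> ((\<ominus> x0 \<oplus> x0) \<oplus> y)"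
      using mem x0 by (simp only: a_minus_def M.a_assoc M.a_inv_closed M.add.m_closed)
    also have "\<dots> = x \<oplus> y" using mem x0 by (simp add: M.l_neg)
    finally have "nrm V (x \<oplus> y) \<le> nrm V (x \<ominus> x0) + nrm V (y \<oplus> x0)"
      using nrm_triangle[of "x \<ominus> x0" "y \<oplus> x0"] mem x0 by simp
    then have "C * nrm V (x \<oplus> y) \<le> C * nrm V (x \<ominus> x0) + C * nrm V (y \<oplus> x0)"
      using C by (metis distrib_left mult_left_mono)
    moreover have "r + s \<le> C * nrm V (x \<oplus> y)" using GD(5)[OF GD(3)[OF that]] .
    ultimately show ?thesis by linarith
  qed
  define a where "a = Sup L"
  have "L \<noteq> {}" unfolding L_def using GD(2) by blast
  have "bdd_above L" unfolding L_def bdd_above_def using le[OF _ GD(2)] by blast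
  have lower: "r - C * nrm V (x \<ominus> x0) \<le> a" if "(x, r) \<in> G" for x r
    unfolding a_def by (rule cSup_upper) (use that \<open>bdd_above L\<close> in \<open>auto simp: L_def\<close>)
  have upper: "a \<le> C * nrm V (y \<oplus> x0) - s" if "(y, s) \<in> G" for y s
    unfolding a_def by (rule cSup_least[OF \<open>L \<noteq> {}\<close>]) (use le that in \<open>auto simp: L_def\<close>)
  define G' where "G' = {(x \<oplus> t \<odot> x0, r + t * a) | x r t. (x, r) \<in> G}"
  have "functional_graph C G'"
    unfolding functional_graph_def
  proof (intro conjI allI impI)
    show "G' \<subseteq> carrier V \<times> UNIV" unfolding G'_def using GD(1) x0 by auto
    show "(\<zero>, 0) \<in> G'"
      unfolding G'_def using GD(2) x0
      by (intro CollectI exI[of _ \<zero>] exI[of _ 0]) simp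
  next
    fix u r v s assume "(u, r) \<in> G'" "(v, s) \<in> G'"
    then obtain x r0 t y s0 t' where
      u: "u = x \<oplus> t \<odot> x0" "r = r0 + t * a" "(x, r0) \<in> G" and
      v: "v = y \<oplus> t' \<odot> x0" "s = s0 + t' * a" "(y, s0) \<in> G"
      unfolding G'_def by auto
    have mem: "x \<in> carrier V" "y \<in> carrier V" using u v GD(1) by blast+
    have "u \<oplus> v = (x \<oplus> y) \<oplus> (t + t') \<odot> x0"
      using mem x0 by (simp add: u v smult_add_left M.a_ac)
    moreover have "r + s = (r0 + s0) + (t + t') * a" by (simp add: u v algebra_simps)
    moreover have "(x \<oplus> y, r0 + s0) \<in> G" using GD(3)[OF u(3) v(3)] .
    ultimately show "(u \<oplus> v, r + s) \<in> G'" unfolding G'_def by blast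
  next
    fix c u r assume "(u, r) \<in> G'"
    then obtain x r0 t where u: "u = x \<oplus> t \<odot> x0" "r = r0 + t * a" "(x, r0) \<in> G"
      unfolding G'_def by auto
    have mem: "x \<in> carrier V" using u GD(1) by blast
    have "c \<odot> u = c \<odot> x \<oplus> (c * t) \<odot> x0" using mem x0 by (simp add: u smult_add_right smult_assoc)
    moreover have "c * r = c * r0 + (c * t) * a" by (simp add: u algebra_simps)
    moreover have "(c \<odot> x, c * r0) \<in> G" using GD(4)[OF u(3)] .
    ultimately show "(c \<odot> u, c * r) \<in> G'" unfolding G'_def by blast
  next
    fix u r assume "(u, r) \<in> G'"
    then obtain x r0 t where u: "u = x \<oplus> t \<odot> x0" "r = r0 + t * a" "(x, r0) \<in> G"
      unfolding G'_def by auto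
    have mem: "x \<in> carrier V" using u GD(1) by blast
    consider "t = 0" | "t > 0" | "t < 0" by linarith
    then show "r \<le> C * nrm V u"
    proof cases
      case 1 then show ?thesis using u mem x0 GD(5) by simp
    next
      case 2
      have G1: "((1/t) \<odot> x, (1/t) * r0) \<in> G" using GD(4)[OF u(3)] .
      have "u = t \<odot> ((1/t) \<odot> x \<oplus> x0)" using 2 mem x0 by (simp add: u smult_add_right smult_assoc)
      then have "nrm V u = t * nrm V ((1/t) \<odot> x \<oplus> x0)" using 2 mem x0 by (simp add: nrm_smult)
      moreover have "t * (a + (1/t) * r0) \<le> t * (C * nrm V ((1/t) \<odot> x \<oplus> x0))"
        using upper[OF G1] 2 by (intro mult_left_mono) auto
      moreover have "t * (a + (1/t) * r0) = r" using 2 by (simp add: u algebra_simps)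
      ultimately show ?thesis by (simp add: algebra_simps)
    next
      case 3
      define k where "k = - t"
      have k: "k > 0" "t = - k" using 3 by (auto simp: k_def)
      have G1: "((1/k) \<odot> x, (1/k) * r0) \<in> G" using GD(4)[OF u(3)] .
      have "u = k \<odot> ((1/k) \<odot> x \<ominus> x0)"
        using k mem x0
        by (simp add: u a_minus_def a_inv_eq_smult[OF x0] smult_add_right smult_assoc)
      then have "nrm V u = k * nrm V ((1/k) \<odot> x \<ominus> x0)" using k mem x0 by (simp add: nrm_smult)
      moreover have "k * ((1/k) * r0 - a) \<le> k * (C * nrm V ((1/k) \<odot> x \<ominus> x0))"
        using lower[OF G1] k by (intro mult_left_mono) auto
      moreover have "k * ((1/k) * r0 - a) = r" using k by (simp add: u algebra_simps)
      ultimately show ?thesis by (simp add: algebra_simps)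
    qed
  qed
  moreover have "G \<subseteq> G'"
  proof
    fix w assume "w \<in> G"
    moreover obtain x r where w: "w = (x, r)" by (cases w)
    ultimately have "(x, r) \<in> G" "x \<in> carrier V" using GD(1) by auto
    then show "w \<in> G'" unfolding w G'_def using x0
      by (intro CollectI exI[of _ x] exI[of _ r] exI[of _ 0]) simp
  qed
  moreover have "(x0, a) \<in> G'"
    unfolding G'_def using GD(2) x0 by (intro CollectI exI[of _ \<zero>] exI[of _ 0] exI[of _ 1]) simp
  ultimately show ?thesis by blast
qed

lemma functional_graph_Union:
  assumes "\<C> \<noteq> {}" and "\<And>G. G \<in> \<C> \<Longrightarrow> functional_graph C G"
    and chain: "\<And>G H. G \<in> \<C> \<Longrightarrow> H \<in> \<C> \<Longrightarrow> G \<subseteq> H \<or> H \<subseteq> G"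
  shows "functional_graph C (\<Union>\<C>)"
  unfolding functional_graph_def
proof (intro conjI allI impI)
  show "\<Union>\<C> \<subseteq> carrier V \<times> UNIV" using assms(2) unfolding functional_graph_def by blast
  show "(\<zero>, 0) \<in> \<Union>\<C>" using assms(1,2) functional_graphD(2) by blast
  fix x r assume xr: "(x, r) \<in> \<Union>\<C>"
  show "(c \<odot> x, c * r) \<in> \<Union>\<C>" for c using xr assms(2) functional_graphD(4) by (meson UnionE UnionI)
  show "r \<le> C * nrm V x" using xr assms(2) functional_graphD(5) by (meson UnionE)
  fix y s assume "(y, s) \<in> \<Union>\<C>"
  with xr obtain G H where GH: "G \<in> \<C>" "H \<in> \<C>" "(x, r) \<in> G" "(y, s) \<in> H" by blast
  define K where "K = (if G \<subseteq> H then H else G)"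
  have "K \<in> \<C>" "(x, r) \<in> K" "(y, s) \<in> K" using GH chain[of G H] by (auto simp: K_def)
  then show "(x \<oplus> y, r + s) \<in> \<Union>\<C>" using assms(2) functional_graphD(3) by (meson UnionI)
qed

theorem hahn_banach:
  assumes G0: "functional_graph C G0" and C: "0 \<le> C"
  shows "\<exists>f\<in>dual V. (\<forall>x\<in>carrier V. \<bar>f x\<bar> \<le> C * nrm V x) \<and> (\<forall>x r. (x, r) \<in> G0 \<longrightarrow> f x = r)"
proof -
  define A where "A = {G. functional_graph C G \<and> G0 \<subseteq> G}"
  have "\<exists>M\<in>A. \<forall>G\<in>A. M \<subseteq> G \<longrightarrow> G = M"
  proof (rule subset_Zorn_nonempty)
    show "A \<noteq> {}" using G0 by (auto simp: A_def)
    fix \<C> assume "\<C> \<noteq> {}" "subset.chain A \<C>"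
    then have sub: "\<C> \<subseteq> A" and chain: "\<And>G H. G \<in> \<C> \<Longrightarrow> H \<in> \<C> \<Longrightarrow> G \<subseteq> H \<or> H \<subseteq> G"
      by (auto simp: subset_chain_def)
    have "functional_graph C (\<Union>\<C>)"
      using \<open>\<C> \<noteq> {}\<close> sub chain by (intro functional_graph_Union) (auto simp: A_def)
    moreover have "G0 \<subseteq> \<Union>\<C>" using \<open>\<C> \<noteq> {}\<close> sub unfolding A_def by blast
    ultimately show "\<Union>\<C> \<in> A" by (simp add: A_def)
  qed
  then obtain M where "M \<in> A" and maxA: "\<forall>G\<in>A. M \<subseteq> G \<longrightarrow> G = M" ..
  then have M: "functional_graph C M" "G0 \<subseteq> M" by (simp_all add: A_def)
  have max: "G = M" if "functional_graph C G" "M \<subseteq> G" for G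
    using maxA that M(2) by (simp add: A_def)
  note MD = functional_graphD[OF M(1)]
  have total: "\<exists>r. (x, r) \<in> M" if "x \<in> carrier V" for x
    using functional_graph_extend[OF M(1) C that] max by metis
  define f where "f x = (THE r. (x, r) \<in> M)" for x
  have fI: "f x = r" if "(x, r) \<in> M" for x r
    unfolding f_def using that functional_graph_unique[OF M(1)] by blast
  have fM: "(x, f x) \<in> M" if "x \<in> carrier V" for x
    using total[OF that] fI by blast
  have lin1: "f (x \<oplus> y) = f x + f y" if "x \<in> carrier V" "y \<in> carrier V" for x y
    using that by (intro fI MD(3) fM)
  have lin2: "f (a \<odot> x) = a * f x" if "x \<in> carrier V" for a x
    using that by (intro fI MD(4) fM)
  have bd: "\<bar>f x\<bar> \<le> C * nrm V x" if x: "x \<in> carrier V" for x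
  proof -
    have "f x \<le> C * nrm V x" using MD(5)[OF fM[OF x]] .
    moreover have "f ((-1) \<odot> x) \<le> C * nrm V ((-1) \<odot> x)" using MD(5) fM x by simp
    ultimately show ?thesis using x by (simp add: lin2 nrm_smult)
  qed
  have "f \<in> dual V" unfolding dual_def using lin1 lin2 bd by blast
  then show ?thesis using bd fI M(2) by blast
qed

lemma dual_separates:
  assumes v: "v \<in> carrier V" "v \<noteq> \<zero>"
  shows "\<exists>f\<in>dual V. f v \<noteq> 0"
proof -
  have "functional_graph 1 {(t \<odot> v, t * nrm V v) | t. True}"
    unfolding functional_graph_def
  proof (intro conjI allI impI)
    show "{(t \<odot> v, t * nrm V v) | t. True} \<subseteq> carrier V \<times> UNIV" using v by auto
    show "(\<zero>, 0) \<in> {(t \<odot> v, t * nrm V v) | t. True}"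
      using v by (intro CollectI exI[of _ 0]) simp
    fix x r assume "(x, r) \<in> {(t \<odot> v, t * nrm V v) | t. True}"
    then obtain t where t: "x = t \<odot> v" "r = t * nrm V v" by auto
    show "(a \<odot> x, a * r) \<in> {(t \<odot> v, t * nrm V v) | t. True}" for a
      using v by (intro CollectI exI[of _ "a * t"]) (simp add: t smult_assoc)
    show "r \<le> 1 * nrm V x" using v by (simp add: t nrm_smult mult_right_mono)
    fix y s assume "(y, s) \<in> {(t \<odot> v, t * nrm V v) | t. True}"
    then obtain t' where t': "y = t' \<odot> v" "s = t' * nrm V v" by auto
    show "(x \<oplus> y, r + s) \<in> {(t \<odot> v, t * nrm V v) | t. True}"
      using v by (intro CollectI exI[of _ "t + t'"]) (simp add: t t' smult_add_left distrib_right)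
  qed
  from hahn_banach[OF this] obtain f where f: "f \<in> dual V"
    and eq: "\<And>x r. (x, r) \<in> {(t \<odot> v, t * nrm V v) | t. True} \<Longrightarrow> f x = r" by auto
  have "f (1 \<odot> v) = 1 * nrm V v" by (rule eq) blast
  then show ?thesis using v nrm_eq_0_iff f by (intro bexI[of _ f]) auto
qed

lemma Hausdorff_weak_topology: "Hausdorff_space (weak_topology V)"
  unfolding Hausdorff_space_def
proof (intro allI impI, elim conjE)
  fix x y assume "x \<in> topspace (weak_topology V)" "y \<in> topspace (weak_topology V)" "x \<noteq> y"
  then have xy: "x \<in> carrier V" "y \<in> carrier V" "x \<ominus> y \<noteq> \<zero>"
    by (simp_all add: diff_eq_zero_iff)
  then obtain f where f: "f \<in> dual V" "f (x \<ominus> y) \<noteq> 0" using dual_separates by blast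
  have "f (x \<oplus> (-1) \<odot> y) = f x + (-1) * f y"
    using f(1) xy unfolding dual_def by simp
  then have "f x \<noteq> f y" using f(2) xy by (simp add: a_minus_def a_inv_eq_smult)
  then obtain U W where UW: "open U" "open W" "f x \<in> U" "f y \<in> W" "U \<inter> W = {}"
    using hausdorff[of "f x" "f y"] by metis
  have "openin (weak_topology V) {z \<in> carrier V. f z \<in> S}" if "open S" for S
    unfolding weak_topology_def using f(1) that
    by (intro topology_generated_by_Basis CollectI exI[of _ f] exI[of _ S]) simp
  then show "\<exists>U W. openin (weak_topology V) U \<and> openin (weak_topology V) W \<and>
      x \<in> U \<and> y \<in> W \<and> disjnt U W"
    using UW xy
    by (intro exI[of _ "{z \<in> carrier V. f z \<in> U}"] exI[of _ "{z \<in> carrier V. f z \<in> W}"])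
       (auto simp: disjnt_iff)
qed

end

lemma carrier_subspace_of [simp]: "carrier (subspace_of V H) = H"
  and nrm_subspace_of [simp]: "nrm (subspace_of V H) = nrm V"
  and zero_subspace_of [simp]: "\<zero>\<^bsub>subspace_of V H\<^esub> = \<zero>\<^bsub>V\<^esub>"
  and add_subspace_of [simp]: "x \<oplus>\<^bsub>subspace_of V H\<^esub> y = x \<oplus>\<^bsub>V\<^esub> y"
  and smult_subspace_of [simp]: "a \<odot>\<^bsub>subspace_of V H\<^esub> x = a \<odot>\<^bsub>V\<^esub> x"
  by (simp_all add: subspace_of_def)

lemma normed_space_subspace_of:
  assumes "normed_space V" "submodule H real_ring V"
  shows "normed_space (subspace_of V H)"
proof -
  interpret normed_space V by (rule assms)
  have "H \<subseteq> carrier V" by (rule submoduleE(1)[OF assms(2)])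
  then show ?thesis
    using submodule.submodule_is_module[OF assms(2) module_axioms]
    by (intro normed_space.intro normed_space_axioms.intro)
       (auto simp: subspace_of_def nrm_smult nrm_eq_0_iff intro!: nrm_triangle)
qed

lemma diff_subspace_of:
  assumes "normed_space V" "submodule H real_ring V" "x \<in> H" "y \<in> H"
  shows "x \<ominus>\<^bsub>subspace_of V H\<^esub> y = x \<ominus>\<^bsub>V\<^esub> y"
proof -
  interpret V: normed_space V by (rule assms)
  interpret W: normed_space "subspace_of V H" by (rule normed_space_subspace_of[OF assms(1,2)])
  have "y \<in> carrier V" using V.submoduleE(1)[OF assms(2)] assms(4) by blast
  then show ?thesis using assms(4) by (simp add: a_minus_def V.a_inv_eq_smult W.a_inv_eq_smult)
qed

lemma banach_space_subspace_of:
  assumes V: "banach_space V" and H: "closed_subspace V H"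
  shows "banach_space (subspace_of V H)"
proof -
  have ns: "normed_space V" using V by (simp add: banach_space_def)
  have sub: "submodule H real_ring V" and clo: "closedin (nrm_topology V) H"
    using H by (simp_all add: closed_subspace_def)
  interpret V: normed_space V by (rule ns)
  have HV: "H \<subseteq> carrier V" by (rule V.submoduleE(1)[OF sub])
  interpret VM: Metric_space "carrier V" "nrm_dist V" by (rule V.Metric_space_nrm_dist)
  interpret S: Submetric "carrier V" "nrm_dist V" H by unfold_locales (rule HV)
  interpret W: normed_space "subspace_of V H" by (rule normed_space_subspace_of[OF ns sub])
  interpret WM: Metric_space H "nrm_dist (subspace_of V H)"
    using W.Metric_space_nrm_dist by simp
  have eq: "nrm_dist (subspace_of V H) x y = nrm_dist V x y" if "x \<in> H" "y \<in> H" for x y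
    using that HV by (auto simp: nrm_dist_def diff_subspace_of[OF ns sub])
  have "S.sub.mcomplete"
    using S.closedin_mcomplete_imp_mcomplete[OF clo] V by (simp add: banach_space_def)
  have "WM.mcomplete"
    unfolding WM.mcomplete_def
  proof (intro allI impI)
    fix \<sigma> assume "WM.MCauchy \<sigma>"
    then have \<sigma>: "range \<sigma> \<subseteq> H" and "S.sub.MCauchy \<sigma>"
      by (auto simp: WM.MCauchy_def S.sub.MCauchy_def eq range_subsetD)
    then obtain l where "limitin S.sub.mtopology \<sigma> l sequentially"
      using \<open>S.sub.mcomplete\<close> by (auto simp: S.sub.mcomplete_def)
    then have "l \<in> H" "(\<lambda>n. nrm_dist V (\<sigma> n) l) \<longlonglongrightarrow> 0"
      by (auto simp: S.sub.limitin_metric_dist_null)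
    then have "limitin WM.mtopology \<sigma> l sequentially"
      using \<sigma> by (simp add: WM.limitin_metric_dist_null eq range_subsetD)
    then show "\<exists>l. limitin WM.mtopology \<sigma> l sequentially" by blast
  qed
  then show ?thesis using W.normed_space_axioms by (simp add: banach_space_def)
qed

definition transport :: "'a nvs \<Rightarrow> ('a \<Rightarrow> 'b) \<Rightarrow> 'b nvs" where
  "transport V s = (let p = inv_into (carrier V) s in
     \<lparr>carrier = s ` carrier V, monoid.mult = (\<lambda>u v. u), one = s \<zero>\<^bsub>V\<^esub>, zero = s \<zero>\<^bsub>V\<^esub>,
      add = (\<lambda>u v. s (p u \<oplus>\<^bsub>V\<^esub> p v)), smult = (\<lambda>a u. s (a \<odot>\<^bsub>V\<^esub> p u)), nrm = (\<lambda>u. nrm V (p u))\<rparr>)"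

lemma transport_simps:
  assumes "inj_on s (carrier V)"
  shows "carrier (transport V s) = s ` carrier V"
    "\<zero>\<^bsub>transport V s\<^esub> = s \<zero>\<^bsub>V\<^esub>"
    "x \<in> carrier V \<Longrightarrow> y \<in> carrier V \<Longrightarrow> s x \<oplus>\<^bsub>transport V s\<^esub> s y = s (x \<oplus>\<^bsub>V\<^esub> y)"
    "x \<in> carrier V \<Longrightarrow> a \<odot>\<^bsub>transport V s\<^esub> s x = s (a \<odot>\<^bsub>V\<^esub> x)"
    "x \<in> carrier V \<Longrightarrow> nrm (transport V s) (s x) = nrm V x"
  using assms by (simp_all add: transport_def Let_def)

lemma normed_space_transport:
  assumes "normed_space V" and inj: "inj_on s (carrier V)"
  shows "normed_space (transport V s)"
proof -
  interpret normed_space V by (rule assms)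
  note [simp] = transport_simps[OF inj]
  have "abelian_group (transport V s)"
  proof (rule abelian_groupI)
    fix u assume "u \<in> carrier (transport V s)"
    then obtain x where "u = s x" "x \<in> carrier V" by auto
    then show "\<exists>v\<in>carrier (transport V s). v \<oplus>\<^bsub>transport V s\<^esub> u = \<zero>\<^bsub>transport V s\<^esub>"
      by (intro bexI[of _ "s (\<ominus>\<^bsub>V\<^esub> x)"]) (auto simp: M.l_neg)
  qed (auto simp: M.a_ac)
  then have "module real_ring (transport V s)"
    by (intro moduleI cring_real_ring)
       (auto simp: smult_add_left smult_add_right smult_assoc)
  then show ?thesis
    by (intro normed_space.intro normed_space_axioms.intro)
       (auto simp: nrm_eq_0_iff nrm_smult nrm_triangle inj_on_eq_iff[OF inj])
qed

lemma banach_space_transport: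
  assumes V: "banach_space V" and inj: "inj_on s (carrier V)"
  shows "banach_space (transport V s)"
proof -
  have ns: "normed_space V" using V by (simp add: banach_space_def)
  interpret V: normed_space V by (rule ns)
  interpret W: normed_space "transport V s" by (rule normed_space_transport[OF ns inj])
  interpret VM: Metric_space "carrier V" "nrm_dist V" by (rule V.Metric_space_nrm_dist)
  interpret WM: Metric_space "carrier (transport V s)" "nrm_dist (transport V s)"
    by (rule W.Metric_space_nrm_dist)
  note [simp] = transport_simps[OF inj]
  have dist: "nrm_dist (transport V s) (s x) (s y) = nrm_dist V x y"
    if "x \<in> carrier V" "y \<in> carrier V" for x y
    using that by (simp add: nrm_dist_def a_minus_def V.a_inv_eq_smult W.a_inv_eq_smult)
  have "WM.mcomplete"
    unfolding WM.mcomplete_def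
  proof (intro allI impI)
    fix \<sigma> assume \<sigma>: "WM.MCauchy \<sigma>"
    define \<tau> where "\<tau> n = inv_into (carrier V) s (\<sigma> n)" for n
    have \<tau>: "\<tau> n \<in> carrier V" "\<sigma> n = s (\<tau> n)" for n
    proof -
      have "\<sigma> n \<in> carrier (transport V s)"
        using \<sigma> unfolding WM.MCauchy_def by blast
      then have "\<sigma> n \<in> s ` carrier V" by simp
      then show "\<tau> n \<in> carrier V" "\<sigma> n = s (\<tau> n)"
        by (simp_all add: \<tau>_def inv_into_into f_inv_into_f)
    qed
    have "VM.MCauchy \<tau>"
      using \<sigma> \<tau>(1) unfolding WM.MCauchy_def VM.MCauchy_def by (simp add: \<tau>(2) dist image_subset_iff)
    then obtain l where "limitin VM.mtopology \<tau> l sequentially"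
      using V by (auto simp: banach_space_def VM.mcomplete_def)
    then have "l \<in> carrier V" "(\<lambda>n. nrm_dist V (\<tau> n) l) \<longlonglongrightarrow> 0"
      by (auto simp: VM.limitin_metric_dist_null)
    then have "limitin WM.mtopology \<sigma> (s l) sequentially"
      unfolding WM.limitin_metric_dist_null using \<tau>(1) by (simp add: \<tau>(2) dist)
    then show "\<exists>l. limitin WM.mtopology \<sigma> l sequentially" by blast
  qed
  then show ?thesis using W.normed_space_axioms by (simp add: banach_space_def)
qed

lemma continuous_map_weak_topology:
  assumes V: "normed_space V" and W: "normed_space W" and T: "T \<in> carrier V \<rightarrow> carrier W"
    and dual: "\<And>f. f \<in> dual W \<Longrightarrow> (\<lambda>x. f (T x)) \<in> dual V"
  shows "continuous_map (weak_topology V) (weak_topology W) T"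
proof -
  note top = normed_space.carrier_weak_topology[OF V] normed_space.carrier_weak_topology[OF W]
  have "openin (weak_topology V) (T -` S \<inter> topspace (weak_topology V))"
    if mem: "S \<in> {{x \<in> carrier W. f x \<in> U} | f U. f \<in> dual W \<and> open U}" for S
  proof -
    obtain f U where S: "S = {x \<in> carrier W. f x \<in> U}" "f \<in> dual W" "open U" using mem by blast
    have "T -` S \<inter> topspace (weak_topology V) = {x \<in> carrier V. f (T x) \<in> U}"
      using T by (auto simp: S top)
    moreover have "openin (weak_topology V) {x \<in> carrier V. f (T x) \<in> U}"
      unfolding weak_topology_def using dual[OF S(2)] S(3)
      by (intro topology_generated_by_Basis CollectI exI[of _ "\<lambda>x. f (T x)"] exI[of _ U]) simp
    ultimately show ?thesis by simp
  qed
  moreover have "T ` topspace (weak_topology V) \<subseteq> topspace (weak_topology W)"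
    using T by (auto simp: top)
  ultimately have "continuous_map (weak_topology V)
      (topology_generated_by {{x \<in> carrier W. f x \<in> U} | f U. f \<in> dual W \<and> open U}) T"
    by (intro continuous_on_generated_topo) (simp_all add: weak_topology_def)
  then show ?thesis by (simp add: weak_topology_def)
qed

text \<open>The codomain is first replaced by the closure of the range of the operator (functionals
  extend by the Hahn-Banach theorem), and the closure is then copied to sequences in X.\<close>

theorem property_V_every_codomain:
  fixes X :: "'a nvs" and Y :: "'b nvs"
  assumes pV: "property_V q X" and Y: "banach_space Y"
    and T: "bounded_operator X Y T" and conv: "unconditionally_converging q X Y T"
  shows "weakly_compact_operator X Y T"
proof -
  have nX: "normed_space X" and nY: "normed_space Y"
    using pV Y by (auto simp: property_V_def banach_space_def)
  interpret X: normed_space X by (rule nX)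
  interpret Y: normed_space Y by (rule nY)
  interpret YM: Metric_space "carrier Y" "nrm_dist Y" by (rule Y.Metric_space_nrm_dist)
  have Tmem [simp]: "\<And>x. x \<in> carrier X \<Longrightarrow> T x \<in> carrier Y"
    and Tadd: "\<And>x y. x \<in> carrier X \<Longrightarrow> y \<in> carrier X \<Longrightarrow> T (x \<oplus>\<^bsub>X\<^esub> y) = T x \<oplus>\<^bsub>Y\<^esub> T y"
    and Tsmult: "\<And>a x. x \<in> carrier X \<Longrightarrow> T (a \<odot>\<^bsub>X\<^esub> x) = a \<odot>\<^bsub>Y\<^esub> T x"
    using T by (auto simp: bounded_operator_def)
  obtain K where K: "\<forall>x\<in>carrier X. nrm Y (T x) \<le> K * nrm X x"
    using T by (auto simp: bounded_operator_def)

  text \<open>\<open>Z\<close> is the closure of the range of \<open>T\<close>.\<close>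
  define Z where "Z = nrm_topology Y closure_of (T ` carrier X)"
  define approx where "approx x z \<longleftrightarrow> (\<forall>n::nat. x n \<in> carrier X) \<and>
    (\<lambda>n. nrm Y (T (x n) \<ominus>\<^bsub>Y\<^esub> z)) \<longlonglongrightarrow> 0" for x z
  have Z_iff: "z \<in> Z \<longleftrightarrow> z \<in> carrier Y \<and> (\<exists>x. approx x z)" for z
  proof
    assume "z \<in> Z"
    then obtain \<sigma> where z: "z \<in> carrier Y" and \<sigma>: "range \<sigma> \<subseteq> T ` carrier X"
      and lim: "(\<lambda>n. nrm_dist Y (\<sigma> n) z) \<longlonglongrightarrow> 0"
      by (auto simp: Z_def YM.closure_of_sequentially YM.limitin_metric_dist_null)
    have "\<forall>n. \<exists>x\<in>carrier X. \<sigma> n = T x" using \<sigma> by blast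
    then obtain x where x: "\<And>n. x n \<in> carrier X" "\<And>n. \<sigma> n = T (x n)" by metis
    have "approx x z" using x lim z by (simp add: approx_def nrm_dist_def)
    then show "z \<in> carrier Y \<and> (\<exists>x. approx x z)" using z by blast
  next
    assume "z \<in> carrier Y \<and> (\<exists>x. approx x z)"
    then obtain x where "z \<in> carrier Y" "approx x z" by blast
    then show "z \<in> Z"
      by (auto simp: Z_def YM.closure_of_sequentially YM.limitin_metric_dist_null approx_def
          nrm_dist_def intro!: exI[of _ "\<lambda>n. T (x n)"])
  qed
  have TZ [simp]: "T x \<in> Z" if "x \<in> carrier X" for x
  proof -
    have "T x \<ominus>\<^bsub>Y\<^esub> T x = \<zero>\<^bsub>Y\<^esub>" using that Y.diff_eq_zero_iff[of "T x" "T x"] by simp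
    then have "approx (\<lambda>n. x) (T x)" using that by (simp add: approx_def)
    then show ?thesis using that by (auto simp: Z_iff)
  qed
  have ZY: "Z \<subseteq> carrier Y" using Z_iff by blast
  have Zadd: "z \<oplus>\<^bsub>Y\<^esub> w \<in> Z" if "z \<in> Z" "w \<in> Z" for z w
  proof -
    obtain x y where xy: "approx x z" "approx y w" and mem: "z \<in> carrier Y" "w \<in> carrier Y"
      using \<open>z \<in> Z\<close> \<open>w \<in> Z\<close> by (auto simp: Z_iff)
    have car: "\<And>n. x n \<in> carrier X" "\<And>n. y n \<in> carrier X" using xy by (auto simp: approx_def)
    have eq: "T (x n \<oplus>\<^bsub>X\<^esub> y n) \<ominus>\<^bsub>Y\<^esub> (z \<oplus>\<^bsub>Y\<^esub> w) = (T (x n) \<ominus>\<^bsub>Y\<^esub> z) \<oplus>\<^bsub>Y\<^esub> (T (y n) \<ominus>\<^bsub>Y\<^esub> w)" for n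
      using car mem by (simp add: Tadd a_minus_def Y.M.minus_add Y.M.a_ac)
    have "(\<lambda>n. nrm Y (T (x n) \<ominus>\<^bsub>Y\<^esub> z) + nrm Y (T (y n) \<ominus>\<^bsub>Y\<^esub> w)) \<longlonglongrightarrow> 0"
      using xy by (auto simp: approx_def intro: tendsto_add_zero)
    then have "(\<lambda>n. nrm Y (T (x n \<oplus>\<^bsub>X\<^esub> y n) \<ominus>\<^bsub>Y\<^esub> (z \<oplus>\<^bsub>Y\<^esub> w))) \<longlonglongrightarrow> 0"
      unfolding eq using car mem
      by (rule_tac tendsto_sandwich[OF _ _ tendsto_const])
         (auto intro!: always_eventually Y.nrm_triangle)
    then have "approx (\<lambda>n. x n \<oplus>\<^bsub>X\<^esub> y n) (z \<oplus>\<^bsub>Y\<^esub> w)" using car by (simp add: approx_def)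
    then show ?thesis using mem by (auto simp: Z_iff)
  qed
  have Zsmult: "a \<odot>\<^bsub>Y\<^esub> z \<in> Z" if "z \<in> Z" for a z
  proof -
    obtain x where x: "approx x z" and mem: "z \<in> carrier Y"
      using \<open>z \<in> Z\<close> by (auto simp: Z_iff)
    have car: "\<And>n. x n \<in> carrier X" using x by (auto simp: approx_def)
    have eq: "T (a \<odot>\<^bsub>X\<^esub> x n) \<ominus>\<^bsub>Y\<^esub> (a \<odot>\<^bsub>Y\<^esub> z) = a \<odot>\<^bsub>Y\<^esub> (T (x n) \<ominus>\<^bsub>Y\<^esub> z)" for n
      using car mem by (simp add: Tsmult a_minus_def Y.a_inv_eq_smult Y.smult_add_right Y.smult_assoc)
    have "(\<lambda>n. \<bar>a\<bar> * nrm Y (T (x n) \<ominus>\<^bsub>Y\<^esub> z)) \<longlonglongrightarrow> 0"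
      using x by (auto simp: approx_def intro: tendsto_mult_right_zero)
    then have "approx (\<lambda>n. a \<odot>\<^bsub>X\<^esub> x n) (a \<odot>\<^bsub>Y\<^esub> z)"
      using car mem by (simp add: approx_def eq Y.nrm_smult)
    then show ?thesis using mem by (auto simp: Z_iff)
  qed
  have "\<zero>\<^bsub>Y\<^esub> \<in> Z" using Zsmult[of "T \<zero>\<^bsub>X\<^esub>" 0] by simp
  moreover have "\<ominus>\<^bsub>Y\<^esub> z \<in> Z" if "z \<in> Z" for z
    using that Zsmult[of z "-1"] ZY by (auto simp: Y.a_inv_eq_smult)
  ultimately have sub: "submodule Z real_ring Y"
    using ZY Zadd Zsmult by (intro Y.submoduleI) auto
  have cZ: "closed_subspace Y Z" using sub by (simp add: closed_subspace_def Z_def)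

  text \<open>A copy \<open>W\<close> of \<open>Z\<close> in the type of sequences: represent a point by a sequence in \<open>X\<close>
    whose image converges to it.\<close>
  define s where "s z = (SOME x. approx x z)" for z
  have s: "approx (s z) z" if "z \<in> Z" for z
    unfolding s_def using that Z_iff someI_ex by metis
  have "inj_on s Z"
  proof (rule inj_onI)
    fix z w assume zw: "z \<in> Z" "w \<in> Z" "s z = s w"
    then have mem: "z \<in> carrier Y" "w \<in> carrier Y" using ZY by auto
    have lim: "(\<lambda>n. nrm Y (T (s z n) \<ominus>\<^bsub>Y\<^esub> z)) \<longlonglongrightarrow> 0" "(\<lambda>n. nrm Y (T (s z n) \<ominus>\<^bsub>Y\<^esub> w)) \<longlonglongrightarrow> 0"
      and car: "\<And>n. s z n \<in> carrier X"
      using s[OF zw(1)] s[OF zw(2)] zw(3) by (auto simp: approx_def)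
    have "nrm Y (z \<ominus>\<^bsub>Y\<^esub> w) \<le> nrm Y (T (s z n) \<ominus>\<^bsub>Y\<^esub> z) + nrm Y (T (s z n) \<ominus>\<^bsub>Y\<^esub> w)" for n
      using Y.nrm_diff_triangle[of z "T (s z n)" w] Y.nrm_diff_commute[of z "T (s z n)"] mem car
      by simp
    moreover have "(\<lambda>n. nrm Y (T (s z n) \<ominus>\<^bsub>Y\<^esub> z) + nrm Y (T (s z n) \<ominus>\<^bsub>Y\<^esub> w)) \<longlonglongrightarrow> 0"
      using tendsto_add_zero[OF lim] .
    ultimately have "nrm Y (z \<ominus>\<^bsub>Y\<^esub> w) \<le> 0"
      by (intro tendsto_lowerbound[where F = sequentially]) auto
    then have "nrm Y (z \<ominus>\<^bsub>Y\<^esub> w) = 0" using mem by (intro order_antisym) auto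
    then show "z = w" using mem by (simp add: Y.nrm_eq_0_iff Y.diff_eq_zero_iff)
  qed
  define W where "W = transport (subspace_of Y Z) s"
  have inj: "inj_on s (carrier (subspace_of Y Z))" using \<open>inj_on s Z\<close> by simp
  note [simp] = transport_simps[OF inj, folded W_def, simplified]
  have W: "banach_space W"
    unfolding W_def by (rule banach_space_transport[OF banach_space_subspace_of[OF Y cZ] inj])
  have nW: "normed_space W" using W by (simp add: banach_space_def)
  define T' where "T' = (\<lambda>x. s (T x))"
  define p where "p = inv_into Z s"
  have p [simp]: "p (s z) = z" if "z \<in> Z" for z using that \<open>inj_on s Z\<close> by (simp add: p_def)

  have T': "bounded_operator X W T'"
    unfolding bounded_operator_def T'_def using K by (auto simp: Tadd Tsmult)

  have ext: "\<exists>h\<in>dual Y. (\<forall>y\<in>carrier Y. \<bar>h y\<bar> \<le> C * nrm Y y) \<and> (\<forall>z\<in>Z. h z = g (s z))"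
    if g: "g \<in> dual W" and C: "0 \<le> C" and bd: "\<And>u. u \<in> carrier W \<Longrightarrow> \<bar>g u\<bar> \<le> C * nrm W u" for g C
  proof -
    have g1: "g (s (z \<oplus>\<^bsub>Y\<^esub> w)) = g (s z) + g (s w)" if "z \<in> Z" "w \<in> Z" for z w
    proof -
      have "g (s z \<oplus>\<^bsub>W\<^esub> s w) = g (s z) + g (s w)"
        using g that by (simp add: dual_def)
      then show ?thesis using that by simp
    qed
    have g2: "g (s (a \<odot>\<^bsub>Y\<^esub> z)) = a * g (s z)" if "z \<in> Z" for a z
    proof -
      have "g (a \<odot>\<^bsub>W\<^esub> s z) = a * g (s z)" using g that by (simp add: dual_def)
      then show ?thesis using that by simp
    qed
    have g3: "g (s z) \<le> C * nrm Y z" if "z \<in> Z" for z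
      using bd[of "s z"] that by auto
    have "Y.functional_graph C {(z, g (s z)) | z. z \<in> Z}"
      unfolding Y.functional_graph_def
    proof (intro conjI allI impI)
      show "{(z, g (s z)) | z. z \<in> Z} \<subseteq> carrier Y \<times> UNIV" using ZY by auto
      have "g (s \<zero>\<^bsub>Y\<^esub>) = 0" using g2[OF \<open>\<zero>\<^bsub>Y\<^esub> \<in> Z\<close>, of 0] by simp
      then show "(\<zero>\<^bsub>Y\<^esub>, 0) \<in> {(z, g (s z)) | z. z \<in> Z}" using \<open>\<zero>\<^bsub>Y\<^esub> \<in> Z\<close> by force
    qed (auto simp: g1 g2 g3 Zadd Zsmult)
    from Y.hahn_banach[OF this C] show ?thesis by fastforce
  qed

  have "unconditionally_converging q X W T'"
    unfolding unconditionally_converging_def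
  proof (intro allI impI)
    fix x assume x: "weakly_summable q X x"
    then have car: "x n \<in> carrier X" for n by (auto simp: weakly_summable_def)
    have uY: "unconditionally_summable q Y (\<lambda>n. T (x n))"
      using conv x by (simp add: unconditionally_converging_def)
    have "summable (\<lambda>n. \<bar>g (T' (x n))\<bar> powr q)" if g: "g \<in> dual W" for g
    proof -
      obtain C where C: "\<forall>u\<in>carrier W. \<bar>g u\<bar> \<le> C * nrm W u"
        using g by (auto simp: dual_def)
      have "\<bar>g u\<bar> \<le> \<bar>C\<bar> * nrm W u" if "u \<in> carrier W" for u
        using bspec[OF C that] mult_right_mono[OF abs_ge_self normed_space.nrm_nonneg[OF nW that], of C]
        by linarith
      from ext[OF g _ this] obtain h where h: "h \<in> dual Y" "\<And>z. z \<in> Z \<Longrightarrow> h z = g (s z)" by auto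
      have "summable (\<lambda>n. \<bar>h (T (x n))\<bar> powr q)"
        using uY h(1) by (simp add: unconditionally_summable_def weakly_summable_def)
      then show ?thesis using car by (simp add: h(2) T'_def)
    qed
    then have wW: "weakly_summable q W (\<lambda>n. T' (x n))"
      using car by (auto simp: weakly_summable_def T'_def)
    have le: "(SUP g\<in>dual_ball W. ennreal ((\<Sum>n. \<bar>g (T' (x (m + n)))\<bar> powr q) powr (1 / q)))
        \<le> (SUP f\<in>dual_ball Y. ennreal ((\<Sum>n. \<bar>f (T (x (m + n)))\<bar> powr q) powr (1 / q)))" for m
    proof (rule SUP_least)
      fix g assume "g \<in> dual_ball W"
      then have g: "g \<in> dual W" "\<And>u. u \<in> carrier W \<Longrightarrow> \<bar>g u\<bar> \<le> 1 * nrm W u"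
        by (auto simp: dual_ball_def)
      from ext[OF g(1) _ g(2)] obtain h where h: "h \<in> dual Y" "\<And>z. z \<in> Z \<Longrightarrow> h z = g (s z)"
        "\<And>y. y \<in> carrier Y \<Longrightarrow> \<bar>h y\<bar> \<le> nrm Y y" by auto
      then have "h \<in> dual_ball Y" by (simp add: dual_ball_def)
      moreover have "g (T' (x k)) = h (T (x k))" for k using car by (simp add: h(2) T'_def)
      ultimately show "ennreal ((\<Sum>n. \<bar>g (T' (x (m + n)))\<bar> powr q) powr (1 / q))
          \<le> (SUP f\<in>dual_ball Y. ennreal ((\<Sum>n. \<bar>f (T (x (m + n)))\<bar> powr q) powr (1 / q)))"
        by (simp add: SUP_upper2[of h])
    qed
    have lim: "((\<lambda>m. SUP f\<in>dual_ball Y.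
        ennreal ((\<Sum>n. \<bar>f (T (x (m + n)))\<bar> powr q) powr (1 / q))) \<longlongrightarrow> 0) sequentially"
      using uY unfolding unconditionally_summable_def by (rule conjunct2)
    have "((\<lambda>m. SUP g\<in>dual_ball W.
        ennreal ((\<Sum>n. \<bar>g (T' (x (m + n)))\<bar> powr q) powr (1 / q))) \<longlongrightarrow> 0) sequentially"
      by (rule tendsto_sandwich[OF _ _ tendsto_const lim])
         (rule always_eventually, rule allI, rule zero_le, rule always_eventually, rule allI, rule le)
    then show "unconditionally_summable q W (\<lambda>n. T' (x n))"
      using wW by (simp add: unconditionally_summable_def)
  qed
  with pV W T' have "weakly_compact_operator X W T'"
    unfolding property_V_def by blast
  then have comp: "compactin (weak_topology W)
      (weak_topology W closure_of (T' ` {x \<in> carrier X. nrm X x \<le> 1}))"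
    by (simp add: weakly_compact_operator_def)

  have "(\<lambda>u. f (p u)) \<in> dual W" if f: "f \<in> dual Y" for f
  proof -
    obtain C where "\<forall>y\<in>carrier Y. \<bar>f y\<bar> \<le> C * nrm Y y" using f by (auto simp: dual_def)
    then show ?thesis using f ZY unfolding dual_def by (auto simp: Zadd Zsmult subset_eq)
  qed
  then have cont: "continuous_map (weak_topology W) (weak_topology Y) p"
    using ZY by (intro continuous_map_weak_topology nW nY) auto
  define B where "B = {x \<in> carrier X. nrm X x \<le> 1}"
  define Q where "Q = p ` (weak_topology W closure_of (T' ` B))"
  have Q: "compactin (weak_topology Y) Q"
    unfolding Q_def B_def by (rule image_compactin[OF comp cont])
  have "T ` B \<subseteq> Q"
  proof
    fix y assume "y \<in> T ` B"
    then obtain x where x: "y = T x" "x \<in> B" by blast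
    have "T' ` B \<subseteq> topspace (weak_topology W)"
      by (auto simp: normed_space.carrier_weak_topology[OF nW] T'_def B_def)
    then have "T' x \<in> weak_topology W closure_of (T' ` B)"
      using closure_of_subset x(2) by (metis image_subset_iff)
    moreover have "p (T' x) = y" using x by (simp add: T'_def B_def)
    ultimately show "y \<in> Q" unfolding Q_def by blast
  qed
  have "closedin (weak_topology Y) Q"
    by (rule compactin_imp_closedin[OF Y.Hausdorff_weak_topology Q])
  with \<open>T ` B \<subseteq> Q\<close> have "weak_topology Y closure_of (T ` B) \<subseteq> Q"
    by (rule closure_of_minimal)
  then have "compactin (weak_topology Y) (weak_topology Y closure_of (T ` B))"
    using Q by (intro closed_compactin[OF Q]) auto
  then show ?thesis by (simp add: weakly_compact_operator_def B_def)
qed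

locale normed_space_subspace = normed_space V for V :: "'a nvs" (structure) + fixes H
  assumes subspace: "submodule H real_ring V"
begin

abbreviation Q :: "'a set nvs" where "Q \<equiv> quotient_space V H"

lemma subset_carrier: "H \<subseteq> carrier V"
  and subspace_add: "x \<in> H \<Longrightarrow> y \<in> H \<Longrightarrow> x \<oplus> y \<in> H"
  and subspace_smult: "x \<in> H \<Longrightarrow> a \<odot> x \<in> H"
  and subspace_neg: "x \<in> H \<Longrightarrow> \<ominus> x \<in> H"
  using submoduleE[OF subspace] by auto

lemma subspace_zero: "\<zero> \<in> H"
proof -
  obtain x where "x \<in> H" using submoduleE(2)[OF subspace] by blast
  then show ?thesis using subspace_smult[of x 0] subset_carrier by auto
qed

lemma abelian_subgroup: "abelian_subgroup H V"
  using submodule.axioms(1)[OF subspace] M.abelian_group_axioms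
  by (intro abelian_subgroupI3 additive_subgroup.intro)

lemma coset_iff: "y \<in> H +> x \<longleftrightarrow> (\<exists>h\<in>H. y = h \<oplus> x)"
  by (auto simp: a_r_coset_def')

lemma coset_self: "x \<in> carrier V \<Longrightarrow> x \<in> H +> x"
  using subspace_zero by (auto simp: coset_iff intro!: bexI[of _ \<zero>])

lemma coset_subset: "x \<in> carrier V \<Longrightarrow> H +> x \<subseteq> carrier V"
  using subset_carrier by (auto simp: coset_iff subset_iff)

lemma coset_eqI: "y \<in> H +> x \<Longrightarrow> x \<in> carrier V \<Longrightarrow> H +> y = H +> x"
  using abelian_subgroup.a_repr_independence'[OF abelian_subgroup] by metis

lemma coset_zero: "H +> \<zero> = H"
  using subset_carrier by (force simp: coset_iff)

lemma carrier_Q: "C \<in> carrier Q \<longleftrightarrow> (\<exists>x\<in>carrier V. C = H +> x)"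
  by (auto simp: quotient_space_def A_RCOSETS_def')

lemma coset_in_Q [simp]: "x \<in> carrier V \<Longrightarrow> H +> x \<in> carrier Q"
  by (auto simp: carrier_Q)

lemma zero_Q [simp]: "\<zero>\<^bsub>Q\<^esub> = H +> \<zero>"
  by (simp add: quotient_space_def coset_zero)

lemma add_Q [simp]:
  "x \<in> carrier V \<Longrightarrow> y \<in> carrier V \<Longrightarrow> (H +> x) \<oplus>\<^bsub>Q\<^esub> (H +> y) = H +> (x \<oplus> y)"
  using abelian_subgroup.a_rcos_sum[OF abelian_subgroup] by (simp add: quotient_space_def)

lemma smult_Q [simp]:
  assumes x: "x \<in> carrier V" shows "a \<odot>\<^bsub>Q\<^esub> (H +> x) = H +> (a \<odot> x)"
proof -
  have "H +> (a \<odot> y) = H +> (a \<odot> x)" if y: "y \<in> H +> x" for y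
  proof -
    obtain h where "h \<in> H" "y = h \<oplus> x" using y by (auto simp: coset_iff)
    then have "a \<odot> y = (a \<odot> h) \<oplus> (a \<odot> x)" "a \<odot> h \<in> H"
      using x subset_carrier by (auto simp: smult_add_right subspace_smult)
    then show ?thesis using x by (intro coset_eqI) (auto simp: coset_iff)
  qed
  then have "(\<Union>y\<in>H +> x. H +> (a \<odot> y)) = H +> (a \<odot> x)"
    using coset_self[OF x] by blast
  then show ?thesis by (simp add: quotient_space_def)
qed

lemma nrm_Q: "nrm Q C = (INF x\<in>C. nrm V x)"
  by (simp add: quotient_space_def)

lemma nrm_Q_le:
  assumes "C \<in> carrier Q" "x \<in> C" shows "nrm Q C \<le> nrm V x"
proof -
  have "bdd_below (nrm V ` C)"
    using assms(1) coset_subset by (intro bdd_belowI2[of _ 0] nrm_nonneg) (auto simp: carrier_Q)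
  then show ?thesis unfolding nrm_Q using assms(2) by (rule cINF_lower)
qed

lemma nrm_Q_greatest:
  assumes "C \<in> carrier Q" "\<And>x. x \<in> C \<Longrightarrow> c \<le> nrm V x" shows "c \<le> nrm Q C"
  unfolding nrm_Q using assms coset_self by (intro cINF_greatest) (auto simp: carrier_Q)

lemma nrm_Q_less:
  assumes "C \<in> carrier Q" "nrm Q C < e" shows "\<exists>x\<in>C. nrm V x < e"
  using nrm_Q_greatest[OF assms(1), of e] assms(2) by (meson not_le)

lemma module_Q: "module real_ring Q"
proof (intro moduleI cring_real_ring)
  show "abelian_group Q"
  proof (rule abelian_groupI)
    fix C assume "C \<in> carrier Q"
    then obtain x where "C = H +> x" "x \<in> carrier V" by (auto simp: carrier_Q)
    then show "\<exists>D\<in>carrier Q. D \<oplus>\<^bsub>Q\<^esub> C = \<zero>\<^bsub>Q\<^esub>"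
      by (intro bexI[of _ "H +> (\<ominus> x)"]) (auto simp: M.l_neg)
  qed (auto simp: carrier_Q M.a_ac)
qed (auto simp: carrier_Q smult_add_left smult_add_right smult_assoc)

lemma normed_space_Q:
  assumes H: "closed_subspace V H"
  shows "normed_space Q"
proof -
  interpret VM: Metric_space "carrier V" "nrm_dist V" by (rule Metric_space_nrm_dist)
  have le: "nrm Q (a \<odot>\<^bsub>Q\<^esub> C) \<le> \<bar>a\<bar> * nrm Q C" if C: "C \<in> carrier Q" for a C
  proof (cases "a = 0")
    case True
    obtain x where "x \<in> carrier V" "C = H +> x" using C by (auto simp: carrier_Q)
    then show ?thesis using nrm_Q_le[of "H +> \<zero>" \<zero>] coset_self[of \<zero>] True by simp
  next
    case False
    obtain x where x: "x \<in> carrier V" "C = H +> x" using C by (auto simp: carrier_Q)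
    have "nrm Q (a \<odot>\<^bsub>Q\<^esub> C) / \<bar>a\<bar> \<le> nrm Q C"
    proof (rule nrm_Q_greatest[OF C])
      fix y assume y: "y \<in> C"
      then have yV: "y \<in> carrier V" and "C = H +> y" using x coset_subset coset_eqI by auto
      then have "nrm Q (a \<odot>\<^bsub>Q\<^esub> C) \<le> nrm V (a \<odot> y)"
        using coset_self by (intro nrm_Q_le) auto
      then show "nrm Q (a \<odot>\<^bsub>Q\<^esub> C) / \<bar>a\<bar> \<le> nrm V y"
        using False yV by (simp add: nrm_smult field_simps)
    qed
    then show ?thesis using False by (simp add: field_simps)
  qed
  have "normed_space_axioms Q"
  proof
    fix C assume C: "C \<in> carrier Q"
    obtain x where x: "x \<in> carrier V" "C = H +> x" using C by (auto simp: carrier_Q)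
    show "nrm Q C = 0 \<longleftrightarrow> C = \<zero>\<^bsub>Q\<^esub>"
    proof
      assume "C = \<zero>\<^bsub>Q\<^esub>"
      then have "nrm Q C \<le> 0" using nrm_Q_le[OF C, of \<zero>] coset_self[of \<zero>] by simp
      moreover have "0 \<le> nrm Q C"
        using coset_subset[OF x(1)] x(2) by (intro nrm_Q_greatest[OF C] nrm_nonneg) auto
      ultimately show "nrm Q C = 0" by simp
    next
      assume 0: "nrm Q C = 0"
      have "x \<in> H"
      proof (rule ccontr)
        assume "x \<notin> H"
        moreover have "closedin VM.mtopology H" using H by (simp add: closed_subspace_def)
        ultimately obtain r where r: "r > 0" "disjnt H (VM.mball x r)"
          using x by (auto simp: VM.closedin_metric)
        obtain y where "y \<in> C" "nrm V y < r" using nrm_Q_less[OF C] 0 r(1) by auto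
        then obtain h where h: "h \<in> H" "nrm V (h \<oplus> x) < r" using x by (auto simp: coset_iff)
        then have hV: "h \<in> carrier V" using subset_carrier by auto
        have "x \<ominus> (\<ominus> h) = h \<oplus> x" using x hV by (simp add: a_minus_def M.a_comm)
        then have "\<ominus> h \<in> VM.mball x r" using h hV x by (simp add: nrm_dist_def)
        then show False using r(2) subspace_neg[OF h(1)] by (auto simp: disjnt_iff)
      qed
      then have "x \<in> H +> \<zero>" by (simp add: coset_zero)
      then show "C = \<zero>\<^bsub>Q\<^esub>" using x coset_eqI[of x \<zero>] by simp
    qed
    show "nrm Q (a \<odot>\<^bsub>Q\<^esub> C) = \<bar>a\<bar> * nrm Q C" for a
    proof (cases "a = 0")
      case True
      have "0 \<le> nrm Q (a \<odot>\<^bsub>Q\<^esub> C)"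
        using x coset_subset[of "a \<odot> x"] by (intro nrm_Q_greatest) auto
      then show ?thesis using le[OF C, of a] True by simp
    next
      case False
      have "nrm Q ((1 / a) \<odot>\<^bsub>Q\<^esub> (a \<odot>\<^bsub>Q\<^esub> C)) \<le> \<bar>1 / a\<bar> * nrm Q (a \<odot>\<^bsub>Q\<^esub> C)"
        using x by (intro le) simp
      then have "\<bar>a\<bar> * nrm Q C \<le> nrm Q (a \<odot>\<^bsub>Q\<^esub> C)"
        using False x by (simp add: smult_assoc field_simps)
      then show ?thesis using le[OF C, of a] by simp
    qed
    fix D assume D: "D \<in> carrier Q"
    obtain y where y: "y \<in> carrier V" "D = H +> y" using D by (auto simp: carrier_Q)
    have *: "nrm Q (C \<oplus>\<^bsub>Q\<^esub> D) \<le> nrm V u + nrm V v" if "u \<in> C" "v \<in> D" for u v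
    proof -
      have uv: "u \<in> carrier V" "v \<in> carrier V" "C = H +> u" "D = H +> v"
        using that x y coset_subset coset_eqI by auto
      then have "nrm Q (C \<oplus>\<^bsub>Q\<^esub> D) \<le> nrm V (u \<oplus> v)"
        using coset_self by (intro nrm_Q_le) auto
      then show ?thesis using nrm_triangle uv by force
    qed
    have "nrm Q (C \<oplus>\<^bsub>Q\<^esub> D) - nrm V v \<le> nrm Q C" if "v \<in> D" for v
      using *[OF _ that] by (intro nrm_Q_greatest[OF C]) (simp add: algebra_simps)
    then have "nrm Q (C \<oplus>\<^bsub>Q\<^esub> D) - nrm Q C \<le> nrm Q D"
      by (intro nrm_Q_greatest[OF D]) (simp add: algebra_simps)
    then show "nrm Q (C \<oplus>\<^bsub>Q\<^esub> D) \<le> nrm Q C + nrm Q D" by simp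
  qed
  then show ?thesis using module_Q by (simp add: normed_space_def)
qed

lemma banach_space_Q:
  assumes V: "banach_space V" and H: "closed_subspace V H"
  shows "banach_space Q"
proof -
  interpret QN: normed_space Q by (rule normed_space_Q[OF H])
  interpret VM: Metric_space "carrier V" "nrm_dist V" by (rule Metric_space_nrm_dist)
  interpret QM: Metric_space "carrier Q" "nrm_dist Q" by (rule QN.Metric_space_nrm_dist)
  have diffQ: "(H +> x) \<ominus>\<^bsub>Q\<^esub> (H +> y) = H +> (x \<ominus> y)" if "x \<in> carrier V" "y \<in> carrier V" for x y
    using that by (simp add: a_minus_def QN.a_inv_eq_smult a_inv_eq_smult)
  have "QM.mcomplete"
    unfolding QM.mcomplete_def
  proof (intro allI impI)
    fix \<sigma> assume \<sigma>: "QM.MCauchy \<sigma>"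
    have \<sigma>Q: "\<sigma> n \<in> carrier Q" for n using \<sigma> unfolding QM.MCauchy_def by blast
    have "\<exists>N. \<forall>n n'. N \<le> n \<longrightarrow> N \<le> n' \<longrightarrow> nrm_dist Q (\<sigma> n) (\<sigma> n') < (1/2)^k" for k
      using \<sigma> by (simp add: QM.MCauchy_def)
    then obtain N where N: "\<And>k n n'. N k \<le> n \<Longrightarrow> N k \<le> n' \<Longrightarrow> nrm_dist Q (\<sigma> n) (\<sigma> n') < (1/2)^k"
      by metis
    define r where "r k = k + (\<Sum>i\<le>k. N i)" for k
    have "strict_mono r" by (rule strict_mono_Suc_iff[THEN iffD2]) (simp add: r_def)
    have rN: "N k \<le> r k" for k
      using member_le_sum[of k "{..k}" N] by (simp add: r_def)
    have close: "nrm_dist Q (\<sigma> (r k)) (\<sigma> (r (Suc k))) < (1/2)^k" for k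
      using rN[of k] strict_monoD[OF \<open>strict_mono r\<close>, of k "Suc k"] by (intro N) auto
    have step: "\<exists>y. (y \<in> carrier V \<and> \<sigma> (r (Suc k)) = H +> y) \<and> nrm_dist V x y < (1/2)^k"
      if x: "x \<in> carrier V \<and> \<sigma> (r k) = H +> x" for x k
    proof -
      obtain z where z: "z \<in> carrier V" "\<sigma> (r (Suc k)) = H +> z"
        using \<sigma>Q[of "r (Suc k)"] by (auto simp: carrier_Q)
      have "nrm Q (H +> (x \<ominus> z)) < (1/2)^k"
        using close[of k] x z by (simp add: nrm_dist_def diffQ)
      then obtain h where h: "h \<in> H" "nrm V (h \<oplus> (x \<ominus> z)) < (1/2)^k"
        using nrm_Q_less[of "H +> (x \<ominus> z)"] x z by (force simp: coset_iff)
      define y where "y = \<ominus> h \<oplus> z"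
      have hV: "h \<in> carrier V" using h subset_carrier by auto
      have "y \<in> H +> z" using subspace_neg[OF h(1)] by (auto simp: y_def coset_iff)
      then have "H +> y = H +> z" using z coset_eqI by auto
      moreover have "x \<ominus> y = h \<oplus> (x \<ominus> z)"
        using x z hV by (simp add: y_def a_minus_def M.minus_add M.a_ac)
      moreover have "y \<in> carrier V" using z hV by (simp add: y_def)
      ultimately show ?thesis using x z h by (intro exI[of _ y]) (simp add: nrm_dist_def)
    qed
    obtain x0 where "x0 \<in> carrier V \<and> \<sigma> (r 0) = H +> x0"
      using \<sigma>Q[of "r 0"] by (auto simp: carrier_Q)
    then obtain x where x: "\<And>k. x k \<in> carrier V \<and> \<sigma> (r k) = H +> x k"
      and xd: "\<And>k. nrm_dist V (x k) (x (Suc k)) < (1/2)^k"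
      using dependent_nat_choice[of "\<lambda>k x. x \<in> carrier V \<and> \<sigma> (r k) = H +> x"
          "\<lambda>k x y. nrm_dist V x y < (1/2)^k"] step by blast
    have far: "nrm_dist V (x n) (x (n + m)) \<le> 2 * (1/2)^n - 2 * (1/2)^(n + m)" for n m
    proof (induction m)
      case 0 then show ?case using x by simp
    next
      case (Suc m)
      have "nrm_dist V (x n) (x (n + Suc m))
          \<le> nrm_dist V (x n) (x (n + m)) + nrm_dist V (x (n + m)) (x (Suc (n + m)))"
        using VM.triangle x by simp
      then show ?case using Suc xd[of "n + m"] by simp
    qed
    have far': "nrm_dist V (x n) (x m) \<le> 2 * (1/2)^n" if "n \<le> m" for n m
      using far[of n "m - n"] that by (smt (verit) le_add_diff_inverse zero_le_power zero_le_divide_1_iff)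
    have "VM.MCauchy x"
      unfolding VM.MCauchy_def
    proof (intro conjI allI impI)
      show "range x \<subseteq> carrier V" using x by blast
      fix e :: real assume "0 < e"
      then obtain n0 where n0: "(1/2)^n0 < e / 2" using real_arch_pow_inv[of "e/2" "1/2"] by auto
      have "nrm_dist V (x n) (x m) < e" if nm: "n0 \<le> n" "n \<le> m" for n m
      proof -
        have "(1/2::real)^n \<le> (1/2)^n0" using nm by (intro power_decreasing) auto
        then show ?thesis using far'[OF nm(2)] n0 by linarith
      qed
      then show "\<exists>N. \<forall>n n'. N \<le> n \<longrightarrow> N \<le> n' \<longrightarrow> nrm_dist V (x n) (x n') < e"
        by (metis VM.commute nle_le)
    qed
    then obtain l where "limitin VM.mtopology x l sequentially"
      using V by (auto simp: banach_space_def VM.mcomplete_def)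
    then have l: "l \<in> carrier V" "(\<lambda>n. nrm_dist V (x n) l) \<longlonglongrightarrow> 0"
      by (auto simp: VM.limitin_metric_dist_null)
    have "nrm_dist Q (\<sigma> (r k)) (H +> l) \<le> nrm_dist V (x k) l" for k
      using x[of k] l(1) nrm_Q_le[of "H +> (x k \<ominus> l)" "x k \<ominus> l"] coset_self[of "x k \<ominus> l"]
      by (simp add: nrm_dist_def diffQ)
    then have "(\<lambda>k. nrm_dist Q (\<sigma> (r k)) (H +> l)) \<longlonglongrightarrow> 0"
      by (rule_tac tendsto_sandwich[OF _ _ tendsto_const l(2)]) (auto intro!: always_eventually)
    then have "limitin QM.mtopology (\<sigma> \<circ> r) (H +> l) sequentially"
      unfolding QM.limitin_metric_dist_null using l(1) \<sigma>Q by simp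
    then have "limitin QM.mtopology \<sigma> (H +> l) sequentially"
      by (rule QM.MCauchy_convergent_subsequence[OF \<sigma> \<open>strict_mono r\<close>])
    then show "\<exists>l. limitin QM.mtopology \<sigma> l sequentially" by blast
  qed
  then show ?thesis using QN.normed_space_axioms by (simp add: banach_space_def)
qed

end

theorem banach_space_quotient_space:
  assumes "banach_space V" "closed_subspace V H"
  shows "banach_space (quotient_space V H)"
  using assms
  by (intro normed_space_subspace.banach_space_Q normed_space_subspace.intro
      normed_space_subspace_axioms.intro) (auto simp: banach_space_def closed_subspace_def)

end

theory Submission
  imports Defs "HOL-Library.Sublist"
begin

text \<open>
  A three-space argument would have to lift weakly summable sequences from the quotient to the
  space. The example is a space \<open>X\<close> with a quotient \<open>X / X\<^sub>0\<close> isomorphic to \<open>c\<^sub>0\<close> for which this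
  fails as badly as possible: the quotient map sends every weakly \<open>q\<close>-summable sequence to a norm
  null sequence. It is then unconditionally \<open>q\<close>-converging, but an operator onto \<open>c\<^sub>0\<close> is not
  weakly compact, so \<open>X\<close> does not have the property. The same \<open>X\<close> serves for all \<open>q\<close>.

  The space \<open>X\<close> consists of bounded functions on a tree of finite sequences of natural numbers.
  The nodes \<open>s @ m # t\<close> are regarded as tending to \<open>s\<close> when \<open>m\<close> tends to infinity, which makes the
  tree a countable compact space, and \<open>X\<^sub>0\<close> is the space of continuous functions. The functions in
  \<open>X\<close> may jump at each node \<open>s\<close>: up by \<open>a k\<close> for even \<open>m\<close> and down by \<open>a k\<close> for odd \<open>m\<close>, where
  \<open>k\<close> is determined by the last entry of \<open>s\<close> and \<open>a\<close> is a null sequence that depends on the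
  function. The jumps \<open>a\<close> can be prescribed (\<open>has_jumps_lift\<close>), at the cost of a factor 2 in the
  norm, so \<open>X / X\<^sub>0\<close> is a copy of \<open>c\<^sub>0\<close>.

  If a weakly \<open>q\<close>-summable sequence of functions had infinitely many members with jumps larger
  than \<open>d\<close>, one could walk up the tree and at each step use the jump of a new member to make its
  absolute value at least \<open>d / 2\<close> at all nodes still to come (\<open>node_with_many_large_values\<close>).
  After \<open>R\<close> steps the evaluation at the node reached is a functional of norm at most 1 that is
  large on \<open>R\<close> members. This contradicts the uniform boundedness principle
  (\<open>weakly_summable_uniform_bound\<close>), since \<open>R\<close> is arbitrary. By a duality argument
  (\<open>unconditionally_convergingI_norm_null\<close>) an operator that maps weakly \<open>q\<close>-summable sequences to
  norm null sequences is unconditionally \<open>q\<close>-converging.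

  The subspace and the quotient have the property because unconditionally converging operators on
  them are compact. Both are built from finite-dimensional pieces by iterated \<open>c\<^sub>0\<close>-sums, and an
  unconditionally converging operator is uniformly small on the tails of a \<open>c\<^sub>0\<close>-sum, as blocks of
  it are weakly 1-summable (\<open>precompact_image_if_unconditional_decomposition\<close>). For \<open>c\<^sub>0\<close> itself
  the pieces are lines. For \<open>X\<^sub>0\<close> the functions that live above a node are constants plus the
  \<open>c\<^sub>0\<close>-sum of the functions above its children, and the argument is an induction over the tree.
  For this induction the tree must not have infinite branches, while the walk above needs
  arbitrarily long branches with arbitrarily sparse entries; a Schreier tree, in which the first
  entry bounds the length, has both properties.
\<close>

section \<open>Weakly summable sequences and unconditionally converging operators\<close>

lemma convex_on_abs_powr:
  assumes "1 \<le> (q :: real)" shows "convex_on UNIV (\<lambda>x :: real. \<bar>x\<bar> powr q)"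
proof (rule convex_onI)
  fix t x y :: real assume t: "0 < t" "t < 1"
  have small: "(c * \<bar>z\<bar>) powr q \<le> c * \<bar>z\<bar> powr q" if "0 < c" "c < 1" for c z :: real
  proof -
    have "c powr q \<le> c powr 1" using that assms by (intro powr_mono') auto
    then show ?thesis using that by (simp add: powr_mult mult_right_mono)
  qed
  have "\<bar>(1 - t) * x + t * y\<bar> powr q \<le> ((1 - t) * \<bar>x\<bar> + t * \<bar>y\<bar>) powr q"
    using t assms abs_triangle_ineq[of "(1 - t) * x" "t * y"]
    by (intro powr_mono2) (auto simp: abs_mult)
  also have "\<dots> \<le> (1 - t) * \<bar>x\<bar> powr q + t * \<bar>y\<bar> powr q"
  proof (cases "x = 0 \<or> y = 0")
    case True
    then show ?thesis using small[of t y] small[of "1 - t" x] t assms by auto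
  next
    case False
    then show ?thesis
      using convex_onD[OF powr_convex[OF assms], of t "\<bar>x\<bar>" "\<bar>y\<bar>"] t by simp
  qed
  finally show "\<bar>(1 - t) *\<^sub>R x + t *\<^sub>R y\<bar> powr q \<le> (1 - t) * \<bar>x\<bar> powr q + t * \<bar>y\<bar> powr q" by simp
qed simp

text \<open>
  The coefficients are \<open>sgn (t n) * \<bar>t n\<bar> powr (q - 1)\<close> up to a common factor, as in the equality
  case of Hoelder's inequality. The second property is Jensen's inequality for the weights
  \<open>w n = \<bar>t n\<bar> powr q / A\<close>; this form treats \<open>q = 1\<close> and \<open>q > 1\<close> alike.
\<close>

lemma norming_coefficients:
  fixes t :: "nat \<Rightarrow> real"
  assumes q: "1 \<le> q" and I: "finite I" and pos: "0 < (\<Sum>n\<in>I. \<bar>t n\<bar> powr q)"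
  obtains b where "(\<Sum>n\<in>I. b n * t n) = (\<Sum>n\<in>I. \<bar>t n\<bar> powr q) powr (1 / q)"
    and "\<And>u. \<bar>\<Sum>n\<in>I. b n * u n\<bar> powr q \<le> (\<Sum>n\<in>I. \<bar>u n\<bar> powr q)"
proof -
  define A where "A = (\<Sum>n\<in>I. \<bar>t n\<bar> powr q)"
  define r where "r = A powr (1 / q)"
  define w where "w n = \<bar>t n\<bar> powr q / A" for n
  define b where "b n = (if t n = 0 then 0 else r * w n / t n)" for n
  have A: "A > 0" using pos by (simp add: A_def)
  have r: "r > 0" "r powr q = A" using A q by (auto simp: r_def powr_powr)
  have w: "(\<Sum>n\<in>I. w n) = 1" "\<And>n. 0 \<le> w n"
    using A by (simp_all add: w_def A_def flip: sum_divide_distrib)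
  have "(\<Sum>n\<in>I. b n * t n) = (\<Sum>n\<in>I. r * w n)"
    using q by (intro sum.cong) (auto simp: b_def w_def)
  then have 1: "(\<Sum>n\<in>I. b n * t n) = r" using w(1) by (simp flip: sum_distrib_left)
  have 2: "\<bar>\<Sum>n\<in>I. b n * u n\<bar> powr q \<le> (\<Sum>n\<in>I. \<bar>u n\<bar> powr q)" for u :: "nat \<Rightarrow> real"
  proof -
    define v where "v n = (if t n = 0 then 0 else r * u n / t n)" for n
    have "I \<noteq> {}" using w(1) by auto
    have "(\<Sum>n\<in>I. b n * u n) = (\<Sum>n\<in>I. w n * v n)"
      by (intro sum.cong) (auto simp: b_def v_def)
    then have "\<bar>\<Sum>n\<in>I. b n * u n\<bar> powr q \<le> (\<Sum>n\<in>I. w n * \<bar>v n\<bar> powr q)"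
      using convex_on_sum[OF I \<open>I \<noteq> {}\<close> convex_on_abs_powr[OF q] w(1) w(2), of v] by simp
    also have "\<dots> \<le> (\<Sum>n\<in>I. \<bar>u n\<bar> powr q)"
    proof (rule sum_mono)
      fix n
      show "w n * \<bar>v n\<bar> powr q \<le> \<bar>u n\<bar> powr q"
        using A r by (auto simp: v_def w_def abs_mult powr_mult powr_divide)
    qed
    finally show ?thesis .
  qed
  show ?thesis using that[OF 1[unfolded r_def A_def] 2] .
qed

lemma sum_disjoint_intervals_le:
  fixes u :: "nat \<Rightarrow> real"
  assumes mp: "\<And>k. m k < p k" "\<And>k. p k \<le> m (Suc k)" and u: "\<And>n. 0 \<le> u n"
  shows "(\<Sum>k<K. \<Sum>n\<in>{m k..<p k}. u n) \<le> (\<Sum>n<m K. u n)"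
proof (induction K)
  case (Suc K)
  have "(\<Sum>n<m K. u n) + (\<Sum>n\<in>{m K..<p K}. u n) = (\<Sum>n<p K. u n)"
    using mp(1)[of K] by (simp add: lessThan_atLeast0 sum.atLeastLessThan_concat)
  also have "\<dots> \<le> (\<Sum>n<m (Suc K). u n)"
    using mp(2)[of K] u by (intro sum_mono2) auto
  finally show ?case using Suc by simp
qed (simp add: u sum_nonneg)

text \<open>The choice of successive blocks in a gliding hump argument.\<close>

lemma nat_block_sequence:
  assumes "\<And>N :: nat. \<exists>m p z. N \<le> m \<and> m < p \<and> P m p z"
  obtains m p z where "\<And>k. m k < p k" "\<And>k. p k \<le> m (Suc k)" "\<And>k :: nat. P (m k) (p k) (z k)"
proof -
  obtain a b c where *: "\<And>N. N \<le> a N \<and> a N < b N \<and> P (a N) (b N) (c N)"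
    using assms by metis
  define N where "N = rec_nat 0 (\<lambda>_. b)"
  have "N (Suc k) = b (N k)" for k by (simp add: N_def)
  then show ?thesis
    using that[of "\<lambda>k. a (N k)" "\<lambda>k. b (N k)" "\<lambda>k. c (N k)"] * by metis
qed

context normed_space
begin

lemma finsum_lessThan_Suc:
  assumes "y \<in> {..<Suc N} \<rightarrow> carrier V"
  shows "finsum V y {..<Suc N} = y N \<oplus> finsum V y {..<N}"
  using assms unfolding lessThan_Suc by (subst M.finsum_insert) auto

lemma dual_finsum:
  assumes f: "f \<in> dual V" and "finite I" "y \<in> I \<rightarrow> carrier V"
  shows "f (finsum V y I) = (\<Sum>i\<in>I. f (y i))"
  using assms(2,3)
proof (induction I rule: finite_induct)
  case empty
  have "f (0 \<odot> \<zero>) = 0 * f \<zero>" using f unfolding dual_def by blast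
  then show ?case by simp
next
  case (insert i I)
  have "finsum V y I \<in> carrier V" using insert by (intro M.finsum_closed) auto
  then show ?case using insert f by (simp add: dual_def)
qed

lemma dual_simps:
  assumes "f \<in> dual V"
  shows "x \<in> carrier V \<Longrightarrow> y \<in> carrier V \<Longrightarrow> f (x \<oplus> y) = f x + f y"
    "x \<in> carrier V \<Longrightarrow> f (a \<odot> x) = a * f x"
  using assms by (auto simp: dual_def)

text \<open>
  The functional \<open>t v \<mapsto> t * nrm v\<close> on the line through \<open>v\<close> is extended by the Hahn-Banach theorem.
\<close>

lemma norming_functional:
  assumes v: "v \<in> carrier V"
  shows "\<exists>f\<in>dual_ball V. f v = nrm V v"
proof -
  have "functional_graph 1 {(t \<odot> v, t * nrm V v) | t. True}"
    unfolding functional_graph_def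
  proof (intro conjI allI impI)
    show "{(t \<odot> v, t * nrm V v) | t. True} \<subseteq> carrier V \<times> UNIV" using v by auto
    show "(\<zero>, 0) \<in> {(t \<odot> v, t * nrm V v) | t. True}"
      using v by (intro CollectI exI[of _ 0]) simp
    fix x r assume "(x, r) \<in> {(t \<odot> v, t * nrm V v) | t. True}"
    then obtain t where t: "x = t \<odot> v" "r = t * nrm V v" by auto
    show "(a \<odot> x, a * r) \<in> {(t \<odot> v, t * nrm V v) | t. True}" for a
      using v by (intro CollectI exI[of _ "a * t"]) (simp add: t smult_assoc)
    show "r \<le> 1 * nrm V x" using v by (simp add: t nrm_smult mult_right_mono)
    fix y s assume "(y, s) \<in> {(t \<odot> v, t * nrm V v) | t. True}"
    then obtain t' where t': "y = t' \<odot> v" "s = t' * nrm V v" by auto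
    show "(x \<oplus> y, r + s) \<in> {(t \<odot> v, t * nrm V v) | t. True}"
      using v by (intro CollectI exI[of _ "t + t'"]) (simp add: t t' smult_add_left distrib_right)
  qed
  from hahn_banach[OF this] obtain f where f: "f \<in> dual V" "\<forall>x\<in>carrier V. \<bar>f x\<bar> \<le> 1 * nrm V x"
    and eq: "\<And>x r. (x, r) \<in> {(t \<odot> v, t * nrm V v) | t. True} \<Longrightarrow> f x = r" by auto
  have "f (1 \<odot> v) = 1 * nrm V v" by (rule eq) blast
  then show ?thesis using v f by (intro bexI[of _ f]) (auto simp: dual_ball_def)
qed

text \<open>
  The signs of the values \<open>f (y k)\<close> turn the bound on signed sums into a bound on the sums of
  \<open>\<bar>f (y k)\<bar>\<close>. So \<open>y\<close> is weakly 1-summable, and from some index on the terms are below 1, where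
  the power \<open>q\<close> only makes them smaller.
\<close>

lemma weakly_summable_if_signed_sums_bounded:
  assumes q: "1 \<le> q" and y: "\<And>k. y k \<in> carrier V"
    and C: "\<And>c N. (\<And>k. \<bar>c k\<bar> \<le> 1) \<Longrightarrow> nrm V (finsum V (\<lambda>k. c k \<odot> y k) {..<N}) \<le> C"
  shows "weakly_summable q V y"
  unfolding weakly_summable_def
proof (intro conjI ballI)
  show "range y \<subseteq> carrier V" using y by auto
  fix f assume f: "f \<in> dual V"
  obtain K where K: "\<And>x. x \<in> carrier V \<Longrightarrow> \<bar>f x\<bar> \<le> K * nrm V x"
    using f unfolding dual_def by blast
  have "summable (\<lambda>k. \<bar>f (y k)\<bar>)"
  proof (rule summableI_nonneg_bounded)
    fix N
    define s where "s = finsum V (\<lambda>k. sgn (f (y k)) \<odot> y k) {..<N}"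
    have s: "s \<in> carrier V" unfolding s_def using y by (intro M.finsum_closed) auto
    have "(\<Sum>k<N. \<bar>f (y k)\<bar>) = f s"
      unfolding s_def using f y
      by (subst dual_finsum) (auto simp: dual_simps abs_sgn mult.commute)
    also have "\<dots> \<le> \<bar>K\<bar> * nrm V s"
      using K[OF s] s by (smt (verit) mult_right_mono nrm_nonneg)
    also have "\<dots> \<le> \<bar>K\<bar> * C"
      unfolding s_def by (intro mult_left_mono C) (auto simp: sgn_if)
    finally show "(\<Sum>k<N. \<bar>f (y k)\<bar>) \<le> \<bar>K\<bar> * C" .
  qed simp
  then have "(\<lambda>k. \<bar>f (y k)\<bar>) \<longlonglongrightarrow> 0" by (rule summable_LIMSEQ_zero)
  then have "eventually (\<lambda>k. \<bar>f (y k)\<bar> < 1) sequentially" by (rule order_tendstoD) simp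
  then show "summable (\<lambda>k. \<bar>f (y k)\<bar> powr q)"
  proof (intro summable_comparison_test_ev[OF _ \<open>summable (\<lambda>k. \<bar>f (y k)\<bar>)\<close>], elim eventually_mono)
    fix k assume "\<bar>f (y k)\<bar> < 1"
    then have "\<bar>f (y k)\<bar> powr q \<le> \<bar>f (y k)\<bar> powr 1" using q by (intro powr_mono') auto
    then show "norm (\<bar>f (y k)\<bar> powr q) \<le> \<bar>f (y k)\<bar>" by simp
  qed
qed

end

locale bounded_linear_between = V: normed_space V + W: normed_space W
  for V :: "'a nvs" and W :: "'b nvs" +
  fixes T :: "'a \<Rightarrow> 'b"
  assumes bounded_operator: "bounded_operator V W T"
begin

lemma T_mem [simp]: "x \<in> carrier V \<Longrightarrow> T x \<in> carrier W"
  and T_add: "x \<in> carrier V \<Longrightarrow> y \<in> carrier V \<Longrightarrow> T (x \<oplus>\<^bsub>V\<^esub> y) = T x \<oplus>\<^bsub>W\<^esub> T y"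
  and T_smult: "x \<in> carrier V \<Longrightarrow> T (a \<odot>\<^bsub>V\<^esub> x) = a \<odot>\<^bsub>W\<^esub> T x"
  using bounded_operator by (auto simp: bounded_operator_def)

lemma T_diff:
  assumes "x \<in> carrier V" "y \<in> carrier V" shows "T (x \<ominus>\<^bsub>V\<^esub> y) = T x \<ominus>\<^bsub>W\<^esub> T y"
  using assms by (simp add: a_minus_def V.a_inv_eq_smult W.a_inv_eq_smult T_add T_smult)

lemma T_bound: obtains K where "K > 0" "\<And>x. x \<in> carrier V \<Longrightarrow> nrm W (T x) \<le> K * nrm V x"
proof -
  obtain K where K: "\<And>x. x \<in> carrier V \<Longrightarrow> nrm W (T x) \<le> K * nrm V x"
    using bounded_operator unfolding bounded_operator_def by blast
  have "nrm W (T x) \<le> (\<bar>K\<bar> + 1) * nrm V x" if "x \<in> carrier V" for x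
    using order_trans[OF K[OF that] mult_right_mono[of K "\<bar>K\<bar> + 1" "nrm V x"]] that by simp
  then show ?thesis using that[of "\<bar>K\<bar> + 1"] by simp
qed

lemma dual_comp: assumes f: "f \<in> dual W" shows "(\<lambda>x. f (T x)) \<in> dual V"
proof -
  obtain K where K: "K > 0" "\<And>x. x \<in> carrier V \<Longrightarrow> nrm W (T x) \<le> K * nrm V x"
    using T_bound by blast
  obtain L where L: "\<And>y. y \<in> carrier W \<Longrightarrow> \<bar>f y\<bar> \<le> L * nrm W y"
    using f unfolding dual_def by blast
  have "\<bar>f (T x)\<bar> \<le> (\<bar>L\<bar> * K) * nrm V x" if x: "x \<in> carrier V" for x
  proof -
    have "\<bar>f (T x)\<bar> \<le> L * nrm W (T x)" using L x by simp
    also have "\<dots> \<le> \<bar>L\<bar> * nrm W (T x)" using x by (intro mult_right_mono) auto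
    also have "\<dots> \<le> \<bar>L\<bar> * (K * nrm V x)" using K x by (intro mult_left_mono) auto
    finally show ?thesis by (simp add: mult.assoc)
  qed
  then show ?thesis
    unfolding dual_def using W.dual_simps[OF f] by (auto simp: T_add T_smult)
qed

lemma weakly_summable_image:
  "weakly_summable q V x \<Longrightarrow> weakly_summable q W (\<lambda>n. T (x n))"
  unfolding weakly_summable_def using dual_comp by force

text \<open>
  The supremum in the definition of unconditional summability is over tails of series; the first
  term of a tail alone, for a norming functional, already gives the norm of a member of the
  sequence.
\<close>

lemma unconditionally_converging_imp_norm_null:
  assumes q: "1 \<le> q" and T: "unconditionally_converging q V W T" and y: "weakly_summable q V y"
  shows "(\<lambda>k. nrm W (T (y k))) \<longlonglongrightarrow> 0"
proof -
  have yV: "y k \<in> carrier V" for k using y by (auto simp: weakly_summable_def)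
  let ?S = "\<lambda>m. SUP f\<in>dual_ball W. ennreal ((\<Sum>n. \<bar>f (T (y (m + n)))\<bar> powr q) powr (1 / q))"
  have S: "?S \<longlonglongrightarrow> 0"
    using T y by (auto simp: unconditionally_converging_def unconditionally_summable_def)
  have "ennreal (nrm W (T (y m))) \<le> ?S m" for m
  proof -
    obtain f where f: "f \<in> dual_ball W" "f (T (y m)) = nrm W (T (y m))"
      using W.norming_functional[of "T (y m)"] yV by auto
    have "summable (\<lambda>n. \<bar>f (T (y n))\<bar> powr q)"
      using weakly_summable_image[OF y] f(1) by (auto simp: weakly_summable_def dual_ball_def)
    then have sm: "summable (\<lambda>n. \<bar>f (T (y (m + n)))\<bar> powr q)"
      using summable_iff_shift[of "\<lambda>n. \<bar>f (T (y n))\<bar> powr q" m] by (simp add: add.commute)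
    have "nrm W (T (y m)) powr q \<le> (\<Sum>n. \<bar>f (T (y (m + n)))\<bar> powr q)"
      using sum_le_suminf[OF sm, of "{0}"] f(2) yV by simp
    then have "(nrm W (T (y m)) powr q) powr (1 / q)
        \<le> (\<Sum>n. \<bar>f (T (y (m + n)))\<bar> powr q) powr (1 / q)"
      using q by (intro powr_mono2) auto
    then have "nrm W (T (y m)) \<le> (\<Sum>n. \<bar>f (T (y (m + n)))\<bar> powr q) powr (1 / q)"
      using q yV by (simp add: powr_powr)
    then show ?thesis using f(1) by (intro SUP_upper2[of f]) (auto intro: ennreal_leI)
  qed
  then have "(\<lambda>m. ennreal (nrm W (T (y m)))) \<longlonglongrightarrow> ennreal 0"
    unfolding ennreal_0
    using tendsto_sandwich[where f = "\<lambda>_. 0" and g = "\<lambda>m. ennreal (nrm W (T (y m)))", OF _ _ tendsto_const S]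
    by (simp add: always_eventually)
  then show ?thesis by (subst (asm) tendsto_ennreal_iff) (auto simp: yV)
qed

text \<open>
  If the tails for some weakly summable \<open>x\<close> do not vanish, there are successive blocks on which
  functionals \<open>f k\<close> have \<open>q\<close>-sums above \<open>d powr q\<close>. Combining the members of each block with
  norming coefficients produces a sequence that is again weakly summable, because norming
  coefficients do not increase \<open>q\<close>-sums of other functionals, but whose images have norm at least
  \<open>d\<close>.
\<close>

lemma unconditionally_convergingI_norm_null:
  assumes q: "1 \<le> q"
    and null: "\<And>y. weakly_summable q V y \<Longrightarrow> (\<lambda>k. nrm W (T (y k))) \<longlonglongrightarrow> 0"
  shows "unconditionally_converging q V W T"
  unfolding unconditionally_converging_def
proof (intro allI impI)
  fix x assume x: "weakly_summable q V x"
  then have xV: "x n \<in> carrier V" for n by (auto simp: weakly_summable_def)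
  let ?S = "\<lambda>m. SUP f\<in>dual_ball W. ennreal ((\<Sum>n. \<bar>f (T (x (m + n)))\<bar> powr q) powr (1 / q))"
  have "?S \<longlonglongrightarrow> 0"
  proof (rule ccontr)
    assume "\<not> ?S \<longlonglongrightarrow> 0"
    then obtain e where e: "e > 0" "\<not> eventually (\<lambda>m. ?S m < e) sequentially"
      unfolding order_tendsto_iff by auto
    obtain d' where d': "0 < d'" "d' < e" using dense[OF e(1)] by blast
    obtain d where "d' = ennreal d" using d'(2) by (cases d') (auto simp: top_unique)
    with d' have d: "0 < ennreal d" "ennreal d < e" by simp_all
    then have "d > 0" by simp
    have "\<exists>m p f. N \<le> m \<and> m < p \<and> f \<in> dual_ball W \<and> d powr q < (\<Sum>n\<in>{m..<p}. \<bar>f (T (x n))\<bar> powr q)" for N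
    proof -
      obtain m where m: "N \<le> m" "e \<le> ?S m"
        using e(2) by (auto simp: eventually_sequentially not_less)
      have "ennreal d < ?S m" using d m by order
      then obtain f where f: "f \<in> dual_ball W"
        "ennreal d < ennreal ((\<Sum>n. \<bar>f (T (x (m + n)))\<bar> powr q) powr (1 / q))"
        by (auto simp: less_SUP_iff)
      have "summable (\<lambda>n. \<bar>f (T (x n))\<bar> powr q)"
        using weakly_summable_image[OF x] f(1) by (auto simp: weakly_summable_def dual_ball_def)
      then have sm: "summable (\<lambda>n. \<bar>f (T (x (m + n)))\<bar> powr q)"
        using summable_iff_shift[of "\<lambda>n. \<bar>f (T (x n))\<bar> powr q" m] by (simp add: add.commute)
      have "d < (\<Sum>n. \<bar>f (T (x (m + n)))\<bar> powr q) powr (1 / q)"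
        using f(2) \<open>d > 0\<close> by (simp add: ennreal_less_iff)
      then have "d powr q < ((\<Sum>n. \<bar>f (T (x (m + n)))\<bar> powr q) powr (1 / q)) powr q"
        using \<open>d > 0\<close> q by (intro powr_less_mono2) auto
      then have "d powr q < (\<Sum>n. \<bar>f (T (x (m + n)))\<bar> powr q)"
        using q suminf_nonneg[OF sm] by (simp add: powr_powr)
      then obtain l where l: "d powr q < (\<Sum>n<l. \<bar>f (T (x (m + n)))\<bar> powr q)"
        using eventually_happens'[OF sequentially_bot order_tendstoD(1)[OF summable_LIMSEQ[OF sm]]] by blast
      have "l > 0" using l by (cases l) auto
      have "(\<Sum>n<l. \<bar>f (T (x (m + n)))\<bar> powr q) = (\<Sum>n\<in>{m..<m + l}. \<bar>f (T (x n))\<bar> powr q)"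
        by (simp add: lessThan_atLeast0 sum.shift_bounds_nat_ivl[of _ 0 m l, simplified] add.commute flip: sum.shift_bounds_nat_ivl)
      then show ?thesis using m(1) l f(1) \<open>l > 0\<close>
        by (intro exI[of _ m] exI[of _ "m + l"] exI[of _ f]) simp
    qed
    then obtain m p f where mp: "\<And>k. m k < p k" "\<And>k. p k \<le> m (Suc k)"
      and f: "\<And>k :: nat. f k \<in> dual_ball W"
        "\<And>k. d powr q < (\<Sum>n\<in>{m k..<p k}. \<bar>f k (T (x n))\<bar> powr q)"
      using nat_block_sequence[of "\<lambda>m p f. f \<in> dual_ball W \<and> d powr q < (\<Sum>n\<in>{m..<p}. \<bar>f (T (x n))\<bar> powr q)"]
      by metis
    have norming: "\<forall>k. \<exists>b. (\<Sum>n\<in>{m k..<p k}. b n * f k (T (x n)))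
          = (\<Sum>n\<in>{m k..<p k}. \<bar>f k (T (x n))\<bar> powr q) powr (1 / q) \<and>
        (\<forall>u. \<bar>\<Sum>n\<in>{m k..<p k}. b n * u n\<bar> powr q \<le> (\<Sum>n\<in>{m k..<p k}. \<bar>u n\<bar> powr q))"
    proof
      fix k
      have "0 < (\<Sum>n\<in>{m k..<p k}. \<bar>f k (T (x n))\<bar> powr q)"
        by (rule order_le_less_trans[OF _ f(2)]) simp
      then obtain b where "(\<Sum>n\<in>{m k..<p k}. b n * f k (T (x n)))
          = (\<Sum>n\<in>{m k..<p k}. \<bar>f k (T (x n))\<bar> powr q) powr (1 / q)"
        "\<And>u. \<bar>\<Sum>n\<in>{m k..<p k}. b n * u n\<bar> powr q \<le> (\<Sum>n\<in>{m k..<p k}. \<bar>u n\<bar> powr q)"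
        by (rule norming_coefficients[OF q finite_atLeastLessThan]) blast
      then show "\<exists>b. (\<Sum>n\<in>{m k..<p k}. b n * f k (T (x n)))
            = (\<Sum>n\<in>{m k..<p k}. \<bar>f k (T (x n))\<bar> powr q) powr (1 / q) \<and>
          (\<forall>u. \<bar>\<Sum>n\<in>{m k..<p k}. b n * u n\<bar> powr q \<le> (\<Sum>n\<in>{m k..<p k}. \<bar>u n\<bar> powr q))"
        by (intro exI[of _ b] conjI allI)
    qed
    from choice[OF norming] obtain b where b: "\<forall>k. (\<Sum>n\<in>{m k..<p k}. b k n * f k (T (x n)))
          = (\<Sum>n\<in>{m k..<p k}. \<bar>f k (T (x n))\<bar> powr q) powr (1 / q) \<and>
        (\<forall>u. \<bar>\<Sum>n\<in>{m k..<p k}. b k n * u n\<bar> powr q \<le> (\<Sum>n\<in>{m k..<p k}. \<bar>u n\<bar> powr q))"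
      ..
    have b1: "(\<Sum>n\<in>{m k..<p k}. b k n * f k (T (x n)))
          = (\<Sum>n\<in>{m k..<p k}. \<bar>f k (T (x n))\<bar> powr q) powr (1 / q)" for k
      using b by (rule allE) (erule conjunct1)
    have b2: "\<bar>\<Sum>n\<in>{m k..<p k}. b k n * u n\<bar> powr q \<le> (\<Sum>n\<in>{m k..<p k}. \<bar>u n\<bar> powr q)" for k u
      using b by simp
    define y where "y k = finsum V (\<lambda>n. b k n \<odot>\<^bsub>V\<^esub> x n) {m k..<p k}" for k
    have yV: "y k \<in> carrier V" for k
      unfolding y_def using xV by (intro V.M.finsum_closed) auto
    have gy: "g (y k) = (\<Sum>n\<in>{m k..<p k}. b k n * g (x n))" if "g \<in> dual V" for g k
      unfolding y_def by (subst V.dual_finsum[OF that]) (auto simp: V.dual_simps[OF that] xV)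
    have "weakly_summable q V y"
      unfolding weakly_summable_def
    proof (intro conjI ballI)
      show "range y \<subseteq> carrier V" using yV by auto
      fix g assume g: "g \<in> dual V"
      have sm: "summable (\<lambda>n. \<bar>g (x n)\<bar> powr q)" using x g by (auto simp: weakly_summable_def)
      show "summable (\<lambda>k. \<bar>g (y k)\<bar> powr q)"
      proof (rule summableI_nonneg_bounded)
        fix K
        have "(\<Sum>k<K. \<bar>g (y k)\<bar> powr q) \<le> (\<Sum>k<K. \<Sum>n\<in>{m k..<p k}. \<bar>g (x n)\<bar> powr q)"
          unfolding gy[OF g] by (intro sum_mono b2)
        also have "\<dots> \<le> (\<Sum>n<m K. \<bar>g (x n)\<bar> powr q)"
          using mp by (intro sum_disjoint_intervals_le) auto
        also have "\<dots> \<le> (\<Sum>n. \<bar>g (x n)\<bar> powr q)" by (intro sum_le_suminf sm) auto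
        finally show "(\<Sum>k<K. \<bar>g (y k)\<bar> powr q) \<le> (\<Sum>n. \<bar>g (x n)\<bar> powr q)" .
      qed simp
    qed
    then have "(\<lambda>k. nrm W (T (y k))) \<longlonglongrightarrow> 0" by (rule null)
    then have "eventually (\<lambda>k. nrm W (T (y k)) < d) sequentially"
      using \<open>d > 0\<close> by (rule order_tendstoD)
    then obtain k where k: "nrm W (T (y k)) < d" by (auto simp: eventually_sequentially)
    have fk: "f k \<in> dual W" using f(1) by (simp add: dual_ball_def)
    have "d = (d powr q) powr (1 / q)" using \<open>d > 0\<close> q by (simp add: powr_powr)
    also have "\<dots> \<le> (\<Sum>n\<in>{m k..<p k}. \<bar>f k (T (x n))\<bar> powr q) powr (1 / q)"
      using f(2)[of k] q by (intro powr_mono2) auto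
    also have "\<dots> = f k (T (y k))" using b1[of k] gy[OF dual_comp[OF fk]] by simp
    also have "\<dots> \<le> nrm W (T (y k))" using f(1)[of k] yV[of k] by (fastforce simp: dual_ball_def abs_le_iff)
    finally show False using k by simp
  qed
  then show "unconditionally_summable q W (\<lambda>n. T (x n))"
    using weakly_summable_image[OF x] by (simp add: unconditionally_summable_def)
qed

end

section \<open>Uniform boundedness of weakly summable sequences\<close>

lemma abs_powr_midpoint:
  assumes "1 \<le> (q :: real)"
  shows "\<bar>b :: real\<bar> powr q \<le> (\<bar>a + b\<bar> powr q + \<bar>a - b\<bar> powr q) / 2"
  using convex_onD[OF convex_on_abs_powr[OF assms], of "1/2" "a + b" "b - a"]
  by (simp add: abs_minus_commute field_simps)

lemma abs_powr_add:
  assumes "1 \<le> (q :: real)"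
  shows "\<bar>a + b :: real\<bar> powr q \<le> 2 powr q * (\<bar>a\<bar> powr q + \<bar>b\<bar> powr q)"
proof -
  have "\<bar>a + b\<bar> powr q \<le> (\<bar>2 * a\<bar> powr q + \<bar>2 * b\<bar> powr q) / 2"
    using convex_onD[OF convex_on_abs_powr[OF assms], of "1/2" "2 * a" "2 * b"] by simp
  also have "\<dots> = 2 powr q * (\<bar>a\<bar> powr q + \<bar>b\<bar> powr q) / 2"
    by (simp add: abs_mult powr_mult algebra_simps)
  also have "\<dots> \<le> 2 powr q * (\<bar>a\<bar> powr q + \<bar>b\<bar> powr q)" by simp
  finally show ?thesis .
qed

context normed_space
begin

lemma dual_ball_simps:
  assumes "f \<in> dual_ball V"
  shows "f \<in> dual V" "x \<in> carrier V \<Longrightarrow> \<bar>f x\<bar> \<le> nrm V x"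
  using assms by (auto simp: dual_ball_def)

text \<open>
  The uniform boundedness principle for the seminorms \<open>f \<mapsto> (\<Sum>j<n. \<bar>f (x j)\<bar> powr q) powr (1 / q)\<close>
  on the dual space, proved by a gliding hump. Otherwise there are \<open>g i\<close> in the dual ball and
  \<open>N i\<close> such that the \<open>q\<close>-sum \<open>G (N i) (g i)\<close> is huge and maximal over the ball up to the factor
  2. In the series \<open>f = (\<Sum>i. s i * (1/9) ^ i * g i)\<close> the signs \<open>s i\<close> are chosen so that the
  partial sum up to \<open>i\<close> has at least the \<open>q\<close>-sum of its last term: one of the two signs does this
  by convexity. The rest of the series is \<open>(1/9) ^ i / 8\<close> times a functional in the dual ball,
  which is too small to cancel that \<open>q\<close>-sum. So the \<open>q\<close>-sums of \<open>f\<close> are unbounded, although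
  \<open>f\<close> is a bounded functional.
\<close>

lemma weakly_summable_uniform_bound:
  assumes q: "1 \<le> q" and x: "weakly_summable q V x"
  shows "\<exists>M. \<forall>f\<in>dual_ball V. \<forall>n. (\<Sum>j<n. \<bar>f (x j)\<bar> powr q) \<le> M"
proof (rule ccontr)
  assume contra: "\<not> ?thesis"
  define G where "G n f = (\<Sum>j<n. \<bar>f (x j)\<bar> powr q)" for n :: nat and f :: "'a \<Rightarrow> real"
  define r :: real where "r = 1/9"
  have xV: "x j \<in> carrier V" for j using x by (auto simp: weakly_summable_def)
  have G_nonneg: "0 \<le> G n f" for n f by (simp add: G_def sum_nonneg)
  have big: "\<exists>n g. g \<in> dual_ball V \<and> M < G n g \<and> (\<forall>u\<in>dual_ball V. G n u \<le> 2 * G n g)"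
    if "0 \<le> M" for M
  proof -
    obtain f n where f: "f \<in> dual_ball V" "2 * M < G n f"
      using contra unfolding G_def by (meson not_le)
    have bdd: "bdd_above (G n ` dual_ball V)"
    proof (rule bdd_aboveI2)
      fix u assume "u \<in> dual_ball V"
      then show "G n u \<le> (\<Sum>j<n. nrm V (x j) powr q)"
        unfolding G_def using q xV dual_ball_simps by (intro sum_mono powr_mono2) auto
    qed
    define S where "S = (SUP u\<in>dual_ball V. G n u)"
    have S: "G n u \<le> S" if "u \<in> dual_ball V" for u
      unfolding S_def using bdd that by (rule cSUP_upper2) simp
    have "0 < S" using S[OF f(1)] f(2) \<open>0 \<le> M\<close> by linarith
    then have "S / 2 < S" by simp
    then obtain g where g: "g \<in> dual_ball V" "S / 2 < G n g"
      unfolding S_def using less_cSUP_iff[OF _ bdd] f(1) by blast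
    show ?thesis using g S[OF f(1)] f(2) S by (intro exI[of _ n] exI[of _ g]) force
  qed
  have "\<exists>n g. g \<in> dual_ball V \<and> real i * (2 * 2 powr q) / (r ^ i) powr q < G n g \<and>
      (\<forall>u\<in>dual_ball V. G n u \<le> 2 * G n g)" for i
    by (rule big) (simp add: r_def)
  then obtain N g where g: "\<And>i. g i \<in> dual_ball V"
    and large: "\<And>i. real i * (2 * 2 powr q) / (r ^ i) powr q < G (N i) (g i)"
    and near_max: "\<And>i u. u \<in> dual_ball V \<Longrightarrow> G (N i) u \<le> 2 * G (N i) (g i)"
    by metis
  define step where "step i \<phi> = (if G (N i) (\<lambda>v. \<phi> v - r ^ i * g i v) \<le> G (N i) (\<lambda>v. \<phi> v + r ^ i * g i v)
      then (\<lambda>v. \<phi> v + r ^ i * g i v) else (\<lambda>v. \<phi> v - r ^ i * g i v))" for i \<phi>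
  define F where "F = rec_nat (\<lambda>_. 0) step"
  have F_0: "F 0 = (\<lambda>_. 0)" and F_Suc: "F (Suc i) = step i (F i)" for i by (simp_all add: F_def)
  have "\<exists>s. \<bar>s\<bar> = 1 \<and> F (Suc i) = (\<lambda>v. F i v + s * (r ^ i * g i v))" for i
    by (cases "G (N i) (\<lambda>v. F i v - r ^ i * g i v) \<le> G (N i) (\<lambda>v. F i v + r ^ i * g i v)")
       (auto simp: F_Suc step_def intro: exI[of _ 1] exI[of _ "-1"])
  then obtain s where s: "\<And>i. \<bar>s i\<bar> = (1 :: real)"
    and F_s: "\<And>i v. F (Suc i) v = F i v + s i * (r ^ i * g i v)"
    by metis
  have F_sum: "F i v = (\<Sum>l<i. s l * (r ^ l * g l v))" for i v
    by (induction i) (simp_all add: F_0 F_s)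
  have F_large: "(r ^ i) powr q * G (N i) (g i) \<le> G (N i) (F (Suc i))" for i
  proof -
    let ?p = "G (N i) (\<lambda>v. F i v + r ^ i * g i v)" and ?m = "G (N i) (\<lambda>v. F i v - r ^ i * g i v)"
    have "(r ^ i) powr q * G (N i) (g i) = (\<Sum>j<N i. \<bar>r ^ i * g i (x j)\<bar> powr q)"
      by (simp add: G_def sum_distrib_left abs_mult powr_mult r_def)
    also have "\<dots> \<le> (\<Sum>j<N i. (\<bar>F i (x j) + r ^ i * g i (x j)\<bar> powr q
        + \<bar>F i (x j) - r ^ i * g i (x j)\<bar> powr q) / 2)"
      by (intro sum_mono abs_powr_midpoint q)
    also have "\<dots> = (?p + ?m) / 2" by (simp add: G_def sum.distrib flip: sum_divide_distrib)
    also have "\<dots> \<le> G (N i) (F (Suc i))" by (auto simp: F_Suc step_def)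
    finally show ?thesis .
  qed
  define h where "h v l = s l * (r ^ l * g l v)" for v l
  have h_le: "\<bar>h v l\<bar> \<le> r ^ l * nrm V v" if "v \<in> carrier V" for v l
    using dual_ball_simps(2)[OF g that] s[of l] by (simp add: h_def abs_mult r_def mult_left_mono)
  have geo: "(\<lambda>l. r ^ (l + i) * c) sums (r ^ i * c * (9/8))" for c i
  proof -
    have "(\<lambda>l. r ^ l * (r ^ i * c)) sums ((1 / (1 - r)) * (r ^ i * c))"
      by (intro sums_mult2 geometric_sums) (simp add: r_def)
    then show ?thesis by (simp add: power_add r_def mult_ac)
  qed
  have h_summable: "summable (h v)" if "v \<in> carrier V" for v
    using geo[of 0 "nrm V v"] h_le[OF that]
    by (intro summable_comparison_test[OF _ sums_summable[of "\<lambda>l. r ^ l * nrm V v"]]) (auto simp del: abs_mult)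
  define f where "f v = suminf (h v)" for v
  have tail: "\<bar>f v - F i v\<bar> \<le> r ^ i * nrm V v * (9/8)" if v: "v \<in> carrier V" for v i
  proof -
    have "f v - F i v = (\<Sum>l. h v (l + i))"
      unfolding f_def F_sum using suminf_split_initial_segment[OF h_summable[OF v], of i] by (simp add: h_def)
    moreover have "\<bar>\<Sum>l. h v (l + i)\<bar> \<le> (\<Sum>l. r ^ (l + i) * nrm V v)"
    proof -
      have sm: "summable (\<lambda>l. \<bar>h v (l + i)\<bar>)"
        using h_le[OF v] by (intro summable_comparison_test[OF _ sums_summable[OF geo]]) auto
      have "\<bar>\<Sum>l. h v (l + i)\<bar> \<le> (\<Sum>l. \<bar>h v (l + i)\<bar>)" by (rule summable_rabs[OF sm])
      also have "\<dots> \<le> (\<Sum>l. r ^ (l + i) * nrm V v)"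
        by (intro suminf_le h_le v sm sums_summable[OF geo])
      finally show ?thesis .
    qed
    ultimately show ?thesis using sums_unique[OF geo[of i "nrm V v"]] by simp
  qed
  have f_add: "f (u \<oplus> v) = f u + f v" if "u \<in> carrier V" "v \<in> carrier V" for u v
  proof -
    have "h (u \<oplus> v) = (\<lambda>l. h u l + h v l)"
      using dual_simps(1)[OF dual_ball_simps(1)[OF g] that] by (simp add: h_def fun_eq_iff algebra_simps)
    then show ?thesis unfolding f_def using suminf_add[OF h_summable h_summable] that by simp
  qed
  have f_smult: "f (a \<odot> v) = a * f v" if "v \<in> carrier V" for a v
  proof -
    have "h (a \<odot> v) = (\<lambda>l. a * h v l)"
      using dual_simps(2)[OF dual_ball_simps(1)[OF g] that] by (simp add: h_def fun_eq_iff algebra_simps)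
    then show ?thesis unfolding f_def using suminf_mult[OF h_summable] that by simp
  qed
  have "f \<in> dual V"
    unfolding dual_def using f_add f_smult tail[of _ 0]
    by (auto simp: F_0 intro!: exI[of _ "9/8"] simp: mult.commute)
  then have sm: "summable (\<lambda>j. \<bar>f (x j)\<bar> powr q)" using x by (auto simp: weakly_summable_def)
  have "real i \<le> G (N i) f" for i
  proof -
    \<comment> \<open>The rest of the series, rescaled into the dual ball: the ratio 1/9 gives 1/9 + 1/81 + ... = 1/8.\<close>
    define u where "u v = (F (Suc i) v - f v) * (8 / r ^ i)" for v
    have r: "0 < r ^ i" by (simp add: r_def)
    have u_le: "\<bar>u v\<bar> \<le> nrm V v" if "v \<in> carrier V" for v
    proof -
      have "\<bar>u v\<bar> = \<bar>f v - F (Suc i) v\<bar> * (8 / r ^ i)"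
        using r by (simp only: u_def abs_mult abs_minus_commute[of "F (Suc i) v"]) simp
      also have "\<dots> \<le> (r ^ Suc i * nrm V v * (9/8)) * (8 / r ^ i)"
        using r by (intro mult_right_mono tail that) auto
      also have "\<dots> = nrm V v" by (simp add: r_def)
      finally show ?thesis .
    qed
    have "F (Suc i) (a \<oplus> b) = F (Suc i) a + F (Suc i) b" if "a \<in> carrier V" "b \<in> carrier V" for a b
      unfolding F_sum using dual_simps(1)[OF dual_ball_simps(1)[OF g] that]
      by (simp only: algebra_simps sum.distrib)
    then have u_add: "u (a \<oplus> b) = u a + u b" if "a \<in> carrier V" "b \<in> carrier V" for a b
      using that f_add by (simp add: u_def add_divide_distrib diff_divide_distrib algebra_simps)
    have "F (Suc i) (c \<odot> a) = c * F (Suc i) a" if "a \<in> carrier V" for a c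
      unfolding F_sum using dual_simps(2)[OF dual_ball_simps(1)[OF g] that]
      by (simp only: sum_distrib_left mult_ac)
    then have u_smult: "u (c \<odot> a) = c * u a" if "a \<in> carrier V" for a c
      using that f_smult by (simp add: u_def add_divide_distrib diff_divide_distrib algebra_simps)
    have "u \<in> dual_ball V"
      unfolding dual_ball_def dual_def using u_le u_add u_smult by (auto intro!: exI[of _ 1])
    then have u: "G (N i) u \<le> 2 * G (N i) (g i)" by (rule near_max)
    define A where "A = (r ^ i) powr q * G (N i) (g i)"
    have Fu: "F (Suc i) v - f v = (r ^ i / 8) * u v" for v by (simp add: u_def r_def)
    have "\<bar>F (Suc i) v - f v\<bar> powr q = (r ^ i / 8) powr q * \<bar>u v\<bar> powr q" for v
    proof -
      have e: "\<bar>F (Suc i) v - f v\<bar> = (r ^ i / 8) * \<bar>u v\<bar>" unfolding Fu abs_mult using r by simp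
      show ?thesis unfolding e by (rule powr_mult; use r in simp)
    qed
    then have diff: "G (N i) (\<lambda>v. F (Suc i) v - f v) = ((r ^ i / 8) powr q) * G (N i) u"
      by (simp add: G_def sum_distrib_left)
    have "(1/8::real) powr q * 2 powr q * 4 \<le> 1"
    proof -
      have "(1/8::real) powr q * 2 powr q = (1/4) powr q" by (simp flip: powr_mult)
      also have "\<dots> \<le> (1/4) powr 1" using q by (intro powr_mono') auto
      finally show ?thesis by simp
    qed
    have "A \<le> G (N i) (F (Suc i))" unfolding A_def by (rule F_large)
    also have "\<dots> \<le> (\<Sum>j<N i. 2 powr q * (\<bar>f (x j)\<bar> powr q + \<bar>F (Suc i) (x j) - f (x j)\<bar> powr q))"
      unfolding G_def using abs_powr_add[OF q] by (intro sum_mono) (metis add_diff_cancel_left' diff_add_cancel add.commute)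
    also have "\<dots> = 2 powr q * (G (N i) f + ((r ^ i / 8) powr q) * G (N i) u)"
      unfolding diff[symmetric] by (simp add: G_def sum_distrib_left sum.distrib distrib_left)
    also have "\<dots> \<le> 2 powr q * (G (N i) f + ((r ^ i / 8) powr q) * (2 * G (N i) (g i)))"
      using u by (intro mult_left_mono add_left_mono) auto
    also have "\<dots> = 2 powr q * G (N i) f + ((1/8) powr q * 2 powr q * 4) * (A / 2)"
      using r by (simp add: A_def powr_divide field_simps)
    also have "\<dots> \<le> 2 powr q * G (N i) f + 1 * (A / 2)"
      using \<open>(1/8::real) powr q * 2 powr q * 4 \<le> 1\<close> G_nonneg
      by (intro add_left_mono mult_right_mono) (auto simp: A_def)
    finally have "A \<le> G (N i) f * (2 * 2 powr q)" by (simp add: mult_ac)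
    moreover have "real i * (2 * 2 powr q) < A"
    proof -
      have "0 < (r ^ i) powr q" by (simp add: r_def)
      then show ?thesis using large[of i] unfolding A_def by (simp only: pos_divide_less_eq mult.commute)
    qed
    ultimately have "real i * (2 * 2 powr q) < G (N i) f * (2 * 2 powr q)" by linarith
    then show ?thesis by (simp add: mult_less_cancel_right)
  qed
  moreover have "G (N i) f \<le> (\<Sum>j. \<bar>f (x j)\<bar> powr q)" for i
    unfolding G_def by (intro sum_le_suminf sm) auto
  ultimately have "real i \<le> (\<Sum>j. \<bar>f (x j)\<bar> powr q)" for i by (meson order_trans)
  then show False by (metis reals_Archimedean2 not_le)
qed

end

section \<open>Precompact images of unconditional decompositions\<close>

context normed_space
begin

text \<open>
  Total boundedness with nets taken from the whole space instead of from the set itself; sums and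
  multiples of nets then serve for sums and multiples of sets.
\<close>

definition precompact :: "'a set \<Rightarrow> bool" where
  "precompact A \<longleftrightarrow> A \<subseteq> carrier V \<and>
     (\<forall>e>0. \<exists>F. finite F \<and> F \<subseteq> carrier V \<and> (\<forall>a\<in>A. \<exists>b\<in>F. nrm V (a \<ominus> b) < e))"

lemma precompactD:
  assumes "precompact A"
  shows "A \<subseteq> carrier V"
    "e > 0 \<Longrightarrow> \<exists>F. finite F \<and> F \<subseteq> carrier V \<and> (\<forall>a\<in>A. \<exists>b\<in>F. nrm V (a \<ominus> b) < e)"
  using assms by (auto simp: precompact_def)

lemma precompact_subset: "precompact B \<Longrightarrow> A \<subseteq> B \<Longrightarrow> precompact A"
  unfolding precompact_def by (meson order_trans subsetD)

lemma diff_self [simp]: "x \<in> carrier V \<Longrightarrow> x \<ominus> x = \<zero>"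
  by (simp add: diff_eq_zero_iff)

lemma finsum_lessThan_split:
  assumes y: "\<And>n. y n \<in> carrier V" and "a \<le> (b :: nat)"
  shows "finsum V y {..<b} = finsum V y {..<a} \<oplus> finsum V y {a..<b}"
proof -
  have "{..<b} = {..<a} \<union> {a..<b}" "{..<a} \<inter> {a..<b} = {}" using assms(2) by auto
  then show ?thesis using y by (auto intro!: M.finsum_Un_disjoint)
qed

lemma precompact_zero: "precompact {\<zero>}"
  unfolding precompact_def by (auto intro!: exI[of _ "{\<zero>}"])

lemma add_diff_add:
  assumes "a \<in> carrier V" "a' \<in> carrier V" "b \<in> carrier V" "b' \<in> carrier V"
  shows "(a \<oplus> a') \<ominus> (b \<oplus> b') = (a \<ominus> b) \<oplus> (a' \<ominus> b')"
  using assms by (simp add: a_minus_def M.minus_add M.a_ac)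

lemma smult_diff:
  assumes "a \<in> carrier V" "b \<in> carrier V" shows "c \<odot> (a \<ominus> b) = (c \<odot> a) \<ominus> (c \<odot> b)"
  using assms by (simp add: a_minus_def a_inv_eq_smult smult_add_right smult_assoc)

lemma precompact_add:
  assumes A: "precompact A" and B: "precompact B"
  shows "precompact {a \<oplus> b | a b. a \<in> A \<and> b \<in> B}"
  unfolding precompact_def
proof (intro conjI allI impI)
  show "{a \<oplus> b | a b. a \<in> A \<and> b \<in> B} \<subseteq> carrier V"
    using precompactD(1)[OF A] precompactD(1)[OF B] by auto
  fix e :: real assume "e > 0"
  obtain F where F: "finite F" "F \<subseteq> carrier V" "\<And>a. a \<in> A \<Longrightarrow> \<exists>b\<in>F. nrm V (a \<ominus> b) < e / 2"
    using precompactD(2)[OF A, of "e / 2"] \<open>e > 0\<close> by auto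
  obtain G where G: "finite G" "G \<subseteq> carrier V" "\<And>a. a \<in> B \<Longrightarrow> \<exists>b\<in>G. nrm V (a \<ominus> b) < e / 2"
    using precompactD(2)[OF B, of "e / 2"] \<open>e > 0\<close> by auto
  have "\<exists>c\<in>(\<lambda>(u, v). u \<oplus> v) ` (F \<times> G). nrm V ((a \<oplus> b) \<ominus> c) < e" if ab: "a \<in> A" "b \<in> B" for a b
  proof -
    obtain u v where uv: "u \<in> F" "v \<in> G" "nrm V (a \<ominus> u) < e / 2" "nrm V (b \<ominus> v) < e / 2"
      using F(3)[OF ab(1)] G(3)[OF ab(2)] by blast
    have mem: "a \<in> carrier V" "b \<in> carrier V" "u \<in> carrier V" "v \<in> carrier V"
      using ab uv F(2) G(2) precompactD(1)[OF A] precompactD(1)[OF B] by auto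
    have "nrm V ((a \<oplus> b) \<ominus> (u \<oplus> v)) \<le> nrm V (a \<ominus> u) + nrm V (b \<ominus> v)"
      using mem by (simp add: add_diff_add nrm_triangle)
    then show ?thesis using uv by (intro bexI[of _ "u \<oplus> v"]) auto
  qed
  then show "\<exists>H. finite H \<and> H \<subseteq> carrier V
      \<and> (\<forall>c\<in>{a \<oplus> b | a b. a \<in> A \<and> b \<in> B}. \<exists>h\<in>H. nrm V (c \<ominus> h) < e)"
    using F(1,2) G(1,2) by (intro exI[of _ "(\<lambda>(u, v). u \<oplus> v) ` (F \<times> G)"]) auto
qed

lemma precompact_finsum:
  assumes A: "\<And>n. n < N \<Longrightarrow> precompact (A n)"
  shows "precompact {finsum V y {..<N :: nat} | y. \<forall>n<N. y n \<in> A n}"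
  using A
proof (induction N)
  case 0 then show ?case using precompact_zero by (rule_tac precompact_subset) auto
next
  case (Suc N)
  have "precompact {a \<oplus> b | a b. a \<in> A N \<and> b \<in> {finsum V y {..<N} | y. \<forall>n<N. y n \<in> A n}}"
    using Suc by (intro precompact_add) auto
  then show ?case
  proof (rule precompact_subset, clarify)
    fix y assume y: "\<forall>n<Suc N. y n \<in> A n"
    have "y \<in> {..<Suc N} \<rightarrow> carrier V"
      using y precompactD(1)[OF Suc.prems] by (auto simp: subset_iff)
    then have "finsum V y {..<Suc N} = y N \<oplus> finsum V y {..<N}" by (rule finsum_lessThan_Suc)
    then show "\<exists>a b. finsum V y {..<Suc N} = a \<oplus> b \<and> a \<in> A N \<and> b \<in> {finsum V y {..<N} | y. \<forall>n<N. y n \<in> A n}"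
      using y by (intro exI[of _ "y N"] exI[of _ "finsum V y {..<N}"]) auto
  qed
qed

lemma precompact_smult:
  assumes A: "precompact A" shows "precompact ((\<odot>) c ` A)"
  unfolding precompact_def
proof (intro conjI allI impI)
  show "(\<odot>) c ` A \<subseteq> carrier V" using precompactD(1)[OF A] by auto
  fix e :: real assume "e > 0"
  then obtain F where F: "finite F" "F \<subseteq> carrier V"
    "\<And>a. a \<in> A \<Longrightarrow> \<exists>b\<in>F. nrm V (a \<ominus> b) < e / (\<bar>c\<bar> + 1)"
    using precompactD(2)[OF A, of "e / (\<bar>c\<bar> + 1)"] by auto
  have "\<exists>b\<in>(\<odot>) c ` F. nrm V (c \<odot> a \<ominus> b) < e" if a: "a \<in> A" for a
  proof -
    obtain b where b: "b \<in> F" "nrm V (a \<ominus> b) < e / (\<bar>c\<bar> + 1)" using F(3)[OF a] by blast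
    have mem: "a \<in> carrier V" "b \<in> carrier V" using a b F(2) precompactD(1)[OF A] by auto
    have "nrm V (c \<odot> a \<ominus> c \<odot> b) = \<bar>c\<bar> * nrm V (a \<ominus> b)"
      using mem by (simp add: nrm_smult flip: smult_diff)
    also have "\<dots> \<le> (\<bar>c\<bar> + 1) * nrm V (a \<ominus> b)" using mem by (intro mult_right_mono) auto
    also have "\<dots> < e" using b(2) by (simp add: field_simps)
    finally show ?thesis using b(1) by blast
  qed
  then show "\<exists>F. finite F \<and> F \<subseteq> carrier V \<and> (\<forall>a\<in>(\<odot>) c ` A. \<exists>b\<in>F. nrm V (a \<ominus> b) < e)"
    using F(1,2) by (intro exI[of _ "(\<odot>) c ` F"]) auto
qed

lemma precompact_segment:
  assumes v: "v \<in> carrier V" shows "precompact {t \<odot> v | t. \<bar>t\<bar> \<le> M}"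
  unfolding precompact_def
proof (intro conjI allI impI)
  show "{t \<odot> v | t. \<bar>t\<bar> \<le> M} \<subseteq> carrier V" using v by auto
  fix e :: real assume "e > 0"
  define d where "d = e / (nrm V v + 1)"
  have pos: "0 < nrm V v + 1" using nrm_nonneg[OF v] by linarith
  then have "d > 0" using \<open>e > 0\<close> by (simp add: d_def)
  then obtain K where K: "finite K" "{-M..M} \<subseteq> (\<Union>s\<in>K. ball s d)"
    using compact_eq_totally_bounded[of "{-M..M}"] by auto
  have "\<exists>s\<in>K. nrm V (t \<odot> v \<ominus> s \<odot> v) < e" if t: "\<bar>t\<bar> \<le> M" for t
  proof -
    have "t \<in> {-M..M}" using t by auto
    then obtain s where s: "s \<in> K" "\<bar>t - s\<bar> < d" using K(2) by (auto simp: dist_real_def abs_minus_commute)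
    have "t \<odot> v \<ominus> s \<odot> v = (t - s) \<odot> v"
      using v smult_add_left[OF v, of t "-s"] by (simp add: a_minus_def smult_neg)
    then have "nrm V (t \<odot> v \<ominus> s \<odot> v) = \<bar>t - s\<bar> * nrm V v" using v by (simp add: nrm_smult)
    also have "\<dots> \<le> \<bar>t - s\<bar> * (nrm V v + 1)" by (intro mult_left_mono) auto
    also have "\<dots> < d * (nrm V v + 1)" using s(2) pos by (intro mult_strict_right_mono)
    also have "\<dots> = e" using pos by (simp add: d_def)
    finally show ?thesis using s(1) by blast
  qed
  then show "\<exists>F. finite F \<and> F \<subseteq> carrier V \<and> (\<forall>a\<in>{t \<odot> v | t. \<bar>t\<bar> \<le> M}. \<exists>b\<in>F. nrm V (a \<ominus> b) < e)"
    using K(1) v by (intro exI[of _ "(\<lambda>s. s \<odot> v) ` K"]) auto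
qed

lemma precompact_approx:
  assumes A: "A \<subseteq> carrier V"
    and B: "\<And>e. e > 0 \<Longrightarrow> \<exists>B. precompact B \<and> (\<forall>a\<in>A. \<exists>b\<in>B. nrm V (a \<ominus> b) < e)"
  shows "precompact A"
  unfolding precompact_def
proof (intro conjI allI impI A)
  fix e :: real assume "e > 0"
  obtain B where pB: "precompact B" and B: "\<And>a. a \<in> A \<Longrightarrow> \<exists>b\<in>B. nrm V (a \<ominus> b) < e / 2"
    using assms(2)[of "e / 2"] \<open>e > 0\<close> by auto
  obtain F where F: "finite F" "F \<subseteq> carrier V" "\<And>a. a \<in> B \<Longrightarrow> \<exists>b\<in>F. nrm V (a \<ominus> b) < e / 2"
    using precompactD(2)[OF pB, of "e / 2"] \<open>e > 0\<close> by auto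
  have "\<exists>c\<in>F. nrm V (a \<ominus> c) < e" if a: "a \<in> A" for a
  proof -
    obtain b c where bc: "b \<in> B" "c \<in> F" "nrm V (a \<ominus> b) < e / 2" "nrm V (b \<ominus> c) < e / 2"
      using B[OF a] F(3) by blast
    have "nrm V (a \<ominus> c) \<le> nrm V (a \<ominus> b) + nrm V (b \<ominus> c)"
      using a bc A F(2) precompactD(1)[OF pB] by (intro nrm_diff_triangle) auto
    then show ?thesis using bc by (intro bexI[of _ c]) auto
  qed
  then show "\<exists>F. finite F \<and> F \<subseteq> carrier V \<and> (\<forall>a\<in>A. \<exists>b\<in>F. nrm V (a \<ominus> b) < e)"
    using F by blast
qed

text \<open>The points of a net of half the mesh are moved into the set.\<close>

lemma precompact_imp_mtotally_bounded:
  assumes A: "precompact A"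
  shows "Metric_space.mtotally_bounded (carrier V) (nrm_dist V) A"
proof -
  interpret VM: Metric_space "carrier V" "nrm_dist V" by (rule Metric_space_nrm_dist)
  have AV: "A \<subseteq> carrier V" by (rule precompactD(1)[OF A])
  show ?thesis
    unfolding VM.mtotally_bounded_def
  proof (intro allI impI)
    fix e :: real assume "e > 0"
    then obtain F where F: "finite F" "F \<subseteq> carrier V" "\<And>a. a \<in> A \<Longrightarrow> \<exists>b\<in>F. nrm V (a \<ominus> b) < e / 2"
      using precompactD(2)[OF A, of "e / 2"] by auto
    define G where "G = {b \<in> F. \<exists>a\<in>A. nrm V (a \<ominus> b) < e / 2}"
    define p where "p b = (SOME a. a \<in> A \<and> nrm V (a \<ominus> b) < e / 2)" for b
    have p: "p b \<in> A \<and> nrm V (p b \<ominus> b) < e / 2" if "b \<in> G" for b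
      unfolding p_def by (rule someI_ex) (use that in \<open>auto simp: G_def\<close>)
    have "A \<subseteq> (\<Union>x\<in>p ` G. VM.mball x e)"
    proof
      fix a assume a: "a \<in> A"
      then obtain b where b: "b \<in> G" "nrm V (a \<ominus> b) < e / 2" using F(3) G_def by blast
      have mem: "a \<in> carrier V" "b \<in> carrier V" "p b \<in> carrier V"
        using a b p[OF b(1)] AV F(2) by (auto simp: G_def)
      have "nrm V (p b \<ominus> a) \<le> nrm V (p b \<ominus> b) + nrm V (b \<ominus> a)"
        using mem by (intro nrm_diff_triangle)
      also have "\<dots> < e" using b p[OF b(1)] mem by (simp add: nrm_diff_commute[of b a])
      finally have "a \<in> VM.mball (p b) e" using mem by (simp add: nrm_dist_def)
      then show "a \<in> (\<Union>x\<in>p ` G. VM.mball x e)" using b(1) by blast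
    qed
    moreover have "finite (p ` G)" using F(1) by (simp add: G_def)
    moreover have "p ` G \<subseteq> A" using p by blast
    ultimately show "\<exists>K. finite K \<and> K \<subseteq> A \<and> A \<subseteq> (\<Union>x\<in>K. VM.mball x e)" by blast
  qed
qed

lemma dual_diff:
  assumes "f \<in> dual V" "x \<in> carrier V" "y \<in> carrier V" shows "f (x \<ominus> y) = f x - f y"
  using assms by (simp add: a_minus_def a_inv_eq_smult dual_simps)

lemma openin_weak_imp_openin_norm:
  assumes "openin (weak_topology V) U" shows "openin (nrm_topology V) U"
proof -
  interpret VM: Metric_space "carrier V" "nrm_dist V" by (rule Metric_space_nrm_dist)
  have basic: "openin VM.mtopology {x \<in> carrier V. f x \<in> U}" if f: "f \<in> dual V" and U: "open U" for f U
    unfolding VM.openin_mtopology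
  proof (intro conjI allI impI)
    fix x assume x: "x \<in> {x \<in> carrier V. f x \<in> U}"
    obtain L where L: "\<And>y. y \<in> carrier V \<Longrightarrow> \<bar>f y\<bar> \<le> L * nrm V y"
      using f unfolding dual_def by blast
    obtain e where e: "e > 0" "ball (f x) e \<subseteq> U" using U x open_contains_ball by blast
    have "VM.mball x (e / (\<bar>L\<bar> + 1)) \<subseteq> {x \<in> carrier V. f x \<in> U}"
    proof
      fix y assume "y \<in> VM.mball x (e / (\<bar>L\<bar> + 1))"
      then have y: "y \<in> carrier V" "nrm V (x \<ominus> y) < e / (\<bar>L\<bar> + 1)"
        by (auto simp: nrm_dist_def)
      have "\<bar>f x - f y\<bar> \<le> L * nrm V (x \<ominus> y)"
        using L[of "x \<ominus> y"] x y f by (simp add: dual_diff)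
      also have "\<dots> \<le> (\<bar>L\<bar> + 1) * nrm V (x \<ominus> y)" using x y by (intro mult_right_mono) auto
      also have "\<dots> < e" using y(2) by (simp add: field_simps)
      finally have "f y \<in> ball (f x) e" by (simp add: dist_real_def)
      then show "y \<in> {x \<in> carrier V. f x \<in> U}" using e(2) y(1) by blast
    qed
    then show "\<exists>r>0. VM.mball x r \<subseteq> {x \<in> carrier V. f x \<in> U}"
      using e(1) by (intro exI[of _ "e / (\<bar>L\<bar> + 1)"]) auto
  qed auto
  have "generate_topology_on {{x \<in> carrier V. f x \<in> U} | f U. f \<in> dual V \<and> open U} U"
    using assms by (simp add: weak_topology_def openin_topology_generated_by_iff)
  then show ?thesis
  proof (induction rule: generate_topology_on.induct)
    case Empty then show ?case by simp
  next
    case (Int a b) then show ?case by (intro openin_Int)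
  next
    case (UN K) then show ?case by (intro openin_Union) auto
  next
    case (Basis s) then show ?case using basic by auto
  qed
qed

end

context bounded_linear_between
begin

text \<open>
  The norm closure of the image of the unit ball is norm compact, hence weakly compact, hence
  weakly closed since the weak topology is Hausdorff; so it contains the weak closure.
\<close>

lemma precompact_image_imp_weakly_compact_operator:
  assumes W: "banach_space W" and pre: "W.precompact (T ` {x \<in> carrier V. nrm V x \<le> 1})"
  shows "weakly_compact_operator V W T"
proof -
  interpret WM: Metric_space "carrier W" "nrm_dist W" by (rule W.Metric_space_nrm_dist)
  define A where "A = T ` {x \<in> carrier V. nrm V x \<le> 1}"
  define K where "K = WM.mtopology closure_of A"
  have AW: "A \<subseteq> carrier W" by (auto simp: A_def)
  have "compactin WM.mtopology K"
    using W WM.mtotally_bounded_eq_compact_closure_of[of A] W.precompact_imp_mtotally_bounded pre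
    by (auto simp: banach_space_def K_def A_def)
  moreover have "continuous_map WM.mtopology (weak_topology W) id"
    unfolding continuous_map_def
  proof (intro conjI allI impI)
    fix U assume U: "openin (weak_topology W) U"
    have "{x \<in> topspace WM.mtopology. id x \<in> U} = U"
      using openin_subset[OF U] by auto
    then show "openin WM.mtopology {x \<in> topspace WM.mtopology. id x \<in> U}"
      using W.openin_weak_imp_openin_norm[OF U] by simp
  qed auto
  ultimately have K: "compactin (weak_topology W) K"
    using image_compactin by fastforce
  then have "closedin (weak_topology W) K"
    using W.Hausdorff_weak_topology compactin_imp_closedin by blast
  moreover have "A \<subseteq> K" unfolding K_def by (intro closure_of_subset) (simp add: AW)
  ultimately have "weak_topology W closure_of A \<subseteq> K" by (intro closure_of_minimal)
  then show ?thesis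
    unfolding weakly_compact_operator_def A_def[symmetric]
    using closed_compactin[OF K] by simp
qed

text \<open>
  Here \<open>x = (\<Sum>n. P n x)\<close> for \<open>x\<close> in \<open>B\<close>, and the summands behave like those of a \<open>c\<^sub>0\<close>-sum. The
  operator must be uniformly small on the tails of these series: otherwise there are \<open>x k\<close> in \<open>B\<close>
  and successive blocks of \<open>(\<Sum>n. P n (x k))\<close> with images of norm at least \<open>d / 2\<close>, while signed
  sums of these blocks are bounded, so that the blocks are weakly summable. Up to a small error
  the image of \<open>B\<close> therefore lies in a finite sum of precompact sets.
\<close>

lemma precompact_image_if_unconditional_decomposition:
  fixes P :: "nat \<Rightarrow> 'a \<Rightarrow> 'a"
  assumes q: "1 \<le> q" and T: "unconditionally_converging q V W T"
    and B: "B \<subseteq> carrier V" and P: "\<And>n x. x \<in> B \<Longrightarrow> P n x \<in> carrier V"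
    and conv: "\<And>x. x \<in> B \<Longrightarrow> (\<lambda>N. nrm V (x \<ominus>\<^bsub>V\<^esub> finsum V (\<lambda>n. P n x) {..<N})) \<longlonglongrightarrow> 0"
    and unc: "\<And>y c N. (\<And>n. y n \<in> B) \<Longrightarrow> (\<And>n. \<bar>c n\<bar> \<le> 1) \<Longrightarrow>
      nrm V (finsum V (\<lambda>n. c n \<odot>\<^bsub>V\<^esub> P n (y n)) {..<N}) \<le> C"
    and pre: "\<And>n. W.precompact (T ` P n ` B)"
  shows "W.precompact (T ` B)"
proof (cases "B = {}")
  case True then show ?thesis by (simp add: W.precompact_def exI[of _ "{}"])
next
  case False
  define S where "S N x = finsum V (\<lambda>n. P n x) {..<N}" for N x
  have SV: "S N x \<in> carrier V" if "x \<in> B" for N x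
    unfolding S_def using P that by (intro V.M.finsum_closed) auto
  obtain K where K: "K > 0" "\<And>x. x \<in> carrier V \<Longrightarrow> nrm W (T x) \<le> K * nrm V x"
    using T_bound by blast
  have tail: "\<exists>N. \<forall>x\<in>B. nrm W (T x \<ominus>\<^bsub>W\<^esub> T (S N x)) \<le> d" if d: "d > 0" for d
  proof (rule ccontr)
    assume "\<not> ?thesis"
    then have far: "\<exists>x\<in>B. d < nrm W (T x \<ominus>\<^bsub>W\<^esub> T (S N x))" for N by (simp add: not_le)
    define big where "big m p x \<longleftrightarrow> x \<in> B \<and> d / 2 < nrm W (T (finsum V (\<lambda>n. P n x) {m..<p}))" for m p x
    have blocks: "\<exists>m p x. N \<le> m \<and> m < p \<and> big m p x" for N
    proof -
      obtain x where x: "x \<in> B" "d < nrm W (T x \<ominus>\<^bsub>W\<^esub> T (S N x))" using far by blast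
      have xV: "x \<in> carrier V" using x B by auto
      have "eventually (\<lambda>p. nrm V (x \<ominus>\<^bsub>V\<^esub> S p x) < d / (2 * K)) sequentially"
        unfolding S_def using conv[OF x(1)] d K(1) by (intro order_tendstoD) auto
      then have "eventually (\<lambda>p. nrm V (x \<ominus>\<^bsub>V\<^esub> S p x) < d / (2 * K) \<and> N < p) sequentially"
        by (intro eventually_conj eventually_gt_at_top)
      then obtain p where p: "nrm V (x \<ominus>\<^bsub>V\<^esub> S p x) < d / (2 * K)" "N < p"
        by (auto simp: eventually_sequentially)
      define R where "R = finsum V (\<lambda>n. P n x) {N..<p}"
      have R: "R \<in> carrier V" unfolding R_def using P x by (intro V.M.finsum_closed) auto
      have "S p x = S N x \<oplus>\<^bsub>V\<^esub> R"
        unfolding S_def R_def using P x p(2) by (intro V.finsum_lessThan_split) auto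
      then have "T (S p x) = T (S N x) \<oplus>\<^bsub>W\<^esub> T R" using SV x R by (simp add: T_add)
      then have TR: "T R = T (S p x) \<ominus>\<^bsub>W\<^esub> T (S N x)"
        using SV x R by (simp add: a_minus_def W.M.a_ac W.M.r_neg)
      have "nrm W (T x \<ominus>\<^bsub>W\<^esub> T (S p x)) \<le> K * nrm V (x \<ominus>\<^bsub>V\<^esub> S p x)"
        using K(2)[of "x \<ominus>\<^bsub>V\<^esub> S p x"] xV SV x by (simp add: T_diff)
      also have "\<dots> < d / 2" using p(1) K(1) by (simp add: field_simps)
      finally have "nrm W (T x \<ominus>\<^bsub>W\<^esub> T (S p x)) < d / 2" .
      moreover have "nrm W (T x \<ominus>\<^bsub>W\<^esub> T (S N x))
          \<le> nrm W (T x \<ominus>\<^bsub>W\<^esub> T (S p x)) + nrm W (T (S p x) \<ominus>\<^bsub>W\<^esub> T (S N x))"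
        using xV SV x by (intro W.nrm_diff_triangle) auto
      ultimately have "d / 2 < nrm W (T R)" using x(2) TR by simp
      then show ?thesis using p(2) x(1)
        unfolding R_def big_def by (intro exI[of _ N] exI[of _ p] exI[of _ x]) simp
    qed
    obtain m p x where mp: "\<And>k. m k < p k" "\<And>k. p k \<le> m (Suc k)"
      and big: "\<And>k :: nat. big (m k) (p k) (x k)"
      by (rule nat_block_sequence[of big, OF blocks]) blast
    have x: "x k \<in> B" "d / 2 < nrm W (T (finsum V (\<lambda>n. P n (x k)) {m k..<p k}))" for k
      using big[of k] by (simp_all add: big_def)
    define u where "u k = finsum V (\<lambda>n. P n (x k)) {m k..<p k}" for k
    have uV: "u k \<in> carrier V" for k unfolding u_def using P x by (intro V.M.finsum_closed) auto
    have "weakly_summable q V u"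
    proof (rule V.weakly_summable_if_signed_sums_bounded[OF q uV])
      fix c :: "nat \<Rightarrow> real" and L assume c: "\<And>k. \<bar>c k\<bar> \<le> 1"
      \<comment> \<open>A signed sum of blocks is a signed sum of single summands; between blocks the sign is 0.\<close>
      have "\<exists>y c'. (\<forall>n. y n \<in> B) \<and> (\<forall>n. \<bar>c' n\<bar> \<le> 1) \<and> (\<forall>n\<ge>m L. c' n = 0) \<and>
         finsum V (\<lambda>k. c k \<odot>\<^bsub>V\<^esub> u k) {..<L} = finsum V (\<lambda>n. c' n \<odot>\<^bsub>V\<^esub> P n (y n)) {..<m L}"
      proof (induction L)
        case 0
        obtain b where "b \<in> B" using False by blast
        moreover have "finsum V (\<lambda>n. 0 \<odot>\<^bsub>V\<^esub> P n b) {..<m 0} = finsum V (\<lambda>_. \<zero>\<^bsub>V\<^esub>) {..<m 0}"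
          using P \<open>b \<in> B\<close> by (intro V.M.finsum_cong') auto
        ultimately show ?case
          by (intro exI[of _ "\<lambda>_. b"] exI[of _ "\<lambda>_. 0"]) (simp add: V.M.finsum_zero)
      next
        case (Suc L)
        then obtain y c' where y: "\<And>n. y n \<in> B" and c': "\<And>n. \<bar>c' n\<bar> \<le> 1" "\<And>n. n \<ge> m L \<Longrightarrow> c' n = 0"
          and eq: "finsum V (\<lambda>k. c k \<odot>\<^bsub>V\<^esub> u k) {..<L} = finsum V (\<lambda>n. c' n \<odot>\<^bsub>V\<^esub> P n (y n)) {..<m L}"
          by blast
        define y' where "y' n = (if m L \<le> n then x L else y n)" for n
        define c'' where "c'' n = (if n < m L then c' n else if n < p L then c L else 0)" for n
        have y': "y' n \<in> B" for n using y x by (simp add: y'_def)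
        let ?t = "\<lambda>n. c'' n \<odot>\<^bsub>V\<^esub> P n (y' n)"
        have tV: "?t n \<in> carrier V" for n using P y' by simp
        have "finsum V ?t {..<m (Suc L)}
            = finsum V ?t {..<m L} \<oplus>\<^bsub>V\<^esub> finsum V ?t {m L..<p L} \<oplus>\<^bsub>V\<^esub> finsum V ?t {p L..<m (Suc L)}"
          using V.finsum_lessThan_split[of ?t, OF tV, of "p L" "m (Suc L)"]
            V.finsum_lessThan_split[of ?t, OF tV, of "m L" "p L"] mp(1)[of L] mp(2)[of L] by simp
        also have "finsum V ?t {p L..<m (Suc L)} = finsum V (\<lambda>_. \<zero>\<^bsub>V\<^esub>) {p L..<m (Suc L)}"
          using mp(1)[of L] P y' by (intro V.M.finsum_cong') (auto simp: c''_def)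
        also have "finsum V ?t {..<m L} = finsum V (\<lambda>n. c' n \<odot>\<^bsub>V\<^esub> P n (y n)) {..<m L}"
          using P y by (intro V.M.finsum_cong') (auto simp: c''_def y'_def)
        also have "finsum V ?t {m L..<p L} = finsum V (\<lambda>n. c L \<odot>\<^bsub>V\<^esub> P n (x L)) {m L..<p L}"
          using P x by (intro V.M.finsum_cong') (auto simp: c''_def y'_def)
        also have "\<dots> = c L \<odot>\<^bsub>V\<^esub> u L"
          unfolding u_def using P x by (subst V.finsum_smult_ldistr) auto
        finally have "finsum V ?t {..<m (Suc L)}
            = finsum V (\<lambda>k. c k \<odot>\<^bsub>V\<^esub> u k) {..<L} \<oplus>\<^bsub>V\<^esub> c L \<odot>\<^bsub>V\<^esub> u L"
          using uV P y by (simp add: eq V.M.finsum_zero)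
        also have "\<dots> = finsum V (\<lambda>k. c k \<odot>\<^bsub>V\<^esub> u k) {..<Suc L}"
          using uV by (subst V.finsum_lessThan_Suc) (auto simp: V.M.a_comm intro!: V.M.a_comm V.M.finsum_closed)
        finally show ?case
          using y' c c' mp(2)[of L] mp(1)[of L]
          by (intro exI[of _ y'] exI[of _ c'']) (auto simp: c''_def)
      qed
      then obtain y c' where "\<And>n. y n \<in> B" "\<And>n. \<bar>c' n\<bar> \<le> 1" and
        eq: "finsum V (\<lambda>k. c k \<odot>\<^bsub>V\<^esub> u k) {..<L} = finsum V (\<lambda>n. c' n \<odot>\<^bsub>V\<^esub> P n (y n)) {..<m L}"
        by blast
      then show "nrm V (finsum V (\<lambda>k. c k \<odot>\<^bsub>V\<^esub> u k) {..<L}) \<le> C" unfolding eq by (intro unc)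
    qed
    then have "(\<lambda>k. nrm W (T (u k))) \<longlonglongrightarrow> 0"
      by (rule unconditionally_converging_imp_norm_null[OF q T])
    then have "eventually (\<lambda>k. nrm W (T (u k)) < d / 2) sequentially" using d by (intro order_tendstoD) auto
    then obtain k where "nrm W (T (u k)) < d / 2" by (auto simp: eventually_sequentially)
    then show False using x(2)[of k] by (simp add: u_def)
  qed
  show ?thesis
  proof (rule W.precompact_approx)
    show "T ` B \<subseteq> carrier W" using B by auto
    fix e :: real assume e: "e > 0"
    then obtain N where N: "\<And>x. x \<in> B \<Longrightarrow> nrm W (T x \<ominus>\<^bsub>W\<^esub> T (S N x)) \<le> e / 2" using tail[of "e / 2"] by auto
    let ?A = "{finsum W y {..<N} | y. \<forall>n<N. y n \<in> T ` P n ` B}"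
    have T_sum: "T (finsum V z {..<L}) = finsum W (\<lambda>n. T (z n)) {..<L}" if "\<And>n. z n \<in> carrier V" for z and L :: nat
    proof (induction L)
      case 0
      have "T (0 \<odot>\<^bsub>V\<^esub> \<zero>\<^bsub>V\<^esub>) = 0 \<odot>\<^bsub>W\<^esub> T \<zero>\<^bsub>V\<^esub>" by (intro T_smult) simp
      then show ?case by simp
    next
      case (Suc L)
      then show ?case
        using that by (simp add: V.finsum_lessThan_Suc W.finsum_lessThan_Suc T_add Pi_iff V.M.finsum_closed)
    qed
    have "T (S N x) \<in> ?A" if "x \<in> B" for x
      unfolding S_def using that P by (intro CollectI exI[of _ "\<lambda>n. T (P n x)"]) (auto simp: T_sum)
    moreover have "nrm W (T x \<ominus>\<^bsub>W\<^esub> T (S N x)) < e" if "x \<in> B" for x using N[OF that] e by linarith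
    ultimately have "\<forall>a\<in>T ` B. \<exists>b\<in>?A. nrm W (a \<ominus>\<^bsub>W\<^esub> b) < e" by blast
    moreover have "W.precompact ?A" by (intro W.precompact_finsum pre)
    ultimately show "\<exists>A. W.precompact A \<and> (\<forall>a\<in>T ` B. \<exists>b\<in>A. nrm W (a \<ominus>\<^bsub>W\<^esub> b) < e)" by blast
  qed
qed

end

section \<open>A tree and functions with prescribed jumps at its nodes\<close>

text \<open>
  A Schreier tree. Above a nonempty node there are only nodes of bounded length, but every length
  occurs, with entries from any given infinite set. The constant 2 gives a child to every node of
  length 1.
\<close>

definition tree :: "nat list set" where
  "tree = {s. sorted s \<and> (s = [] \<or> length s \<le> hd s + 2)}"

lemma Nil_in_tree [simp]: "[] \<in> tree"
  by (simp add: tree_def)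

lemma singleton_in_tree [simp]: "[n] \<in> tree"
  by (simp add: tree_def)

lemma sorted_tree: "s \<in> tree \<Longrightarrow> sorted s"
  by (simp add: tree_def)

lemma tree_prefix: "s @ t \<in> tree \<Longrightarrow> s \<in> tree"
  by (cases s) (auto simp: tree_def sorted_append)

lemma tree_snoc_iff:
  "s @ [m] \<in> tree \<longleftrightarrow> s \<in> tree \<and> (\<forall>k\<in>set s. k \<le> m) \<and> (s = [] \<or> length s < hd s + 2)"
  by (cases s) (auto simp: tree_def sorted_append)

text \<open>An entry \<open>k\<close> stands for the index \<open>k div 2\<close> together with the sign \<open>(-1) ^ k\<close>.\<close>

definition jump :: "(nat \<Rightarrow> real) \<Rightarrow> nat list \<Rightarrow> real" where
  "jump a s = (if s = [] then 0 else a (last s div 2))"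

text \<open>
  In the topology in which the nodes \<open>s @ m # t\<close> tend to \<open>s\<close> as \<open>m\<close> tends to infinity, uniformly
  in \<open>t\<close>, this is continuity for \<open>a = (\<lambda>_. 0)\<close>. In general the limits at \<open>s\<close> along even and along
  odd \<open>m\<close> differ from the value at \<open>s\<close> by the coordinate of \<open>a\<close> that belongs to the last entry of
  \<open>s\<close>, with opposite signs. Since \<open>m\<close> also stands for the index of the next jump, direction and
  index of successive jumps along a branch can be chosen independently.
\<close>

definition has_jumps :: "(nat list \<Rightarrow> real) \<Rightarrow> (nat \<Rightarrow> real) \<Rightarrow> bool" where
  "has_jumps \<phi> a \<longleftrightarrow> (\<forall>s\<in>tree. \<forall>e>0. \<exists>N. \<forall>m\<ge>N. \<forall>t. s @ m # t \<in> tree \<longrightarrow>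
     \<bar>\<phi> (s @ m # t) - \<phi> s - (-1) ^ m * jump a s\<bar> < e)"

lemma has_jumpsD:
  assumes "has_jumps \<phi> a" "s \<in> tree" "e > 0"
  shows "\<exists>N. \<forall>m\<ge>N. \<forall>t. s @ m # t \<in> tree \<longrightarrow> \<bar>\<phi> (s @ m # t) - \<phi> s - (-1) ^ m * jump a s\<bar> < e"
  using assms by (simp add: has_jumps_def)

lemma has_jumps_cong:
  assumes "\<And>s. s \<in> tree \<Longrightarrow> \<phi> s = \<psi> s" shows "has_jumps \<phi> a \<longleftrightarrow> has_jumps \<psi> a"
  unfolding has_jumps_def using assms by (metis (no_types, lifting))

lemma has_jumps_limit:
  assumes approx: "\<And>e. e > 0 \<Longrightarrow> \<exists>\<psi> b. has_jumps \<psi> b \<and>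
      (\<forall>s\<in>tree. \<bar>\<psi> s - \<phi> s\<bar> < e) \<and> (\<forall>k. \<bar>b k - a k\<bar> < e)"
  shows "has_jumps \<phi> a"
  unfolding has_jumps_def
proof (intro ballI allI impI)
  fix s and e :: real assume s: "s \<in> tree" and "e > 0"
  then have e4: "e / 4 > 0" by simp
  obtain \<psi> b where \<psi>: "has_jumps \<psi> b" "\<And>s. s \<in> tree \<Longrightarrow> \<bar>\<psi> s - \<phi> s\<bar> < e / 4" "\<And>k. \<bar>b k - a k\<bar> < e / 4"
    using approx[OF e4] by blast
  obtain N where N: "\<And>m t. m \<ge> N \<Longrightarrow> s @ m # t \<in> tree \<Longrightarrow>
      \<bar>\<psi> (s @ m # t) - \<psi> s - (-1) ^ m * jump b s\<bar> < e / 4"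
    using has_jumpsD[OF \<psi>(1) s e4] by blast
  have "\<bar>\<phi> (s @ m # t) - \<phi> s - (-1) ^ m * jump a s\<bar> < e" if "m \<ge> N" "s @ m # t \<in> tree" for m t
  proof -
    have "\<bar>(-1) ^ m * jump b s - (-1) ^ m * jump a s\<bar> = \<bar>jump b s - jump a s\<bar>"
      by (simp add: abs_mult flip: right_diff_distrib)
    also have "\<dots> < e / 4" using \<psi>(3)[of "last s div 2"] e4 by (auto simp: jump_def)
    finally show ?thesis using N[OF that] \<psi>(2)[OF s] \<psi>(2)[OF that(2)] by linarith
  qed
  then show "\<exists>N. \<forall>m\<ge>N. \<forall>t. s @ m # t \<in> tree \<longrightarrow> \<bar>\<phi> (s @ m # t) - \<phi> s - (-1) ^ m * jump a s\<bar> < e"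
    by blast
qed

lemma has_jumps_add:
  assumes \<phi>: "has_jumps \<phi> a" and \<psi>: "has_jumps \<psi> b"
  shows "has_jumps (\<lambda>s. \<phi> s + \<psi> s) (\<lambda>k. a k + b k)"
  unfolding has_jumps_def
proof (intro ballI allI impI)
  fix s and e :: real assume s: "s \<in> tree" and "e > 0"
  then have e2: "e / 2 > 0" by simp
  obtain N where N: "\<And>m t. m \<ge> N \<Longrightarrow> s @ m # t \<in> tree \<Longrightarrow>
      \<bar>\<phi> (s @ m # t) - \<phi> s - (-1) ^ m * jump a s\<bar> < e / 2"
    using has_jumpsD[OF \<phi> s e2] by blast
  obtain N' where N': "\<And>m t. m \<ge> N' \<Longrightarrow> s @ m # t \<in> tree \<Longrightarrow>
      \<bar>\<psi> (s @ m # t) - \<psi> s - (-1) ^ m * jump b s\<bar> < e / 2"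
    using has_jumpsD[OF \<psi> s e2] by blast
  have "\<bar>\<phi> (s @ m # t) + \<psi> (s @ m # t) - (\<phi> s + \<psi> s) - (-1) ^ m * jump (\<lambda>k. a k + b k) s\<bar> < e"
    if "m \<ge> max N N'" "s @ m # t \<in> tree" for m t
  proof -
    have "(-1) ^ m * jump (\<lambda>k. a k + b k) s = (-1) ^ m * jump a s + (-1) ^ m * jump b s"
      by (simp add: jump_def distrib_left)
    then show ?thesis using N[of m t] N'[of m t] that by linarith
  qed
  then show "\<exists>N. \<forall>m\<ge>N. \<forall>t. s @ m # t \<in> tree \<longrightarrow>
      \<bar>\<phi> (s @ m # t) + \<psi> (s @ m # t) - (\<phi> s + \<psi> s) - (-1) ^ m * jump (\<lambda>k. a k + b k) s\<bar> < e"
    by blast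
qed

lemma has_jumps_cmult:
  assumes \<phi>: "has_jumps \<phi> a" shows "has_jumps (\<lambda>s. c * \<phi> s) (\<lambda>k. c * a k)"
  unfolding has_jumps_def
proof (intro ballI allI impI)
  fix s and e :: real assume s: "s \<in> tree" and "e > 0"
  then have "e / (\<bar>c\<bar> + 1) > 0" by simp
  then obtain N where N: "\<And>m t. m \<ge> N \<Longrightarrow> s @ m # t \<in> tree \<Longrightarrow>
      \<bar>\<phi> (s @ m # t) - \<phi> s - (-1) ^ m * jump a s\<bar> < e / (\<bar>c\<bar> + 1)"
    using has_jumpsD[OF \<phi> s] by blast
  have "\<bar>c * \<phi> (s @ m # t) - c * \<phi> s - (-1) ^ m * jump (\<lambda>k. c * a k) s\<bar> < e"
    if "m \<ge> N" "s @ m # t \<in> tree" for m t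
  proof -
    let ?d = "\<phi> (s @ m # t) - \<phi> s - (-1) ^ m * jump a s"
    have "c * \<phi> (s @ m # t) - c * \<phi> s - (-1) ^ m * jump (\<lambda>k. c * a k) s = c * ?d"
      by (simp add: jump_def algebra_simps)
    then have "\<bar>c * \<phi> (s @ m # t) - c * \<phi> s - (-1) ^ m * jump (\<lambda>k. c * a k) s\<bar> = \<bar>c\<bar> * \<bar>?d\<bar>"
      by (simp add: abs_mult)
    also have "\<dots> \<le> (\<bar>c\<bar> + 1) * \<bar>?d\<bar>" by (intro mult_right_mono) auto
    also have "\<dots> < e" using N[OF that] by (simp add: pos_less_divide_eq mult.commute)
    finally show ?thesis .
  qed
  then show "\<exists>N. \<forall>m\<ge>N. \<forall>t. s @ m # t \<in> tree \<longrightarrow>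
      \<bar>c * \<phi> (s @ m # t) - c * \<phi> s - (-1) ^ m * jump (\<lambda>k. c * a k) s\<bar> < e"
    by blast
qed

lemma has_jumps_zero: "has_jumps (\<lambda>_. 0) (\<lambda>_. 0)"
  by (auto simp: has_jumps_def jump_def)

lemma has_jumps_diff:
  assumes "has_jumps \<phi> a" "has_jumps \<psi> b"
  shows "has_jumps (\<lambda>s. \<phi> s - \<psi> s) (\<lambda>k. a k - b k)"
  using has_jumps_add[OF assms(1) has_jumps_cmult[OF assms(2), of "-1"]] by simp

text \<open>The two limits at the node \<open>[2 * k]\<close> differ by twice the coordinate \<open>a k\<close>.\<close>

lemma jumps_le:
  assumes \<phi>: "has_jumps \<phi> a" and M: "\<And>s. s \<in> tree \<Longrightarrow> \<bar>\<phi> s\<bar> \<le> M"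
  shows "\<bar>a k\<bar> \<le> M"
proof (rule field_le_epsilon)
  fix e :: real assume "e > 0"
  obtain N where N: "\<And>m t. m \<ge> N \<Longrightarrow> [2 * k] @ m # t \<in> tree \<Longrightarrow>
      \<bar>\<phi> ([2 * k] @ m # t) - \<phi> [2 * k] - (-1) ^ m * jump a [2 * k]\<bar> < e"
    using has_jumpsD[OF \<phi>, of "[2 * k]" e] \<open>e > 0\<close> by auto
  have "[2 * k, m] \<in> tree" if "m \<ge> 2 * k" for m using that by (simp add: tree_def)
  then have "\<bar>\<phi> [2 * k, m] - \<phi> [2 * k] - (-1) ^ m * a k\<bar> < e" "\<bar>\<phi> [2 * k, m]\<bar> \<le> M"
    if "m \<ge> N" "m \<ge> 2 * k" for m
    using N[of m "[]"] M that by (auto simp: jump_def)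
  from this[of "2 * (N + k)"] this[of "2 * (N + k) + 1"]
  show "\<bar>a k\<bar> \<le> M + e" by auto
qed

lemma has_jumps_unique:
  assumes "has_jumps \<phi> a" "has_jumps \<phi> b" shows "a = b"
proof
  fix k
  have "\<bar>a k - b k\<bar> \<le> 0" by (rule jumps_le[OF has_jumps_diff[OF assms]]) simp
  then show "a k = b k" by simp
qed

text \<open>
  Adding up all jumps along a branch gives a function with jumps \<open>a\<close> that need not be bounded. A
  jump can be left out if this happens for finitely many next entries \<open>m\<close> only. The function
  \<open>lift a\<close> keeps the jump from \<open>k\<close> to \<open>m\<close> if all later coordinates of \<open>a\<close> are at most half as
  large: this holds for all large \<open>m\<close>, and the jumps kept along a branch form a series dominated
  by a geometric one.
\<close>

definition dominates :: "(nat \<Rightarrow> real) \<Rightarrow> nat \<Rightarrow> nat \<Rightarrow> bool" where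
  "dominates a k m \<longleftrightarrow> (\<forall>j\<ge>m div 2. \<bar>a j\<bar> \<le> \<bar>a (k div 2)\<bar> / 2)"

fun lift :: "(nat \<Rightarrow> real) \<Rightarrow> nat list \<Rightarrow> real" where
  "lift a [] = 0"
| "lift a [k] = 0"
| "lift a (k # m # t) = (if dominates a k m then (-1) ^ m * a (k div 2) else 0) + lift a (m # t)"

lemma lift_bound:
  assumes "sorted (k # t)" "\<And>j. j \<ge> k div 2 \<Longrightarrow> \<bar>a j\<bar> \<le> B"
  shows "\<bar>lift a (k # t)\<bar> \<le> 2 * B"
  using assms
proof (induction t arbitrary: k B)
  case Nil
  have "0 \<le> \<bar>a (k div 2)\<bar>" by simp
  also have "\<dots> \<le> B" by (rule Nil.prems) simp
  finally show ?case by simp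
next
  case (Cons m t)
  have km: "k div 2 \<le> m div 2" using Cons.prems(1) by (intro div_le_mono) auto
  show ?case
  proof (cases "dominates a k m")
    case True
    have "\<bar>lift a (m # t)\<bar> \<le> 2 * (\<bar>a (k div 2)\<bar> / 2)"
      using True Cons.prems(1) by (intro Cons.IH) (auto simp: dominates_def)
    moreover have "\<bar>(-1) ^ m * a (k div 2)\<bar> = \<bar>a (k div 2)\<bar>" by (simp add: abs_mult)
    moreover have "\<bar>a (k div 2)\<bar> \<le> B" by (rule Cons.prems) simp
    ultimately show ?thesis unfolding lift.simps using True by (simp only: if_True) linarith
  next
    case False
    have "\<bar>lift a (m # t)\<bar> \<le> 2 * B"
      using Cons.prems km by (intro Cons.IH) auto
    then show ?thesis using False by simp
  qed
qed

lemma lift_le: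
  assumes "sorted s" "\<And>j. \<bar>a j\<bar> \<le> B" shows "\<bar>lift a s\<bar> \<le> 2 * B"
proof (cases s)
  case Nil
  have "0 \<le> \<bar>a 0\<bar>" by simp
  also have "\<dots> \<le> B" by (rule assms)
  finally show ?thesis using Nil by simp
qed (use assms lift_bound in auto)

lemma lift_append:
  assumes "s \<noteq> []"
  shows "lift a (s @ m # t)
    = lift a s + (if dominates a (last s) m then (-1) ^ m * a (last s div 2) else 0) + lift a (m # t)"
  using assms
proof (induction s rule: list_nonempty_induct)
  case (cons k s)
  then show ?case by (cases s) auto
qed simp

text \<open>
  If the coordinate for the last entry of \<open>s\<close> is nonzero, the step to \<open>m\<close> is kept for all large
  \<open>m\<close>; if it is zero, both cases contribute nothing. The steps inside \<open>t\<close> contribute at most twice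
  the supremum of \<open>a\<close> from the index \<open>m div 2\<close> on.
\<close>

lemma has_jumps_lift:
  assumes a: "a \<longlonglongrightarrow> 0" shows "has_jumps (lift a) a"
  unfolding has_jumps_def
proof (intro ballI allI impI)
  have small: "\<exists>N. \<forall>m\<ge>N. \<forall>j\<ge>m div 2. \<bar>a j\<bar> \<le> d" if d: "d > 0" for d
  proof -
    obtain M where M: "\<And>j. j \<ge> M \<Longrightarrow> \<bar>a j\<bar> < d" using LIMSEQ_D[OF a d] by auto
    have "\<bar>a j\<bar> \<le> d" if "m \<ge> 2 * M" "j \<ge> m div 2" for m j
      using M[of j] that by linarith
    then show ?thesis by blast
  qed
  fix s and e :: real assume "e > 0"
  then obtain N where N: "\<And>m j. m \<ge> N \<Longrightarrow> j \<ge> m div 2 \<Longrightarrow> \<bar>a j\<bar> \<le> e / 4"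
    using small[of "e / 4"] by auto
  have rest: "\<bar>lift a (m # t)\<bar> < e" if "m \<ge> N" "s @ m # t \<in> tree" for m t
  proof -
    have "sorted (m # t)" using sorted_tree[OF that(2)] by (simp add: sorted_append)
    then have "\<bar>lift a (m # t)\<bar> \<le> 2 * (e / 4)" using N that by (intro lift_bound)
    then show ?thesis using \<open>e > 0\<close> by linarith
  qed
  obtain N' where N': "\<And>m. m \<ge> N' \<Longrightarrow> s \<noteq> [] \<Longrightarrow> a (last s div 2) \<noteq> 0 \<Longrightarrow> dominates a (last s) m"
    using small[of "\<bar>a (last s div 2)\<bar> / 2"] unfolding dominates_def
    by (cases "a (last s div 2) = 0") auto
  have "\<bar>lift a (s @ m # t) - lift a s - (-1) ^ m * jump a s\<bar> < e"
    if "m \<ge> max N N'" "s @ m # t \<in> tree" for m t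
  proof (cases "s = []")
    case True then show ?thesis using rest[of m t] that by (simp add: jump_def)
  next
    case False
    have "lift a (s @ m # t) - lift a s - (-1) ^ m * jump a s = lift a (m # t)"
      using lift_append[OF False, of a m t] N'[of m] False that(1)
      by (cases "a (last s div 2) = 0") (auto simp: jump_def)
    then show ?thesis using rest[of m t] that by simp
  qed
  then show "\<exists>N. \<forall>m\<ge>N. \<forall>t. s @ m # t \<in> tree \<longrightarrow> \<bar>lift a (s @ m # t) - lift a s - (-1) ^ m * jump a s\<bar> < e"
    by blast
qed

section \<open>The Banach space of functions with jumps\<close>

definition linf :: "(nat \<Rightarrow> real) nvs" where
  "linf = \<lparr>carrier = {x. \<exists>M. \<forall>n. \<bar>x n\<bar> \<le> M}, monoid.mult = (\<lambda>x y. x), one = (\<lambda>_. 0),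
     zero = (\<lambda>_. 0), add = (\<lambda>x y n. x n + y n), smult = (\<lambda>c x n. c * x n),
     nrm = (\<lambda>x. SUP n. \<bar>x n\<bar>)\<rparr>"

lemma linf_simps [simp]:
  "\<zero>\<^bsub>linf\<^esub> = (\<lambda>_. 0)" "x \<oplus>\<^bsub>linf\<^esub> y = (\<lambda>n. x n + y n)" "c \<odot>\<^bsub>linf\<^esub> x = (\<lambda>n. c * x n)"
  by (simp_all add: linf_def)

lemma linfI: "(\<And>n. \<bar>x n\<bar> \<le> M) \<Longrightarrow> x \<in> carrier linf"
  by (auto simp: linf_def)

lemma linf_abs_le_nrm: "x \<in> carrier linf \<Longrightarrow> \<bar>x n\<bar> \<le> nrm linf x"
  by (auto simp: linf_def intro!: cSUP_upper bdd_aboveI2)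

lemma linf_nrm_le: "(\<And>n. \<bar>x n\<bar> \<le> M) \<Longrightarrow> nrm linf x \<le> M"
  by (auto simp: linf_def intro!: cSUP_least)

lemma linf_add_closed: "x \<in> carrier linf \<Longrightarrow> y \<in> carrier linf \<Longrightarrow> (\<lambda>n. x n + y n) \<in> carrier linf"
  by (rule linfI[of _ "nrm linf x + nrm linf y"])
     (meson abs_triangle_ineq add_mono linf_abs_le_nrm order_trans)

lemma linf_smult_closed: "x \<in> carrier linf \<Longrightarrow> (\<lambda>n. c * x n) \<in> carrier linf"
  by (rule linfI[of _ "\<bar>c\<bar> * nrm linf x"]) (simp add: abs_mult linf_abs_le_nrm mult_left_mono)

lemma normed_space_linf: "normed_space linf"
proof -
  have "abelian_group linf"
  proof (rule abelian_groupI)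
    fix x assume x: "x \<in> carrier linf"
    show "\<exists>y\<in>carrier linf. y \<oplus>\<^bsub>linf\<^esub> x = \<zero>\<^bsub>linf\<^esub>"
      using linf_smult_closed[OF x, of "-1"] by (intro bexI[of _ "\<lambda>n. -1 * x n"]) auto
  qed (auto simp: linf_add_closed algebra_simps intro: linfI[of _ 0])
  then have m: "module real_ring linf"
    by (intro moduleI cring_real_ring) (auto simp: linf_smult_closed algebra_simps)
  have "normed_space_axioms linf"
  proof
    fix x assume x: "x \<in> carrier linf"
    show "nrm linf x = 0 \<longleftrightarrow> x = \<zero>\<^bsub>linf\<^esub>"
    proof
      assume "nrm linf x = 0"
      then show "x = \<zero>\<^bsub>linf\<^esub>" using linf_abs_le_nrm[OF x] by auto
    qed (simp add: linf_def)
    have le: "nrm linf (\<lambda>n. c * y n) \<le> \<bar>c\<bar> * nrm linf y" if "y \<in> carrier linf" for c y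
      using that by (intro linf_nrm_le) (simp add: abs_mult linf_abs_le_nrm mult_left_mono)
    show "nrm linf (a \<odot>\<^bsub>linf\<^esub> x) = \<bar>a\<bar> * nrm linf x" for a
    proof (cases "a = 0")
      case False
      have "nrm linf x \<le> \<bar>1 / a\<bar> * nrm linf (\<lambda>n. a * x n)"
        using le[OF linf_smult_closed[OF x, of a], of "1 / a"] False by simp
      then have "\<bar>a\<bar> * nrm linf x \<le> nrm linf (\<lambda>n. a * x n)" using False by (simp add: field_simps)
      then show ?thesis using le[OF x, of a] by simp
    qed (simp add: linf_def)
    fix y assume y: "y \<in> carrier linf"
    show "nrm linf (x \<oplus>\<^bsub>linf\<^esub> y) \<le> nrm linf x + nrm linf y"
      using x y by (auto intro!: linf_nrm_le) (meson abs_triangle_ineq add_mono linf_abs_le_nrm order_trans)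
  qed
  then show ?thesis using m by (simp add: normed_space_def)
qed

interpretation linf: normed_space linf by (rule normed_space_linf)

lemma linf_diff [simp]:
  assumes "y \<in> carrier linf" shows "x \<ominus>\<^bsub>linf\<^esub> y = (\<lambda>n. x n - y n)"
  using assms by (simp add: a_minus_def linf.a_inv_eq_smult)

lemma banach_space_linf: "banach_space linf"
proof -
  interpret M: Metric_space "carrier linf" "nrm_dist linf" by (rule linf.Metric_space_nrm_dist)
  have "M.mcomplete"
    unfolding M.mcomplete_def
  proof (intro allI impI)
    fix \<sigma> assume C: "M.MCauchy \<sigma>"
    then have \<sigma>: "\<sigma> n \<in> carrier linf" for n unfolding M.MCauchy_def by blast
    have dist: "nrm_dist linf x y = nrm linf (\<lambda>n. x n - y n)" "\<bar>x n - y n\<bar> \<le> nrm_dist linf x y"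
      if "x \<in> carrier linf" "y \<in> carrier linf" for x y n
      using that linf_abs_le_nrm[OF linf.M.minus_closed[OF that]] by (simp_all add: nrm_dist_def)
    have cauchy: "\<exists>N. \<forall>n\<ge>N. \<forall>n'\<ge>N. \<forall>k. \<bar>\<sigma> n k - \<sigma> n' k\<bar> < e" if "e > 0" for e
      using C dist(2)[OF \<sigma> \<sigma>] that unfolding M.MCauchy_def by (meson le_less_trans)
    have "Cauchy (\<lambda>n. \<sigma> n k)" for k
      using cauchy unfolding Cauchy_def dist_real_def by blast
    then have "convergent (\<lambda>n. \<sigma> n k)" for k by (rule Cauchy_convergent)
    then obtain l where l: "\<And>k. (\<lambda>n. \<sigma> n k) \<longlonglongrightarrow> l k" unfolding convergent_def by metis
    have close: "\<exists>N. \<forall>n\<ge>N. \<forall>k. \<bar>\<sigma> n k - l k\<bar> \<le> e" if pos: "e > 0" for e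
    proof -
      obtain N where N: "\<And>n n' k. n \<ge> N \<Longrightarrow> n' \<ge> N \<Longrightarrow> \<bar>\<sigma> n k - \<sigma> n' k\<bar> < e"
        using cauchy[OF pos] by blast
      have "\<bar>\<sigma> n k - l k\<bar> \<le> e" if "n \<ge> N" for n k
      proof (rule LIMSEQ_le_const2)
        show "(\<lambda>n'. \<bar>\<sigma> n k - \<sigma> n' k\<bar>) \<longlonglongrightarrow> \<bar>\<sigma> n k - l k\<bar>" by (intro tendsto_intros l)
        show "\<exists>N. \<forall>n'\<ge>N. \<bar>\<sigma> n k - \<sigma> n' k\<bar> \<le> e" using N[OF that] less_imp_le by blast
      qed
      then show ?thesis by blast
    qed
    have lC: "l \<in> carrier linf"
    proof -
      obtain N where N: "\<And>k. \<bar>\<sigma> N k - l k\<bar> \<le> 1" using close[of 1] by auto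
      have "\<bar>l k\<bar> \<le> nrm linf (\<sigma> N) + 1" for k
        using N[of k] linf_abs_le_nrm[OF \<sigma>, of N k] by linarith
      then show ?thesis by (rule linfI)
    qed
    have "limitin M.mtopology \<sigma> l sequentially"
      unfolding M.limitin_metric
    proof (intro conjI allI impI lC)
      fix e :: real assume "e > 0"
      then obtain N where N: "\<And>n k. n \<ge> N \<Longrightarrow> \<bar>\<sigma> n k - l k\<bar> \<le> e / 2" using close[of "e / 2"] by auto
      have "nrm_dist linf (\<sigma> n) l < e" if "n \<ge> N" for n
      proof -
        have "nrm_dist linf (\<sigma> n) l \<le> e / 2"
          unfolding dist(1)[OF \<sigma> lC] by (intro linf_nrm_le N that)
        then show ?thesis using \<open>e > 0\<close> by linarith
      qed
      then show "eventually (\<lambda>n. \<sigma> n \<in> carrier linf \<and> nrm_dist linf (\<sigma> n) l < e) sequentially"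
        using \<sigma> by (auto simp: eventually_sequentially)
    qed
    then show "\<exists>l. limitin M.mtopology \<sigma> l sequentially" by blast
  qed
  then show ?thesis using normed_space_linf by (simp add: banach_space_def)
qed

lemma (in normed_space) closed_subspaceI:
  assumes sub: "H \<subseteq> carrier V" and zero: "\<zero> \<in> H"
    and add: "\<And>x y. x \<in> H \<Longrightarrow> y \<in> H \<Longrightarrow> x \<oplus> y \<in> H" and smult: "\<And>c x. x \<in> H \<Longrightarrow> c \<odot> x \<in> H"
    and closed: "\<And>x. x \<in> carrier V \<Longrightarrow> (\<And>e. e > 0 \<Longrightarrow> \<exists>h\<in>H. nrm V (h \<ominus> x) < e) \<Longrightarrow> x \<in> H"
  shows "closed_subspace V H"
  unfolding closed_subspace_def
proof
  interpret VM: Metric_space "carrier V" "nrm_dist V" by (rule Metric_space_nrm_dist)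
  show "submodule H real_ring V"
  proof (rule submoduleI[OF sub zero _ add])
    fix x assume "x \<in> H"
    then show "\<ominus> x \<in> H" using smult[of x "-1"] sub by (auto simp: a_inv_eq_smult)
  qed (use smult in auto)
  show "closedin VM.mtopology H"
    unfolding VM.closedin_metric
  proof (intro conjI sub allI impI)
    fix x assume x: "x \<in> carrier V - H"
    then obtain e where e: "e > 0" "\<And>h. h \<in> H \<Longrightarrow> \<not> nrm V (h \<ominus> x) < e" using closed by blast
    have "nrm V (x \<ominus> h) = nrm V (h \<ominus> x)" if "h \<in> H" for h
      using that x sub by (intro nrm_diff_commute) auto
    then have "disjnt H (VM.mball x e)" using e(2) by (auto simp: disjnt_iff nrm_dist_def)
    then show "\<exists>r>0. disjnt H (VM.mball x r)" using e(1) by blast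
  qed
qed

text \<open>
  Functions on lists are coded as sequences, by the bijection between lists and natural numbers.
\<close>

definition at_node :: "(nat \<Rightarrow> real) \<Rightarrow> nat list \<Rightarrow> real" where
  "at_node x s = x (list_encode s)"

definition of_nodes :: "(nat list \<Rightarrow> real) \<Rightarrow> nat \<Rightarrow> real" where
  "of_nodes \<phi> n = (if list_decode n \<in> tree then \<phi> (list_decode n) else 0)"

lemma at_node_of_nodes [simp]: "at_node (of_nodes \<phi>) s = (if s \<in> tree then \<phi> s else 0)"
  by (simp add: at_node_def of_nodes_def)

lemma at_node_list_decode: "x n = at_node x (list_decode n)"
  by (simp add: at_node_def)

definition tree_space :: "(nat \<Rightarrow> real) nvs" where
  "tree_space = subspace_of linf {x \<in> carrier linf. (\<forall>s. s \<notin> tree \<longrightarrow> at_node x s = 0) \<and>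
     (\<exists>a. a \<longlonglongrightarrow> 0 \<and> has_jumps (at_node x) a)}"

definition jumps :: "(nat \<Rightarrow> real) \<Rightarrow> nat \<Rightarrow> real" where
  "jumps x = (THE a. has_jumps (at_node x) a)"

definition no_jumps :: "(nat \<Rightarrow> real) set" where
  "no_jumps = {x \<in> carrier tree_space. has_jumps (at_node x) (\<lambda>_. 0)}"

lemma carrier_tree_space:
  "x \<in> carrier tree_space \<longleftrightarrow> x \<in> carrier linf \<and> (\<forall>s. s \<notin> tree \<longrightarrow> at_node x s = 0) \<and>
     (\<exists>a. a \<longlonglongrightarrow> 0 \<and> has_jumps (at_node x) a)"
  by (simp add: tree_space_def)

lemma tree_space_simps [simp]:
  "\<zero>\<^bsub>tree_space\<^esub> = (\<lambda>_. 0)" "x \<oplus>\<^bsub>tree_space\<^esub> y = (\<lambda>n. x n + y n)" "c \<odot>\<^bsub>tree_space\<^esub> x = (\<lambda>n. c * x n)"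
  by (simp_all add: tree_space_def)

lemma jumps_eq: "has_jumps (at_node x) a \<Longrightarrow> jumps x = a"
  unfolding jumps_def using has_jumps_unique by blast

lemma tree_space_jumps:
  assumes "x \<in> carrier tree_space"
  shows "has_jumps (at_node x) (jumps x)" "jumps x \<longlonglongrightarrow> 0"
  using assms jumps_eq unfolding carrier_tree_space by blast+

lemma at_node_le_nrm: "x \<in> carrier tree_space \<Longrightarrow> \<bar>at_node x s\<bar> \<le> nrm tree_space x"
  unfolding at_node_def by (simp add: carrier_tree_space linf_abs_le_nrm) (simp add: tree_space_def linf_abs_le_nrm)

lemma jumps_le_nrm: "x \<in> carrier tree_space \<Longrightarrow> \<bar>jumps x k\<bar> \<le> nrm tree_space x"
  using jumps_le[OF tree_space_jumps(1)] at_node_le_nrm by blast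

lemma tree_space_nrm_le:
  assumes "x \<in> carrier tree_space" "\<And>s. s \<in> tree \<Longrightarrow> \<bar>at_node x s\<bar> \<le> M"
  shows "nrm tree_space x \<le> M"
proof -
  have "0 \<le> \<bar>at_node x []\<bar>" by simp
  also have "\<dots> \<le> M" by (intro assms) simp
  finally have "\<bar>x n\<bar> \<le> M" for n
    using assms unfolding at_node_list_decode[of x n] carrier_tree_space by (cases "list_decode n \<in> tree") auto
  then show ?thesis by (simp add: tree_space_def linf_nrm_le)
qed

lemma at_node_add [simp]: "at_node (\<lambda>n. x n + y n) s = at_node x s + at_node y s"
  and at_node_diff [simp]: "at_node (\<lambda>n. x n - y n) s = at_node x s - at_node y s"
  and at_node_cmult [simp]: "at_node (\<lambda>n. c * x n) s = c * at_node x s"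
  and at_node_zero [simp]: "at_node (\<lambda>_. 0) s = 0"
  by (simp_all add: at_node_def)

lemma at_node_fun:
  "at_node (\<lambda>n. x n + y n) = (\<lambda>s. at_node x s + at_node y s)"
  "at_node (\<lambda>n. c * x n) = (\<lambda>s. c * at_node x s)"
  "at_node (\<lambda>n. x n - y n) = (\<lambda>s. at_node x s - at_node y s)"
  "at_node (\<lambda>_. 0) = (\<lambda>_. 0)"
  by (simp_all add: fun_eq_iff)

text \<open>Jumps are bounded by the norm, so the jumps of a Cauchy sequence converge uniformly.\<close>

lemma closed_subspace_tree_space: "closed_subspace linf (carrier tree_space)"
proof (rule linf.closed_subspaceI)
  show "carrier tree_space \<subseteq> carrier linf" by (auto simp: carrier_tree_space)
  show "\<zero>\<^bsub>linf\<^esub> \<in> carrier tree_space"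
    unfolding carrier_tree_space using has_jumps_zero
    by (auto simp: at_node_fun intro: linfI[of _ 0] exI[of _ "\<lambda>_. 0"])
next
  fix x y assume x: "x \<in> carrier tree_space" and y: "y \<in> carrier tree_space"
  have "has_jumps (at_node (\<lambda>n. x n + y n)) (\<lambda>k. jumps x k + jumps y k)"
    unfolding at_node_fun by (intro has_jumps_add tree_space_jumps x y)
  moreover have "(\<lambda>k. jumps x k + jumps y k) \<longlonglongrightarrow> 0"
    using tendsto_add[OF tree_space_jumps(2)[OF x] tree_space_jumps(2)[OF y]] by simp
  ultimately show "x \<oplus>\<^bsub>linf\<^esub> y \<in> carrier tree_space"
    using x y unfolding carrier_tree_space by (auto simp: linf_add_closed)
next
  fix c x assume x: "x \<in> carrier tree_space"
  have "has_jumps (at_node (\<lambda>n. c * x n)) (\<lambda>k. c * jumps x k)"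
    unfolding at_node_fun by (intro has_jumps_cmult tree_space_jumps x)
  moreover have "(\<lambda>k. c * jumps x k) \<longlonglongrightarrow> 0"
    using tendsto_mult_left[OF tree_space_jumps(2)[OF x], of c] by simp
  ultimately show "c \<odot>\<^bsub>linf\<^esub> x \<in> carrier tree_space"
    using x unfolding carrier_tree_space by (auto simp: linf_smult_closed)
next
  fix x assume x: "x \<in> carrier linf"
    and approx: "\<And>e. e > 0 \<Longrightarrow> \<exists>h\<in>carrier tree_space. nrm linf (h \<ominus>\<^bsub>linf\<^esub> x) < e"
  have "\<exists>h\<in>carrier tree_space. nrm linf (h \<ominus>\<^bsub>linf\<^esub> x) < 1 / Suc i" for i by (rule approx) simp
  then obtain h where h: "\<And>i. h i \<in> carrier tree_space"
    and near: "\<And>i. nrm linf (h i \<ominus>\<^bsub>linf\<^esub> x) < 1 / Suc i" by metis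
  have hl: "h i \<in> carrier linf" for i using h by (simp add: carrier_tree_space)
  have hx: "\<bar>at_node (h i) s - at_node x s\<bar> < 1 / Suc i" for i s
    using linf_abs_le_nrm[OF linf.M.minus_closed[OF hl x], of i "list_encode s"] near[of i] x
    by (simp add: at_node_def)
  have jj: "\<bar>jumps (h i) k - jumps (h j) k\<bar> \<le> 1 / Suc i + 1 / Suc j" for i j k
  proof (rule jumps_le[OF has_jumps_diff[OF tree_space_jumps(1)[OF h] tree_space_jumps(1)[OF h]]])
    fix s
    show "\<bar>at_node (h i) s - at_node (h j) s\<bar> \<le> 1 / Suc i + 1 / Suc j"
      using hx[of i s] hx[of j s] by linarith
  qed
  have inv: "(\<lambda>i. 1 / real (Suc i)) \<longlonglongrightarrow> 0" by (rule LIMSEQ_Suc[OF lim_1_over_n])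
  have "Cauchy (\<lambda>i. jumps (h i) k)" for k
    unfolding Cauchy_def dist_real_def
  proof (intro allI impI)
    fix e :: real assume "e > 0"
    then obtain N where N: "\<And>i. i \<ge> N \<Longrightarrow> 1 / real (Suc i) < e / 2"
      using LIMSEQ_D[OF inv, of "e / 2"] by auto
    have "\<bar>jumps (h i) k - jumps (h j) k\<bar> < e" if "i \<ge> N" "j \<ge> N" for i j
      using jj[of i k j] N[OF that(1)] N[OF that(2)] by linarith
    then show "\<exists>M. \<forall>m\<ge>M. \<forall>n\<ge>M. \<bar>jumps (h m) k - jumps (h n) k\<bar> < e" by blast
  qed
  then have "convergent (\<lambda>i. jumps (h i) k)" for k by (rule Cauchy_convergent)
  then obtain a where a: "\<And>k. (\<lambda>i. jumps (h i) k) \<longlonglongrightarrow> a k" unfolding convergent_def by metis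
  have ja: "\<bar>jumps (h i) k - a k\<bar> \<le> 1 / Suc i" for i k
  proof (rule LIMSEQ_le)
    show "(\<lambda>j. \<bar>jumps (h i) k - jumps (h j) k\<bar>) \<longlonglongrightarrow> \<bar>jumps (h i) k - a k\<bar>" by (intro tendsto_intros a)
    show "(\<lambda>j. 1 / Suc i + 1 / Suc j) \<longlonglongrightarrow> 1 / Suc i"
      using tendsto_add[OF tendsto_const inv, of "1 / real (Suc i)"] by simp
  qed (use jj in blast)
  have small: "\<exists>i. 1 / real (Suc i) < e" if "e > 0" for e
    using nat_approx_posE[OF that] by metis
  have "a \<longlonglongrightarrow> 0"
  proof (rule LIMSEQ_I)
    fix e :: real assume "e > 0"
    then obtain i where i: "1 / real (Suc i) < e / 2" using small[of "e / 2"] by auto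
    obtain N where N: "\<And>k. k \<ge> N \<Longrightarrow> \<bar>jumps (h i) k\<bar> < e / 2"
      using LIMSEQ_D[OF tree_space_jumps(2)[OF h], of "e / 2" i] \<open>e > 0\<close> by auto
    have "\<bar>a k\<bar> < e" if "k \<ge> N" for k using N[OF that] ja[of i k] i by linarith
    then show "\<exists>N. \<forall>k\<ge>N. norm (a k - 0) < e" by auto
  qed
  moreover have "has_jumps (at_node x) a"
  proof (rule has_jumps_limit)
    fix e :: real assume "e > 0"
    then obtain i where i: "1 / real (Suc i) < e" using small by blast
    have "\<bar>at_node (h i) s - at_node x s\<bar> < e" "\<bar>jumps (h i) k - a k\<bar> < e" for s k
      using hx[of i s] ja[of i k] i by linarith+
    then show "\<exists>\<psi> b. has_jumps \<psi> b \<and> (\<forall>s\<in>tree. \<bar>\<psi> s - at_node x s\<bar> < e) \<and> (\<forall>k. \<bar>b k - a k\<bar> < e)"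
      using tree_space_jumps(1)[OF h] by blast
  qed
  moreover have "at_node x s = 0" if "s \<notin> tree" for s
  proof -
    have "\<bar>at_node x s\<bar> \<le> e" if "e > 0" for e
    proof -
      obtain i where "1 / real (Suc i) < e" using small \<open>e > 0\<close> by blast
      then show ?thesis using hx[of i s] h[of i] \<open>s \<notin> tree\<close> by (simp add: carrier_tree_space)
    qed
    then show ?thesis using field_le_epsilon[of "\<bar>at_node x s\<bar>" 0] by simp
  qed
  ultimately show "x \<in> carrier tree_space" using x unfolding carrier_tree_space by blast
qed

lemma banach_space_tree_space: "banach_space tree_space"
  using banach_space_subspace_of[OF banach_space_linf closed_subspace_tree_space]
  by (simp add: tree_space_def)

interpretation TS: normed_space tree_space
  using banach_space_tree_space by (simp add: banach_space_def)

lemma tree_space_diff [simp]: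
  assumes "y \<in> carrier tree_space" shows "x \<ominus>\<^bsub>tree_space\<^esub> y = (\<lambda>n. x n - y n)"
  using assms by (simp add: a_minus_def TS.a_inv_eq_smult)

lemma jumps_add:
  assumes "x \<in> carrier tree_space" "y \<in> carrier tree_space"
  shows "jumps (\<lambda>n. x n + y n) = (\<lambda>k. jumps x k + jumps y k)"
  using assms by (intro jumps_eq) (simp add: at_node_fun has_jumps_add tree_space_jumps)

lemma jumps_diff:
  assumes "x \<in> carrier tree_space" "y \<in> carrier tree_space"
  shows "jumps (\<lambda>n. x n - y n) = (\<lambda>k. jumps x k - jumps y k)"
  using assms by (intro jumps_eq) (simp add: at_node_fun has_jumps_diff tree_space_jumps)

lemma jumps_cmult:
  assumes "x \<in> carrier tree_space"
  shows "jumps (\<lambda>n. c * x n) = (\<lambda>k. c * jumps x k)"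
  using assms by (intro jumps_eq) (simp add: at_node_fun has_jumps_cmult tree_space_jumps)

lemma no_jumps_iff: "x \<in> no_jumps \<longleftrightarrow> x \<in> carrier tree_space \<and> jumps x = (\<lambda>_. 0)"
  unfolding no_jumps_def using tree_space_jumps(1) jumps_eq by force

lemma closed_subspace_no_jumps: "closed_subspace tree_space no_jumps"
proof (rule TS.closed_subspaceI)
  show "\<zero>\<^bsub>tree_space\<^esub> \<in> no_jumps"
    using TS.M.zero_closed has_jumps_zero by (simp add: no_jumps_def at_node_fun)
  fix x y assume "x \<in> no_jumps" "y \<in> no_jumps"
  then show "x \<oplus>\<^bsub>tree_space\<^esub> y \<in> no_jumps"
    using TS.M.a_closed[of x y] by (simp add: no_jumps_iff jumps_add)
next
  fix c x assume "x \<in> no_jumps"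
  then show "c \<odot>\<^bsub>tree_space\<^esub> x \<in> no_jumps"
    using TS.smult_closed[of c x] by (simp add: no_jumps_iff jumps_cmult)
next
  fix x assume x: "x \<in> carrier tree_space"
    and approx: "\<And>e. e > 0 \<Longrightarrow> \<exists>h\<in>no_jumps. nrm tree_space (h \<ominus>\<^bsub>tree_space\<^esub> x) < e"
  have "jumps x k = 0" for k
  proof -
    have "\<bar>jumps x k\<bar> \<le> e" if "e > 0" for e
    proof -
      obtain h where h: "h \<in> no_jumps" "nrm tree_space (h \<ominus>\<^bsub>tree_space\<^esub> x) < e" using approx \<open>e > 0\<close> by blast
      then have hT: "h \<in> carrier tree_space" "jumps h k = 0" by (simp_all add: no_jumps_iff)
      then have "\<bar>jumps (h \<ominus>\<^bsub>tree_space\<^esub> x) k\<bar> < e"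
        using h(2) jumps_le_nrm[OF TS.M.minus_closed[OF hT(1) x], of k] by linarith
      then show ?thesis using x hT by (simp add: jumps_diff)
    qed
    then show ?thesis using field_le_epsilon[of "\<bar>jumps x k\<bar>" 0] by simp
  qed
  then show "x \<in> no_jumps" using x by (simp add: no_jumps_iff fun_eq_iff)
qed (auto simp: no_jumps_def)

lemma of_nodes_in_tree_space:
  assumes bd: "\<And>s. s \<in> tree \<Longrightarrow> \<bar>\<phi> s\<bar> \<le> M" and \<phi>: "has_jumps \<phi> a" and a: "a \<longlonglongrightarrow> 0"
  shows "of_nodes \<phi> \<in> carrier tree_space" "jumps (of_nodes \<phi>) = a" "nrm tree_space (of_nodes \<phi>) \<le> M"
proof -
  have j: "has_jumps (at_node (of_nodes \<phi>)) a" using \<phi> has_jumps_cong[of "at_node (of_nodes \<phi>)" \<phi> a] by simp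
  have "0 \<le> \<bar>\<phi> []\<bar>" by simp
  also have "\<dots> \<le> M" by (intro bd) simp
  finally have "of_nodes \<phi> \<in> carrier linf" using bd by (intro linfI[of _ M]) (auto simp: of_nodes_def)
  then show 1: "of_nodes \<phi> \<in> carrier tree_space" unfolding carrier_tree_space using j a by auto
  show "jumps (of_nodes \<phi>) = a" using j by (rule jumps_eq)
  show "nrm tree_space (of_nodes \<phi>) \<le> M" using bd by (intro tree_space_nrm_le[OF 1]) simp
qed

section \<open>The functions without jumps have property (V)\<close>

abbreviation NJ :: "(nat \<Rightarrow> real) nvs" where "NJ \<equiv> subspace_of tree_space no_jumps"

lemma submodule_no_jumps: "submodule no_jumps real_ring tree_space"
  using closed_subspace_no_jumps by (simp add: closed_subspace_def)

interpretation NJ: normed_space NJ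
  by (rule normed_space_subspace_of[OF TS.normed_space_axioms submodule_no_jumps])

lemma NJ_diff [simp]:
  assumes "x \<in> no_jumps" "y \<in> no_jumps" shows "x \<ominus>\<^bsub>NJ\<^esub> y = (\<lambda>n. x n - y n)"
  using assms diff_subspace_of[OF TS.normed_space_axioms submodule_no_jumps assms]
  by (simp add: no_jumps_def)

lemma finsum_NJ:
  assumes "\<And>n :: nat. y n \<in> no_jumps"
  shows "finsum NJ y {..<N} = (\<lambda>k. \<Sum>n<N. y n k)"
proof (induction N)
  case (Suc N)
  then show ?case using assms by (subst NJ.finsum_lessThan_Suc) (auto simp: fun_eq_iff)
qed simp

lemma of_nodes_in_no_jumps:
  assumes "\<And>s. s \<in> tree \<Longrightarrow> \<bar>\<phi> s\<bar> \<le> M" "has_jumps \<phi> (\<lambda>_. 0)"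
  shows "of_nodes \<phi> \<in> no_jumps"
  using of_nodes_in_tree_space[OF assms tendsto_const] by (simp add: no_jumps_iff)

text \<open>
  The nodes above \<open>v\<close> form a clopen set: if \<open>s\<close> is not above \<open>v\<close>, then \<open>s @ m # t\<close> is above \<open>v\<close>
  for at most one \<open>m\<close>, an entry of \<open>v\<close>.
\<close>

lemma has_jumps_restrict_above:
  assumes \<phi>: "has_jumps \<phi> (\<lambda>_. 0)"
  shows "has_jumps (\<lambda>u. if prefix v u then \<phi> u else 0) (\<lambda>_. 0)"
  unfolding has_jumps_def
proof (intro ballI allI impI)
  fix s and e :: real assume s: "s \<in> tree" and "e > 0"
  obtain N where N: "\<And>m t. m \<ge> N \<Longrightarrow> s @ m # t \<in> tree \<Longrightarrow> \<bar>\<phi> (s @ m # t) - \<phi> s\<bar> < e"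
    using has_jumpsD[OF \<phi> s \<open>e > 0\<close>] by (auto simp: jump_def)
  \<comment> \<open>This bound exceeds every entry of \<open>v\<close>.\<close>
  have "\<bar>(if prefix v (s @ m # t) then \<phi> (s @ m # t) else 0) - (if prefix v s then \<phi> s else 0)\<bar> < e"
    if m: "m \<ge> max N (Suc (sum_list v))" and t: "s @ m # t \<in> tree" for m t
  proof (cases "prefix v s")
    case True
    then have "prefix v (s @ m # t)" by (rule prefix_prefix)
    then show ?thesis using N[of m t] m t True by simp
  next
    case False
    have "\<not> prefix v (s @ m # t)"
    proof
      assume "prefix v (s @ m # t)"
      then have "prefix (s @ [m]) v"
        using False by (auto simp: prefix_append prefix_Cons)
      then have "m \<in> set v" by (auto simp: prefix_def)
      then show False using member_le_sum_list[of m v] m by simp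
    qed
    then show ?thesis using False \<open>e > 0\<close> by simp
  qed
  then show "\<exists>N. \<forall>m\<ge>N. \<forall>t. s @ m # t \<in> tree \<longrightarrow>
      \<bar>(if prefix v (s @ m # t) then \<phi> (s @ m # t) else 0) - (if prefix v s then \<phi> s else 0)
        - (-1) ^ m * jump (\<lambda>_. 0) s\<bar> < e"
    by (intro exI[of _ "max N (Suc (sum_list v))"]) (auto simp: jump_def)
qed

lemma has_jumps_const: "has_jumps (\<lambda>_. c) (\<lambda>_. 0)"
  by (auto simp: has_jumps_def jump_def)

definition ball_above :: "nat list \<Rightarrow> (nat \<Rightarrow> real) set" where
  "ball_above s = {x \<in> no_jumps. nrm tree_space x \<le> 1 \<and> (\<forall>u. \<not> prefix s u \<longrightarrow> at_node x u = 0)}"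

text \<open>
  A function that lives above \<open>s\<close> is the sum of a constant function above \<open>s\<close> and of functions
  that live above the children of \<open>s\<close>.
\<close>

fun component :: "nat list \<Rightarrow> nat \<Rightarrow> (nat \<Rightarrow> real) \<Rightarrow> nat \<Rightarrow> real" where
  "component s 0 x = of_nodes (\<lambda>u. if prefix s u then at_node x s else 0)"
| "component s (Suc n) x = of_nodes (\<lambda>u. if prefix (s @ [n]) u then at_node x u - at_node x s else 0)"

lemma ball_above_le: "x \<in> ball_above s \<Longrightarrow> \<bar>at_node x u\<bar> \<le> 1"
  using at_node_le_nrm[of x u] by (simp add: ball_above_def no_jumps_def)

lemma component_in_no_jumps:
  assumes x: "x \<in> ball_above s" shows "component s n x \<in> no_jumps"
proof (cases n)
  case 0
  show ?thesis unfolding 0 component.simps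
    by (rule of_nodes_in_no_jumps[of _ 1, OF _ has_jumps_restrict_above[OF has_jumps_const]])
       (simp add: ball_above_le[OF x])
next
  case (Suc n)
  have "has_jumps (\<lambda>u. at_node x u - at_node x s) (\<lambda>_. 0)"
    using has_jumps_diff[OF _ has_jumps_const, of "at_node x" "\<lambda>_. 0"] x
    by (simp add: ball_above_def no_jumps_def)
  moreover have "\<bar>at_node x u - at_node x s\<bar> \<le> 2" for u
    using ball_above_le[OF x, of u] ball_above_le[OF x, of s] by linarith
  ultimately show ?thesis unfolding Suc component.simps
    by (intro of_nodes_in_no_jumps[of _ 2, OF _ has_jumps_restrict_above]) auto
qed

lemma prefix_cases:
  obtains "\<not> prefix s u" | "u = s" | m t where "u = s @ m # t"
  by (metis prefixE append_Nil2 neq_Nil_conv)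

lemma at_node_component:
  assumes "u \<in> tree"
  shows "at_node (component s 0 x) u = (if prefix s u then at_node x s else 0)"
    "at_node (component s (Suc n) x) u = (if prefix (s @ [n]) u then at_node x u - at_node x s else 0)"
  using assms by simp_all

lemma component_remainder_in_no_jumps:
  assumes x: "x \<in> ball_above s"
  shows "(\<lambda>k. x k - (\<Sum>n<N. component s n x k)) \<in> no_jumps"
proof -
  have c: "component s n x \<in> no_jumps" for n by (rule component_in_no_jumps[OF x])
  have S: "finsum NJ (\<lambda>n. component s n x) {..<N} \<in> no_jumps"
    using NJ.M.finsum_closed[of "\<lambda>n. component s n x" "{..<N}"] c by auto
  then have "x \<ominus>\<^bsub>NJ\<^esub> finsum NJ (\<lambda>n. component s n x) {..<N} \<in> no_jumps"
    using NJ.M.minus_closed[of x] x by (simp add: ball_above_def)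
  then show ?thesis using S x c by (simp add: finsum_NJ ball_above_def)
qed

text \<open>
  What is left after the children with last entry below \<open>M\<close> are the differences between
  \<open>at_node x s\<close> and the values above the other children, which are small by continuity at \<open>s\<close>.
\<close>

lemma component_norm_null:
  assumes s: "s \<in> tree" and x: "x \<in> ball_above s"
  shows "(\<lambda>N. nrm tree_space (\<lambda>k. x k - (\<Sum>n<N. component s n x k))) \<longlonglongrightarrow> 0"
proof (rule LIMSEQ_I)
  fix e :: real assume "e > 0"
  have xT: "x \<in> carrier tree_space" and j: "has_jumps (at_node x) (\<lambda>_. 0)"
    using x by (simp_all add: ball_above_def no_jumps_def)
  obtain N where N: "\<And>m t. m \<ge> N \<Longrightarrow> s @ m # t \<in> tree \<Longrightarrow> \<bar>at_node x (s @ m # t) - at_node x s\<bar> < e / 2"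
    using has_jumpsD[OF j s, of "e / 2"] \<open>e > 0\<close> by (auto simp: jump_def)
  have le: "nrm tree_space (\<lambda>k. x k - (\<Sum>n<Suc M. component s n x k)) \<le> e / 2" if M: "M \<ge> N" for M
  proof (rule tree_space_nrm_le)
    show "(\<lambda>k. x k - (\<Sum>n<Suc M. component s n x k)) \<in> carrier tree_space"
      using component_remainder_in_no_jumps[OF x, of "Suc M"] by (simp only: no_jumps_iff)
    fix u assume u: "u \<in> tree"
    have "at_node (\<lambda>k. x k - (\<Sum>n<Suc M. component s n x k)) u
        = at_node x u - (\<Sum>n<Suc M. at_node (component s n x) u)"
      by (simp add: at_node_def)
    also have "\<dots> = at_node x u - (if prefix s u then at_node x s else 0)
        - (\<Sum>n<M. if prefix (s @ [n]) u then at_node x u - at_node x s else 0)"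
      unfolding sum.lessThan_Suc_shift at_node_component[OF u] by simp
    finally have eq: "at_node (\<lambda>k. x k - (\<Sum>n<Suc M. component s n x k)) u
        = at_node x u - (if prefix s u then at_node x s else 0)
        - (\<Sum>n<M. if prefix (s @ [n]) u then at_node x u - at_node x s else 0)" .
    show "\<bar>at_node (\<lambda>k. x k - (\<Sum>n<Suc M. component s n x k)) u\<bar> \<le> e / 2"
    proof (cases rule: prefix_cases[of s u])
      case 1
      then have "\<not> prefix (s @ [n]) u" for n by (metis append_prefixD)
      then show ?thesis unfolding eq using 1 x \<open>e > 0\<close> by (simp add: ball_above_def)
    next
      case 2
      then show ?thesis unfolding eq using \<open>e > 0\<close> by simp
    next
      case (3 m t)
      have "(\<Sum>n<M. if prefix (s @ [n]) u then at_node x u - at_node x s else 0)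
          = (\<Sum>n<M. if n = m then at_node x u - at_node x s else 0)"
        unfolding 3 by (intro sum.cong) auto
      then show ?thesis
        unfolding eq using N[of m t] u 3 M \<open>e > 0\<close> by (cases "m < M") (auto simp: sum.delta)
    qed
  qed
  have "norm (nrm tree_space (\<lambda>k. x k - (\<Sum>n<M. component s n x k)) - 0) < e" if M: "M \<ge> Suc N" for M
  proof -
    obtain M' where M': "M = Suc M'" "M' \<ge> N" using M by (cases M) auto
    have "0 \<le> nrm tree_space (\<lambda>k. x k - (\<Sum>n<M. component s n x k))"
      using component_remainder_in_no_jumps[OF x, of M] by (intro TS.nrm_nonneg) (simp only: no_jumps_iff)
    then show ?thesis using le[OF M'(2)] \<open>e > 0\<close> unfolding M'(1) by (simp del: sum.lessThan_Suc)
  qed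
  then show "\<exists>M0. \<forall>M\<ge>M0. norm (nrm tree_space (\<lambda>k. x k - (\<Sum>n<M. component s n x k)) - 0) < e" by blast
qed

text \<open>
  At every node at most two summands are nonzero: the constant one, which is bounded by 1, and the
  one for the child of \<open>s\<close> on the way to that node, which is bounded by 2.
\<close>

lemma component_signed_sums_bounded:
  assumes y: "\<And>n. y n \<in> ball_above s" and c: "\<And>n. \<bar>c n\<bar> \<le> 1"
  shows "nrm tree_space (\<lambda>k. \<Sum>n<N. c n * component s n (y n) k) \<le> 3"
proof (rule tree_space_nrm_le)
  have mem: "(\<lambda>k. c n * component s n (y n) k) \<in> no_jumps" for n
    using component_in_no_jumps[OF y, of n n] NJ.smult_closed[of "c n" "component s n (y n)"] by simp
  have "finsum NJ (\<lambda>n k. c n * component s n (y n) k) {..<N} \<in> carrier NJ"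
    using mem by (intro NJ.M.finsum_closed) auto
  then show "(\<lambda>k. \<Sum>n<N. c n * component s n (y n) k) \<in> carrier tree_space"
    unfolding finsum_NJ[OF mem] by (simp add: no_jumps_iff)
  fix u assume u: "u \<in> tree"
  have "\<bar>\<Sum>n<N. c n * at_node (component s n (y n)) u\<bar> \<le> 3"
  proof (cases N)
    case (Suc M)
    let ?g = "\<lambda>n. c (Suc n) * (at_node (y (Suc n)) u - at_node (y (Suc n)) s)"
    have le: "\<bar>c n * z\<bar> \<le> r" if "\<bar>z\<bar> \<le> r" for n z r
      using mult_mono[OF c[of n] that] that by (simp add: abs_mult)
    have eq: "(\<Sum>n<N. c n * at_node (component s n (y n)) u)
        = c 0 * (if prefix s u then at_node (y 0) s else 0) + (\<Sum>n<M. if prefix (s @ [n]) u then ?g n else 0)"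
      unfolding Suc sum.lessThan_Suc_shift at_node_component[OF u] by (simp add: if_distrib cong: if_cong)
    have 0: "\<bar>c 0 * (if prefix s u then at_node (y 0) s else 0)\<bar> \<le> 1"
      using ball_above_le[OF y] by (intro le) simp
    have g: "\<bar>?g n\<bar> \<le> 2" for n
      using ball_above_le[OF y[of "Suc n"], of u] ball_above_le[OF y[of "Suc n"], of s] by (intro le) linarith
    have "\<bar>\<Sum>n<M. if prefix (s @ [n]) u then ?g n else 0\<bar> \<le> 2"
    proof (cases rule: prefix_cases[of s u])
      case 1
      then have "\<not> prefix (s @ [n]) u" for n by (metis append_prefixD)
      then show ?thesis by simp
    next
      case (3 m t)
      have "(\<Sum>n<M. if prefix (s @ [n]) u then ?g n else 0) = (\<Sum>n<M. if n = m then ?g n else 0)"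
        unfolding 3 by (intro sum.cong) auto
      then show ?thesis using g[of m] by (auto simp: sum.delta)
    qed simp
    then show ?thesis unfolding eq using 0 by linarith
  qed simp
  then show "\<bar>at_node (\<lambda>k. \<Sum>n<N. c n * component s n (y n) k) u\<bar> \<le> 3" by (simp add: at_node_def)
qed

lemma (in bounded_linear_between) T_zero: "T \<zero>\<^bsub>V\<^esub> = \<zero>\<^bsub>W\<^esub>"
  using T_smult[of "\<zero>\<^bsub>V\<^esub>" 0] by simp

text \<open>
  The induction step along the tree: the unconditional decomposition of functions above \<open>s\<close>
  reduces the claim to constant functions and to functions above the children of \<open>s\<close>.
\<close>

lemma precompact_image_ball_above_step:
  assumes "bounded_linear_between NJ W T"
    and q: "1 \<le> q" and T: "unconditionally_converging q NJ W T" and s: "s \<in> tree"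
    and children: "\<And>n. s @ [n] \<in> tree \<Longrightarrow> normed_space.precompact W (T ` ball_above (s @ [n]))"
  shows "normed_space.precompact W (T ` ball_above s)"
proof -
  interpret bounded_linear_between NJ W T by fact
  have B: "x \<in> no_jumps" if "x \<in> ball_above v" for x v using that by (simp add: ball_above_def)
  have comp: "component s n x \<in> no_jumps" if "x \<in> ball_above s" for n x
    using component_in_no_jumps that .
  show ?thesis
  proof (rule precompact_image_if_unconditional_decomposition[where P = "component s" and C = 3, OF q T])
    show "ball_above s \<subseteq> carrier NJ" using B by auto
    fix n x assume "x \<in> ball_above s"
    then show "component s n x \<in> carrier NJ" using comp by simp
  next
    fix x assume x: "x \<in> ball_above s"
    have "finsum NJ (\<lambda>n. component s n x) {..<N} \<in> no_jumps" for N :: nat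
      using NJ.M.finsum_closed[of "\<lambda>n. component s n x" "{..<N}"] comp[OF x] by auto
    then show "(\<lambda>N. nrm NJ (x \<ominus>\<^bsub>NJ\<^esub> finsum NJ (\<lambda>n. component s n x) {..<N})) \<longlonglongrightarrow> 0"
      using component_norm_null[OF s x] B[OF x] comp[OF x] by (simp add: finsum_NJ)
  next
    fix y :: "nat \<Rightarrow> nat \<Rightarrow> real" and c :: "nat \<Rightarrow> real" and N
    assume y: "\<And>n. y n \<in> ball_above s" and c: "\<And>n. \<bar>c n\<bar> \<le> 1"
    have "(\<lambda>k. c n * component s n (y n) k) \<in> no_jumps" for n
      using comp[OF y, of n n] NJ.smult_closed[of "c n" "component s n (y n)"] by simp
    then show "nrm NJ (finsum NJ (\<lambda>n. c n \<odot>\<^bsub>NJ\<^esub> component s n (y n)) {..<N}) \<le> 3"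
      using component_signed_sums_bounded[OF y c, where N = N] by (simp add: finsum_NJ)
  next
    fix n
    show "W.precompact (T ` component s n ` ball_above s)"
    proof (cases n)
      case 0
      let ?v = "of_nodes (\<lambda>u. if prefix s u then 1 else 0)"
      have v: "?v \<in> no_jumps"
        by (rule of_nodes_in_no_jumps[of _ 1, OF _ has_jumps_restrict_above[OF has_jumps_const]]) simp
      have "T (component s 0 x) = at_node x s \<odot>\<^bsub>W\<^esub> T ?v" for x
      proof -
        have "component s 0 x = at_node x s \<odot>\<^bsub>NJ\<^esub> ?v" by (auto simp: fun_eq_iff of_nodes_def)
        then show ?thesis using v T_smult[of ?v "at_node x s"] by simp
      qed
      then have "T ` component s n ` ball_above s \<subseteq> {t \<odot>\<^bsub>W\<^esub> T ?v | t. \<bar>t\<bar> \<le> 1}"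
        using ball_above_le 0 by auto
      then show ?thesis using v by (intro W.precompact_subset[OF W.precompact_segment]) auto
    next
      case (Suc n')
      show ?thesis
      proof (cases "s @ [n'] \<in> tree")
        case False
        have "component s n x = \<zero>\<^bsub>NJ\<^esub>" for x
        proof -
          have "\<not> prefix (s @ [n']) u" if "u \<in> tree" for u
            using False tree_prefix that unfolding prefix_def by blast
          then show ?thesis by (auto simp: Suc fun_eq_iff of_nodes_def)
        qed
        then have "T ` component s n ` ball_above s \<subseteq> {\<zero>\<^bsub>W\<^esub>}" using T_zero by auto
        then show ?thesis by (rule W.precompact_subset[OF W.precompact_zero])
      next
        case True
        have "T ` component s n ` ball_above s \<subseteq> (\<odot>\<^bsub>W\<^esub>) 2 ` T ` ball_above (s @ [n'])"
        proof clarify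
          fix x assume x: "x \<in> ball_above s"
          \<comment> \<open>The component has norm up to 2, so half of it lies in the ball above the child.\<close>
          define z where "z = (\<lambda>k. 1/2 * component s n x k)"
          have zN: "z \<in> no_jumps"
            using NJ.smult_closed[of "1/2" "component s n x"] comp[OF x] by (simp add: z_def)
          have zu: "at_node z u = 1/2 * at_node (component s n x) u" for u
            unfolding z_def by (rule at_node_cmult)
          have "\<bar>at_node z u\<bar> \<le> 1" for u
            using ball_above_le[OF x, of u] ball_above_le[OF x, of s] by (auto simp: zu Suc abs_le_iff)
          then have "nrm tree_space z \<le> 1" using zN by (intro tree_space_nrm_le) (auto simp: no_jumps_def)
          moreover have "at_node z u = 0" if "\<not> prefix (s @ [n']) u" for u using that by (simp add: zu Suc)
          ultimately have "z \<in> ball_above (s @ [n'])" using zN by (simp add: ball_above_def)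
          moreover have "component s n x = 2 \<odot>\<^bsub>NJ\<^esub> z" by (simp add: z_def)
          then have "T (component s n x) = 2 \<odot>\<^bsub>W\<^esub> T z" using zN T_smult[of z 2] by simp
          ultimately show "T (component s n x) \<in> (\<odot>\<^bsub>W\<^esub>) 2 ` T ` ball_above (s @ [n'])" by blast
        qed
        then show ?thesis by (rule W.precompact_subset[OF W.precompact_smult[OF children[OF True]]])
      qed
    qed
  qed
qed

text \<open>
  Unconditionally converging operators are even compact: above a nonempty node \<open>s\<close> the tree has
  height \<open>hd s + 2 - length s\<close>, which is the measure of an induction; the root, above which
  heights are unbounded, is reached by one more step.
\<close>

theorem property_V_no_jumps:
  assumes q: "1 \<le> q" shows "property_V q NJ"
  unfolding property_V_def
proof (intro conjI allI impI)
  show "banach_space NJ" by (rule banach_space_subspace_of[OF banach_space_tree_space closed_subspace_no_jumps])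
  fix Y :: "(nat \<Rightarrow> nat \<Rightarrow> real) nvs" and T
  assume "banach_space Y \<and> bounded_operator NJ Y T \<and> unconditionally_converging q NJ Y T"
  then have Y: "banach_space Y" and bd: "bounded_operator NJ Y T" and T: "unconditionally_converging q NJ Y T"
    by auto
  interpret Y: normed_space Y using Y by (simp add: banach_space_def)
  interpret bounded_linear_between NJ Y T by unfold_locales (rule bd)
  have step: "Y.precompact (T ` ball_above s)"
    if "s \<in> tree" "\<And>n. s @ [n] \<in> tree \<Longrightarrow> Y.precompact (T ` ball_above (s @ [n]))" for s
    using precompact_image_ball_above_step[OF bounded_linear_between_axioms q T] that .
  have "Y.precompact (T ` ball_above s)" if "s \<in> tree" "s \<noteq> []" for s
    using that
  proof (induction "hd s + 2 - length s" arbitrary: s rule: less_induct)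
    case less
    have "Y.precompact (T ` ball_above (s @ [n]))" if "s @ [n] \<in> tree" for n
      using that less.prems by (intro less.hyps) (auto simp: tree_snoc_iff)
    then show ?case by (rule step[OF less.prems(1)])
  qed
  then have "Y.precompact (T ` ball_above [])" by (intro step[OF Nil_in_tree]) auto
  moreover have "ball_above [] = {x \<in> carrier NJ. nrm NJ x \<le> 1}" by (auto simp: ball_above_def)
  ultimately show "weakly_compact_operator NJ Y T"
    using precompact_image_imp_weakly_compact_operator[OF Y] by simp
qed

section \<open>The quotient has property (V)\<close>

interpretation NS: normed_space_subspace tree_space no_jumps
  by (rule normed_space_subspace.intro[OF TS.normed_space_axioms
        normed_space_subspace_axioms.intro[OF submodule_no_jumps]])

interpretation Q: normed_space NS.Q
  by (rule NS.normed_space_Q[OF closed_subspace_no_jumps])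

text \<open>
  A coset consists of all functions with the same jumps, so the quotient is a copy of \<open>c\<^sub>0\<close>: the
  class of \<open>a\<close> has a norm between the supremum norm of \<open>a\<close> and twice that norm.
\<close>

definition jump_class :: "(nat \<Rightarrow> real) \<Rightarrow> (nat \<Rightarrow> real) set" where
  "jump_class a = no_jumps +>\<^bsub>tree_space\<^esub> of_nodes (lift a)"

lemma lift_in_tree_space:
  assumes a: "a \<longlonglongrightarrow> 0"
  shows "of_nodes (lift a) \<in> carrier tree_space" "jumps (of_nodes (lift a)) = a"
proof -
  obtain B where "\<And>j. \<bar>a j\<bar> \<le> B"
    using convergent_imp_Bseq[OF convergentI[OF a]] unfolding Bseq_def real_norm_def by blast
  then have "\<bar>lift a s\<bar> \<le> 2 * B" if "s \<in> tree" for s using that by (intro lift_le sorted_tree)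
  from of_nodes_in_tree_space[OF this has_jumps_lift[OF a] a]
  show "of_nodes (lift a) \<in> carrier tree_space" "jumps (of_nodes (lift a)) = a" by simp_all
qed

lemma nrm_lift_le:
  assumes a: "a \<longlonglongrightarrow> 0" and B: "\<And>j. \<bar>a j\<bar> \<le> B"
  shows "nrm tree_space (of_nodes (lift a)) \<le> 2 * B"
  using B by (intro of_nodes_in_tree_space(3)[OF _ has_jumps_lift[OF a] a] lift_le sorted_tree)

lemma coset_eq_iff_jumps:
  assumes x: "x \<in> carrier tree_space" and y: "y \<in> carrier tree_space"
  shows "no_jumps +>\<^bsub>tree_space\<^esub> x = no_jumps +>\<^bsub>tree_space\<^esub> y \<longleftrightarrow> jumps x = jumps y"
proof
  assume "no_jumps +>\<^bsub>tree_space\<^esub> x = no_jumps +>\<^bsub>tree_space\<^esub> y"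
  then have "x \<in> no_jumps +>\<^bsub>tree_space\<^esub> y" using NS.coset_self[OF x] by simp
  then obtain h where "h \<in> no_jumps" "x = (\<lambda>n. h n + y n)" by (auto simp: NS.coset_iff)
  then show "jumps x = jumps y" using y by (simp add: jumps_add no_jumps_iff)
next
  assume "jumps x = jumps y"
  then have "(\<lambda>n. x n - y n) \<in> no_jumps"
    using x y TS.M.minus_closed[OF x y] by (simp add: no_jumps_iff jumps_diff)
  then have "x \<in> no_jumps +>\<^bsub>tree_space\<^esub> y"
    by (auto simp: NS.coset_iff intro!: bexI[of _ "\<lambda>n. x n - y n"])
  then show "no_jumps +>\<^bsub>tree_space\<^esub> x = no_jumps +>\<^bsub>tree_space\<^esub> y" by (rule NS.coset_eqI[OF _ y])
qed

lemma coset_eq_jump_class: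
  assumes "x \<in> carrier tree_space" shows "no_jumps +>\<^bsub>tree_space\<^esub> x = jump_class (jumps x)"
  unfolding jump_class_def using assms tree_space_jumps(2)[OF assms]
  by (simp add: coset_eq_iff_jumps lift_in_tree_space)

lemma jump_class_in_Q [simp]: "a \<longlonglongrightarrow> 0 \<Longrightarrow> jump_class a \<in> carrier NS.Q"
  by (simp add: jump_class_def lift_in_tree_space)

lemma jump_class_inject: "a \<longlonglongrightarrow> 0 \<Longrightarrow> b \<longlonglongrightarrow> 0 \<Longrightarrow> jump_class a = jump_class b \<Longrightarrow> a = b"
  using coset_eq_iff_jumps[of "of_nodes (lift a)" "of_nodes (lift b)"]
  by (simp add: jump_class_def lift_in_tree_space)

lemma Q_cases:
  assumes "C \<in> carrier NS.Q" obtains a where "a \<longlonglongrightarrow> 0" "C = jump_class a"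
  using assms coset_eq_jump_class tree_space_jumps(2) unfolding NS.carrier_Q by blast

lemma jump_class_add:
  assumes "a \<longlonglongrightarrow> 0" "b \<longlonglongrightarrow> 0" shows "jump_class a \<oplus>\<^bsub>NS.Q\<^esub> jump_class b = jump_class (\<lambda>k. a k + b k)"
proof -
  have "jump_class a \<oplus>\<^bsub>NS.Q\<^esub> jump_class b
      = no_jumps +>\<^bsub>tree_space\<^esub> (of_nodes (lift a) \<oplus>\<^bsub>tree_space\<^esub> of_nodes (lift b))"
    unfolding jump_class_def using assms by (intro NS.add_Q lift_in_tree_space)
  then show ?thesis
    using assms coset_eq_jump_class[OF TS.M.a_closed[of "of_nodes (lift a)" "of_nodes (lift b)"]]
    by (simp add: lift_in_tree_space jumps_add)
qed

lemma jump_class_smult: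
  assumes "a \<longlonglongrightarrow> 0" shows "c \<odot>\<^bsub>NS.Q\<^esub> jump_class a = jump_class (\<lambda>k. c * a k)"
proof -
  have "c \<odot>\<^bsub>NS.Q\<^esub> jump_class a = no_jumps +>\<^bsub>tree_space\<^esub> (c \<odot>\<^bsub>tree_space\<^esub> of_nodes (lift a))"
    unfolding jump_class_def using assms by (intro NS.smult_Q lift_in_tree_space)
  then show ?thesis
    using assms coset_eq_jump_class[OF TS.smult_closed[of c "of_nodes (lift a)"]]
    by (simp add: lift_in_tree_space jumps_cmult)
qed

lemma jump_class_zero: "\<zero>\<^bsub>NS.Q\<^esub> = jump_class (\<lambda>_. 0)"
  using coset_eq_jump_class[of "\<lambda>_. 0"] TS.M.zero_closed jumps_eq[of "\<lambda>_. 0" "\<lambda>_. 0"] has_jumps_zero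
  by (simp add: at_node_fun)

lemma null_seq_cmult: "a \<longlonglongrightarrow> 0 \<Longrightarrow> (\<lambda>k. c * a k) \<longlonglongrightarrow> (0 :: real)"
  using tendsto_mult_left[of a 0 sequentially c] by simp

lemma jump_class_diff:
  assumes "a \<longlonglongrightarrow> 0" "b \<longlonglongrightarrow> 0" shows "jump_class a \<ominus>\<^bsub>NS.Q\<^esub> jump_class b = jump_class (\<lambda>k. a k - b k)"
  using assms null_seq_cmult[OF assms(2), of "-1"]
  by (simp add: a_minus_def Q.a_inv_eq_smult jump_class_smult jump_class_add)

lemma nrm_jump_class_le:
  assumes "a \<longlonglongrightarrow> 0" "\<And>j. \<bar>a j\<bar> \<le> B" shows "nrm NS.Q (jump_class a) \<le> 2 * B"
proof -
  have "nrm NS.Q (jump_class a) \<le> nrm tree_space (of_nodes (lift a))"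
    using assms(1) NS.coset_self by (intro NS.nrm_Q_le) (auto simp: jump_class_def lift_in_tree_space)
  then show ?thesis using nrm_lift_le[OF assms] by simp
qed

lemma le_nrm_jump_class:
  assumes a: "a \<longlonglongrightarrow> 0" shows "\<bar>a k\<bar> \<le> nrm NS.Q (jump_class a)"
proof (rule NS.nrm_Q_greatest)
  show "jump_class a \<in> carrier NS.Q" using a by simp
  fix x assume x: "x \<in> jump_class a"
  then have xT: "x \<in> carrier tree_space"
    using NS.coset_subset lift_in_tree_space(1)[OF a] by (auto simp: jump_class_def)
  have "no_jumps +>\<^bsub>tree_space\<^esub> x = jump_class a"
    using x NS.coset_eqI lift_in_tree_space(1)[OF a] by (simp add: jump_class_def)
  then have "jumps x = a"
    using coset_eq_jump_class[OF xT] jump_class_inject[OF tree_space_jumps(2)[OF xT] a] by simp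
  then show "\<bar>a k\<bar> \<le> nrm tree_space x" using jumps_le_nrm[OF xT] by blast
qed

lemma finsum_jump_class:
  assumes "\<And>n :: nat. b n \<longlonglongrightarrow> 0"
  shows "finsum NS.Q (\<lambda>n. jump_class (b n)) {..<N} = jump_class (\<lambda>k. \<Sum>n<N. b n k)"
proof (induction N)
  case 0 then show ?case using jump_class_zero by simp
next
  case (Suc N)
  have "(\<lambda>k. \<Sum>n<N. b n k) \<longlonglongrightarrow> 0" using tendsto_sum[of "{..<N}" b "\<lambda>_. 0" sequentially] assms by simp
  then show ?case
    using Suc assms by (subst Q.finsum_lessThan_Suc) (auto simp: jump_class_add add.commute)
qed

definition coords :: "(nat \<Rightarrow> real) set \<Rightarrow> nat \<Rightarrow> real" where
  "coords C = (THE a. a \<longlonglongrightarrow> 0 \<and> C = jump_class a)"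

lemma coords_jump_class [simp]:
  assumes a: "a \<longlonglongrightarrow> 0" shows "coords (jump_class a) = a"
  unfolding coords_def
proof (rule the_equality)
  fix b assume "b \<longlonglongrightarrow> 0 \<and> jump_class a = jump_class b"
  then show "b = a" using jump_class_inject[OF a, of b] by simp
qed (use a in simp)

lemma coords_null: "C \<in> carrier NS.Q \<Longrightarrow> coords C \<longlonglongrightarrow> 0"
  by (erule Q_cases) simp

lemma coords_le: "C \<in> carrier NS.Q \<Longrightarrow> \<bar>coords C k\<bar> \<le> nrm NS.Q C"
  by (erule Q_cases) (simp add: le_nrm_jump_class)

lemma null_seq_finite_support: "(\<And>k. k \<ge> N \<Longrightarrow> b k = 0) \<Longrightarrow> b \<longlonglongrightarrow> (0 :: real)"
  by (rule tendsto_eventually) (auto simp: eventually_sequentially)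

definition coordinate_part :: "nat \<Rightarrow> (nat \<Rightarrow> real) set \<Rightarrow> (nat \<Rightarrow> real) set" where
  "coordinate_part n C = jump_class (\<lambda>k. if k = n then coords C n else 0)"

lemma null_seq_single: "(\<lambda>k. if k = n then c else 0) \<longlonglongrightarrow> (0 :: real)"
  by (rule null_seq_finite_support[of "Suc n"]) simp

lemma coordinate_norm_null:
  assumes C: "C \<in> carrier NS.Q"
  shows "(\<lambda>N. nrm NS.Q (C \<ominus>\<^bsub>NS.Q\<^esub> finsum NS.Q (\<lambda>n. coordinate_part n C) {..<N})) \<longlonglongrightarrow> 0"
proof (rule LIMSEQ_I)
  fix e :: real assume "e > 0"
  obtain a where a: "a \<longlonglongrightarrow> 0" "C = jump_class a" using C by (rule Q_cases)
  obtain N where N: "\<And>k. k \<ge> N \<Longrightarrow> \<bar>a k\<bar> < e / 4" using LIMSEQ_D[OF a(1), of "e / 4"] \<open>e > 0\<close> by auto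
  have "norm (nrm NS.Q (C \<ominus>\<^bsub>NS.Q\<^esub> finsum NS.Q (\<lambda>n. coordinate_part n C) {..<M}) - 0) < e"
    if M: "M \<ge> N" for M
  proof -
    have null: "(\<lambda>k. if k < M then a k else 0) \<longlonglongrightarrow> 0" by (rule null_seq_finite_support[of M]) simp
    have "finsum NS.Q (\<lambda>n. coordinate_part n C) {..<M} = jump_class (\<lambda>k. \<Sum>n<M. if k = n then coords C n else 0)"
      unfolding coordinate_part_def by (rule finsum_jump_class[OF null_seq_single])
    also have "\<dots> = jump_class (\<lambda>k. if k < M then a k else 0)" using a by (simp add: sum.delta' cong: if_cong)
    finally have eq: "C \<ominus>\<^bsub>NS.Q\<^esub> finsum NS.Q (\<lambda>n. coordinate_part n C) {..<M}
        = jump_class (\<lambda>k. a k - (if k < M then a k else 0))"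
      using a null by (simp add: jump_class_diff)
    have null': "(\<lambda>k. a k - (if k < M then a k else 0)) \<longlonglongrightarrow> 0" using tendsto_diff[OF a(1) null] by simp
    have "nrm NS.Q (jump_class (\<lambda>k. a k - (if k < M then a k else 0))) \<le> 2 * (e / 4)"
    proof (rule nrm_jump_class_le[OF null'])
      fix j show "\<bar>a j - (if j < M then a j else 0)\<bar> \<le> e / 4" using N[of j] M \<open>e > 0\<close> by auto
    qed
    then show ?thesis using \<open>e > 0\<close> Q.nrm_nonneg[OF jump_class_in_Q[OF null']] unfolding eq by simp
  qed
  then show "\<exists>N. \<forall>M\<ge>N. norm (nrm NS.Q (C \<ominus>\<^bsub>NS.Q\<^esub> finsum NS.Q (\<lambda>n. coordinate_part n C) {..<M}) - 0) < e"
    by blast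
qed

text \<open>
  The coordinates form an unconditional decomposition into lines; a signed sum of coordinate parts
  of elements of the unit ball is the class of a sequence bounded by 1.
\<close>

theorem property_V_Q:
  assumes q: "1 \<le> q" shows "property_V q NS.Q"
  unfolding property_V_def
proof (intro conjI allI impI)
  show "banach_space NS.Q" by (rule banach_space_quotient_space[OF banach_space_tree_space closed_subspace_no_jumps])
  fix Y :: "(nat \<Rightarrow> (nat \<Rightarrow> real) set) nvs" and T
  assume "banach_space Y \<and> bounded_operator NS.Q Y T \<and> unconditionally_converging q NS.Q Y T"
  then have Y: "banach_space Y" and bd: "bounded_operator NS.Q Y T" and T: "unconditionally_converging q NS.Q Y T"
    by auto
  interpret Y: normed_space Y using Y by (simp add: banach_space_def)
  interpret bounded_linear_between NS.Q Y T by unfold_locales (rule bd)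
  let ?B = "{C \<in> carrier NS.Q. nrm NS.Q C \<le> 1}"
  have "Y.precompact (T ` ?B)"
  proof (rule precompact_image_if_unconditional_decomposition[where P = coordinate_part and C = 2, OF q T])
    fix y :: "nat \<Rightarrow> (nat \<Rightarrow> real) set" and c :: "nat \<Rightarrow> real" and N
    assume y: "\<And>n. y n \<in> ?B" and c: "\<And>n. \<bar>c n\<bar> \<le> 1"
    define b where "b n = (\<lambda>k. if k = n then c n * coords (y n) n else 0)" for n
    have "c n \<odot>\<^bsub>NS.Q\<^esub> coordinate_part n (y n) = jump_class (b n)" for n
      unfolding coordinate_part_def b_def by (subst jump_class_smult[OF null_seq_single]) (simp add: if_distrib cong: if_cong)
    then have "finsum NS.Q (\<lambda>n. c n \<odot>\<^bsub>NS.Q\<^esub> coordinate_part n (y n)) {..<N} = jump_class (\<lambda>k. \<Sum>n<N. b n k)"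
      using finsum_jump_class[of b N] null_seq_single by (simp add: b_def)
    also have "(\<lambda>k. \<Sum>n<N. b n k) = (\<lambda>k. if k < N then c k * coords (y k) k else 0)"
      by (simp add: b_def sum.delta')
    finally have eq: "finsum NS.Q (\<lambda>n. c n \<odot>\<^bsub>NS.Q\<^esub> coordinate_part n (y n)) {..<N}
        = jump_class (\<lambda>k. if k < N then c k * coords (y k) k else 0)" .
    have le: "\<bar>c k * coords (y k) k\<bar> \<le> 1" for k
    proof -
      have "\<bar>coords (y k) k\<bar> \<le> 1" using coords_le[of "y k" k] y[of k] by simp
      then show ?thesis using mult_mono[OF c[of k]] by (fastforce simp: abs_mult)
    qed
    have "nrm NS.Q (jump_class (\<lambda>k. if k < N then c k * coords (y k) k else 0)) \<le> 2 * 1"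
      using le by (intro nrm_jump_class_le null_seq_finite_support[of N]) auto
    then show "nrm NS.Q (finsum NS.Q (\<lambda>n. c n \<odot>\<^bsub>NS.Q\<^esub> coordinate_part n (y n)) {..<N}) \<le> 2"
      unfolding eq by simp
  next
    fix n
    let ?v = "jump_class (\<lambda>k. if k = n then 1 else 0)"
    have "T (coordinate_part n C) = coords C n \<odot>\<^bsub>Y\<^esub> T ?v" for C
    proof -
      have "coordinate_part n C = coords C n \<odot>\<^bsub>NS.Q\<^esub> ?v"
        unfolding coordinate_part_def by (subst jump_class_smult[OF null_seq_single]) (simp add: if_distrib cong: if_cong)
      then show ?thesis using T_smult[OF jump_class_in_Q[OF null_seq_single]] by simp
    qed
    moreover have "\<bar>coords C n\<bar> \<le> 1" if "C \<in> ?B" for C using coords_le[of C n] that by simp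
    ultimately have "T ` coordinate_part n ` ?B \<subseteq> {t \<odot>\<^bsub>Y\<^esub> T ?v | t. \<bar>t\<bar> \<le> 1}" by blast
    then show "Y.precompact (T ` coordinate_part n ` ?B)"
      by (rule Y.precompact_subset[OF Y.precompact_segment[OF T_mem[OF jump_class_in_Q[OF null_seq_single]]]])
  qed (use coordinate_norm_null in \<open>auto simp: coordinate_part_def null_seq_single\<close>)
  then show "weakly_compact_operator NS.Q Y T"
    by (rule precompact_image_imp_weakly_compact_operator[OF Y])
qed

section \<open>The quotient map is unconditionally converging but not weakly compact\<close>

lemma at_node_in_dual_ball: "(\<lambda>x. at_node x s) \<in> dual_ball tree_space"
  unfolding dual_ball_def dual_def using at_node_le_nrm by (auto intro!: exI[of _ 1])

lemma jumps_in_dual: "(\<lambda>x. jumps x k) \<in> dual tree_space"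
  unfolding dual_def using jumps_le_nrm by (auto simp: jumps_add jumps_cmult intro!: exI[of _ 1])

lemma coords_in_dual: "(\<lambda>C. coords C k) \<in> dual NS.Q"
proof -
  have "coords (C \<oplus>\<^bsub>NS.Q\<^esub> D) k = coords C k + coords D k"
    if C: "C \<in> carrier NS.Q" and D: "D \<in> carrier NS.Q" for C D
  proof -
    obtain a b where "a \<longlonglongrightarrow> 0" "C = jump_class a" "b \<longlonglongrightarrow> 0" "D = jump_class b" using C D by (meson Q_cases)
    then show ?thesis using tendsto_add[of a 0 sequentially b 0] by (simp add: jump_class_add)
  qed
  moreover have "coords (c \<odot>\<^bsub>NS.Q\<^esub> C) k = c * coords C k" if "C \<in> carrier NS.Q" for c C
    using that by (elim Q_cases) (simp add: jump_class_smult null_seq_cmult)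
  ultimately show ?thesis unfolding dual_def using coords_le by (auto intro!: exI[of _ 1])
qed

lemma coordinatewise_null_if_weakly_summable:
  assumes q: "1 \<le> q" and y: "weakly_summable q tree_space y"
  shows "(\<lambda>j. jumps (y j) k) \<longlonglongrightarrow> 0"
proof (rule LIMSEQ_I)
  fix e :: real assume e: "e > 0"
  have "summable (\<lambda>j. \<bar>jumps (y j) k\<bar> powr q)"
    using y jumps_in_dual by (auto simp: weakly_summable_def)
  then have "(\<lambda>j. \<bar>jumps (y j) k\<bar> powr q) \<longlonglongrightarrow> 0" by (rule summable_LIMSEQ_zero)
  then have "eventually (\<lambda>j. \<bar>jumps (y j) k\<bar> powr q < e powr q) sequentially"
    using e by (intro order_tendstoD) auto
  then obtain N where "\<And>j. j \<ge> N \<Longrightarrow> \<bar>jumps (y j) k\<bar> powr q < e powr q"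
    unfolding eventually_sequentially by blast
  then have "\<bar>jumps (y j) k\<bar> < e" if "j \<ge> N" for j
    using that powr_mono2[of q e "\<bar>jumps (y j) k\<bar>"] e q by (meson less_imp_le not_le order_trans zero_le_one)
  then show "\<exists>N. \<forall>j\<ge>N. norm (jumps (y j) k - 0) < e" by auto
qed

text \<open>
  The node is built entry by entry, and each new entry adds one function with a large value at all
  nodes that extend the branch suitably. Given \<open>N\<close>, some \<open>j\<close> has a jump above \<open>d\<close> at an index
  \<open>k \<ge> N\<close>, because each single coordinate tends to 0 in \<open>j\<close>. The next entry \<open>m\<close> has the index \<open>k\<close>
  and the parity that the earlier functions ask for. At the new node \<open>y j\<close> jumps up or down by
  more than \<open>d\<close> according to the parity of the entry after \<open>m\<close>, and one of the two directions
  leads away from 0. As the first entry is at least \<open>R\<close>, the tree allows \<open>R\<close> such steps and one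
  more.
\<close>

lemma node_with_many_large_values:
  fixes y :: "nat \<Rightarrow> nat \<Rightarrow> real"
  assumes y: "\<And>j. y j \<in> carrier tree_space" and d: "d > 0"
    and coordwise: "\<And>k. (\<lambda>j. jumps (y j) k) \<longlonglongrightarrow> 0"
    and large: "\<And>K. \<exists>j\<ge>K. \<exists>k. d < \<bar>jumps (y j) k\<bar>"
  shows "\<exists>s\<in>tree. \<exists>J. finite J \<and> card J = R \<and> (\<forall>j\<in>J. d / 2 < \<bar>at_node (y j) s\<bar>)"
proof -
  define stable where "stable s p N j \<longleftrightarrow> (\<forall>m\<ge>N. even m = p \<longrightarrow> (\<forall>t. s @ m # t \<in> tree \<longrightarrow>
      d / 2 < \<bar>at_node (y j) (s @ m # t)\<bar>))" for s :: "nat list" and p and N :: nat and j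
  have nodes: "\<exists>s p N J. s \<in> tree \<and> length s = i \<and> (\<forall>k\<in>set s. R \<le> k \<and> k \<le> N) \<and> R \<le> N \<and>
      finite J \<and> card J = i \<and> (\<forall>j\<in>J. stable s p N j)" if "i \<le> R" for i
    using that
  proof (induction i)
    case 0
    show ?case by (intro exI[of _ "[]"] exI[of _ True] exI[of _ R] exI[of _ "{}"]) simp
  next
    case (Suc i)
    then obtain s p N J where s: "s \<in> tree" "length s = i" "\<And>k. k \<in> set s \<Longrightarrow> R \<le> k \<and> k \<le> N" "R \<le> N"
      and J: "finite J" "card J = i" "\<And>j. j \<in> J \<Longrightarrow> stable s p N j"
      by (metis Suc_leD)
    have "eventually (\<lambda>j. \<forall>k\<in>{..<N}. \<bar>jumps (y j) k\<bar> < d) sequentially"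
    proof (intro eventually_ball_finite ballI)
      fix k
      show "eventually (\<lambda>j. \<bar>jumps (y j) k\<bar> < d) sequentially"
        using tendsto_rabs[OF coordwise[of k]] d by (intro order_tendstoD) auto
    qed simp
    then obtain K where K: "\<And>j k. j \<ge> K \<Longrightarrow> k < N \<Longrightarrow> \<bar>jumps (y j) k\<bar> < d"
      unfolding eventually_sequentially by auto
    obtain j k where j: "j \<ge> max K (Suc (\<Sum>J))" "d < \<bar>jumps (y j) k\<bar>" using large by blast
    have "k \<ge> N" using K[of j k] j by force
    have "j \<notin> J" using member_le_sum[of j J "\<lambda>j. j"] J(1) j(1) by auto
    \<comment> \<open>Index \<open>k\<close>, and the parity that keeps the values of the earlier functions large.\<close>
    define m where "m = (if p then 2 * k else 2 * k + 1)"
    have m: "m \<ge> N" "even m = p" "m div 2 = k" using \<open>k \<ge> N\<close> by (auto simp: m_def)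
    have hd: "R \<le> hd s" if "s \<noteq> []" using s(3)[OF hd_in_set[OF that]] by simp
    have le_m: "k \<le> m" if "k \<in> set s" for k using s(3)[OF that] m(1) by simp
    have "s = [] \<or> length s < hd s + 2" using hd s(2) Suc.prems by (cases "s = []") auto
    then have s': "s @ [m] \<in> tree" unfolding tree_snoc_iff using s(1) le_m by simp
    obtain N1 where N1: "\<And>m' t. m' \<ge> N1 \<Longrightarrow> (s @ [m]) @ m' # t \<in> tree \<Longrightarrow>
        \<bar>at_node (y j) ((s @ [m]) @ m' # t) - at_node (y j) (s @ [m]) - (-1) ^ m' * jumps (y j) k\<bar> < d / 2"
      using has_jumpsD[OF tree_space_jumps(1)[OF y] s', of "d / 2" j] d by (auto simp: jump_def m(3))
    \<comment> \<open>The direction of the jump that leads away from 0.\<close>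
    define p' where "p' \<longleftrightarrow> 0 \<le> at_node (y j) (s @ [m]) * jumps (y j) k"
    have "stable (s @ [m]) p' (N1 + m) j"
      unfolding stable_def
    proof (intro allI impI)
      fix m' t assume m': "m' \<ge> N1 + m" "even m' = p'" "(s @ [m]) @ m' # t \<in> tree"
      have "d < \<bar>at_node (y j) (s @ [m]) + (-1) ^ m' * jumps (y j) k\<bar>"
      proof (cases p')
        case True
        then have "even m'" using m'(2) by simp
        then show ?thesis using True j(2) by (auto simp: p'_def zero_le_mult_iff abs_if split: if_splits)
      next
        case False
        then have "odd m'" using m'(2) by simp
        then show ?thesis using False j(2) by (auto simp: p'_def zero_le_mult_iff abs_if split: if_splits)
      qed
      then show "d / 2 < \<bar>at_node (y j) ((s @ [m]) @ m' # t)\<bar>" using N1[of m' t] m'(1,3) by linarith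
    qed
    moreover have "stable (s @ [m]) p' (N1 + m) l" if "l \<in> J" for l
    proof -
      have "d / 2 < \<bar>at_node (y l) (s @ m # t)\<bar>" if "s @ m # t \<in> tree" for t
        using J(3)[OF \<open>l \<in> J\<close>] m(1,2) that by (simp add: stable_def)
      then show ?thesis unfolding stable_def by simp
    qed
    ultimately have "\<forall>l\<in>insert j J. stable (s @ [m]) p' (N1 + m) l" by simp
    moreover have "\<forall>k\<in>set (s @ [m]). R \<le> k \<and> k \<le> N1 + m"
    proof
      fix k assume "k \<in> set (s @ [m])"
      then consider "k \<in> set s" | "k = m" by auto
      then show "R \<le> k \<and> k \<le> N1 + m"
        by cases (use s(3)[of k] s(4) m(1) in auto)
    qed
    moreover have "R \<le> N1 + m" "card (insert j J) = Suc i" "finite (insert j J)"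
      using s(4) m(1) J(1,2) \<open>j \<notin> J\<close> by auto
    ultimately show ?case
      using s' s(2) by (intro exI[of _ "s @ [m]"] exI[of _ p'] exI[of _ "N1 + m"] exI[of _ "insert j J"]) simp
  qed
  from nodes[OF order_refl] obtain s p N J where s: "s \<in> tree" "length s = R" "\<And>k. k \<in> set s \<Longrightarrow> R \<le> k \<and> k \<le> N"
    and J: "finite J" "card J = R" "\<And>j. j \<in> J \<Longrightarrow> stable s p N j"
    by blast
  define m where "m = (if p then 2 * N else 2 * N + 1)"
  have m: "m \<ge> N" "even m = p" by (auto simp: m_def)
  have "R \<le> hd s" if "s \<noteq> []" using s(3)[OF hd_in_set[OF that]] by simp
  then have "s = [] \<or> length s < hd s + 2" using s(2) by (cases "s = []") auto
  moreover have "k \<le> m" if "k \<in> set s" for k using s(3)[OF that] m(1) by simp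
  ultimately have "s @ [m] \<in> tree" unfolding tree_snoc_iff using s(1) by simp
  then have "\<forall>j\<in>J. d / 2 < \<bar>at_node (y j) (s @ [m])\<bar>" using J(3) m by (simp add: stable_def)
  then show ?thesis using \<open>s @ [m] \<in> tree\<close> J(1,2) by blast
qed

text \<open>
  At a node where \<open>R\<close> of the functions exceed \<open>d / 2\<close>, evaluation is a functional in the dual ball
  whose \<open>q\<close>-sum is at least \<open>R * (d / 2) powr q\<close>; for large \<open>R\<close> this contradicts the uniform
  bound.
\<close>

lemma jumps_uniformly_null_if_weakly_summable:
  assumes q: "1 \<le> q" and y: "weakly_summable q tree_space y" and d: "d > 0"
  shows "\<exists>K. \<forall>j\<ge>K. \<forall>k. \<bar>jumps (y j) k\<bar> \<le> d"
proof (rule ccontr)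
  assume "\<not> ?thesis"
  then have large: "\<exists>j\<ge>K. \<exists>k. d < \<bar>jumps (y j) k\<bar>" for K by (meson not_le)
  have yT: "y j \<in> carrier tree_space" for j using y by (auto simp: weakly_summable_def)
  obtain M where M: "\<And>f n. f \<in> dual_ball tree_space \<Longrightarrow> (\<Sum>j<n. \<bar>f (y j)\<bar> powr q) \<le> M"
    using TS.weakly_summable_uniform_bound[OF q y] by blast
  have dq: "0 < (d / 2) powr q" using d by simp
  then obtain R where R: "M < real R * (d / 2) powr q" using reals_Archimedean3 by blast
  obtain s J where J: "finite J" "card J = R" "\<And>j. j \<in> J \<Longrightarrow> d / 2 < \<bar>at_node (y j) s\<bar>"
    using node_with_many_large_values[OF yT d coordinatewise_null_if_weakly_summable[OF q y] large, of R] by blast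
  obtain n where n: "J \<subseteq> {..<n}" using finite_nat_bounded[OF J(1)] by blast
  have "real R * (d / 2) powr q = (\<Sum>j\<in>J. (d / 2) powr q)" using J(2) by simp
  also have "\<dots> \<le> (\<Sum>j\<in>J. \<bar>at_node (y j) s\<bar> powr q)"
    using J(3) d q by (intro sum_mono powr_mono2) (auto intro: less_imp_le)
  also have "\<dots> \<le> (\<Sum>j<n. \<bar>at_node (y j) s\<bar> powr q)" using n by (intro sum_mono2) auto
  also have "\<dots> \<le> M" by (rule M[OF at_node_in_dual_ball])
  finally show False using R by simp
qed

abbreviation quotient_map :: "(nat \<Rightarrow> real) \<Rightarrow> (nat \<Rightarrow> real) set" where
  "quotient_map x \<equiv> no_jumps +>\<^bsub>tree_space\<^esub> x"

lemma bounded_operator_quotient_map: "bounded_operator tree_space NS.Q quotient_map"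
  unfolding bounded_operator_def
proof (intro conjI ballI allI)
  show "quotient_map \<in> carrier tree_space \<rightarrow> carrier NS.Q" by auto
  fix x y assume "x \<in> carrier tree_space" "y \<in> carrier tree_space"
  then show "quotient_map (x \<oplus>\<^bsub>tree_space\<^esub> y) = quotient_map x \<oplus>\<^bsub>NS.Q\<^esub> quotient_map y"
    by (rule NS.add_Q[symmetric])
next
  fix c x assume "x \<in> carrier tree_space"
  then show "quotient_map (c \<odot>\<^bsub>tree_space\<^esub> x) = c \<odot>\<^bsub>NS.Q\<^esub> quotient_map x"
    by (rule NS.smult_Q[symmetric])
next
  show "\<exists>K. \<forall>x\<in>carrier tree_space. nrm NS.Q (quotient_map x) \<le> K * nrm tree_space x"
  proof (intro exI[of _ 1] ballI)
    fix x assume x: "x \<in> carrier tree_space"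
    then show "nrm NS.Q (quotient_map x) \<le> 1 * nrm tree_space x"
      using NS.nrm_Q_le[OF NS.coset_in_Q[OF x] NS.coset_self[OF x]] by simp
  qed
qed

interpretation QM: bounded_linear_between tree_space NS.Q quotient_map
  by (rule bounded_linear_between.intro[OF TS.normed_space_axioms Q.normed_space_axioms
        bounded_linear_between_axioms.intro[OF bounded_operator_quotient_map]])

lemma unconditionally_converging_quotient_map:
  assumes q: "1 \<le> q" shows "unconditionally_converging q tree_space NS.Q quotient_map"
proof (rule QM.unconditionally_convergingI_norm_null[OF q])
  fix y assume y: "weakly_summable q tree_space y"
  have yT: "y j \<in> carrier tree_space" for j using y by (auto simp: weakly_summable_def)
  show "(\<lambda>k. nrm NS.Q (quotient_map (y k))) \<longlonglongrightarrow> 0"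
  proof (rule LIMSEQ_I)
    fix e :: real assume e: "e > 0"
    obtain K where K: "\<And>j k. j \<ge> K \<Longrightarrow> \<bar>jumps (y j) k\<bar> \<le> e / 4"
      using jumps_uniformly_null_if_weakly_summable[OF q y, of "e / 4"] e by auto
    have "nrm NS.Q (quotient_map (y j)) \<le> 2 * (e / 4)" if "j \<ge> K" for j
      unfolding coset_eq_jump_class[OF yT] by (rule nrm_jump_class_le[OF tree_space_jumps(2)[OF yT] K[OF that]])
    then show "\<exists>K. \<forall>j\<ge>K. norm (nrm NS.Q (quotient_map (y j)) - 0) < e"
      using e Q.nrm_nonneg[OF NS.coset_in_Q[OF yT]] by (intro exI[of _ K]) fastforce
  qed
qed

text \<open>
  The classes of the sequences with \<open>n\<close> initial entries 1/2 lie in the image of the unit ball. The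
  weakly open sets \<open>U k\<close> of classes with coordinate \<open>k\<close> below 1/3 cover the quotient, but finitely
  many of them miss such a class.
\<close>

lemma not_weakly_compact_quotient_map: "\<not> weakly_compact_operator tree_space NS.Q quotient_map"
proof
  define A where "A = quotient_map ` {x \<in> carrier tree_space. nrm tree_space x \<le> 1}"
  define U where "U k = {C \<in> carrier NS.Q. coords C k \<in> {..<1/3}}" for k
  assume "weakly_compact_operator tree_space NS.Q quotient_map"
  then have comp: "compactin (weak_topology NS.Q) (weak_topology NS.Q closure_of A)"
    by (simp add: weakly_compact_operator_def A_def)
  have "openin (weak_topology NS.Q) (U k)" for k
    unfolding weak_topology_def U_def
    by (intro topology_generated_by_Basis CollectI exI[of _ "\<lambda>C. coords C k"] exI[of _ "{..<1/3}"])
       (simp add: coords_in_dual)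
  moreover have "weak_topology NS.Q closure_of A \<subseteq> \<Union>(range U)"
  proof
    fix C assume "C \<in> weak_topology NS.Q closure_of A"
    then have "C \<in> topspace (weak_topology NS.Q)"
      using closure_of_subset_topspace[of "weak_topology NS.Q" A] by (rule subsetD[rotated])
    then have C: "C \<in> carrier NS.Q" by simp
    have "eventually (\<lambda>k. coords C k < 1/3) sequentially"
      using coords_null[OF C] by (rule order_tendstoD) simp
    then obtain k where "coords C k < 1/3" by (auto simp: eventually_sequentially)
    then show "C \<in> \<Union>(range U)" using C by (auto simp: U_def)
  qed
  ultimately obtain F where F: "finite F" "F \<subseteq> range U" "weak_topology NS.Q closure_of A \<subseteq> \<Union>F"
    using compactinD[OF comp, of "range U"] by auto
  obtain I where I: "finite I" "F = U ` I" using finite_subset_image[OF F(1,2)] by auto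
  obtain n where n: "I \<subseteq> {..<n}" using finite_nat_bounded[OF I(1)] by blast
  define a :: "nat \<Rightarrow> real" where "a k = (if k < n then 1/2 else 0)" for k
  have a: "a \<longlonglongrightarrow> 0" by (rule null_seq_finite_support[of n]) (simp add: a_def)
  have "nrm tree_space (of_nodes (lift a)) \<le> 2 * (1/2)" by (rule nrm_lift_le[OF a]) (simp add: a_def)
  then have "jump_class a \<in> A" unfolding A_def jump_class_def using lift_in_tree_space(1)[OF a] by simp
  moreover have "A \<subseteq> topspace (weak_topology NS.Q)" unfolding A_def by auto
  ultimately have "jump_class a \<in> weak_topology NS.Q closure_of A"
    using closure_of_subset[of A "weak_topology NS.Q"] by blast
  then have "jump_class a \<in> \<Union>F" by (rule subsetD[OF F(3)])
  then obtain k where "k \<in> I" "coords (jump_class a) k < 1/3" by (auto simp: I U_def)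
  then show False using n a by (auto simp: a_def)
qed

theorem theorem2p8:
  fixes q :: real
  assumes "1 \<le> q"
  shows "\<exists>(X :: (nat \<Rightarrow> real) nvs) X\<^sub>0.
           banach_space X \<and> closed_subspace X X\<^sub>0 \<and>
           property_V q (subspace_of X X\<^sub>0) \<and>
           property_V q (quotient_space X X\<^sub>0) \<and>
           \<not> property_V q X"
proof (intro exI conjI)
  show "banach_space tree_space" by (rule banach_space_tree_space)
  show "closed_subspace tree_space no_jumps" by (rule closed_subspace_no_jumps)
  show "property_V q NJ" by (rule property_V_no_jumps[OF assms])
  show Q: "property_V q NS.Q" by (rule property_V_Q[OF assms])
  show "\<not> property_V q tree_space"
  proof
    assume "property_V q tree_space"
    then have "weakly_compact_operator tree_space NS.Q quotient_map"
      using Q bounded_operator_quotient_map unconditionally_converging_quotient_map[OF assms]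
      by (intro property_V_every_codomain) (auto simp: property_V_def)
    then show False using not_weakly_compact_quotient_map by contradiction
  qed
qed

end
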